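(* Let $\Bbbk$ be a field and $G$ a finite group with a fixed decomposition $G=G_0\times G_1\times\cdots\times G_n$, where $G_0$ is abelian and $G_1,\dots,G_n$ are indecomposable non-abelian groups. Let $R=(u,r,p,v)$ be a quasitriangular structure of $\mathcal D(G)$ with associated set $E\subseteq\{1,\dots,n\}$, and let $\Psi_R\in\operatorname{End}(\mathcal D(G_E))$ be the associated endomorphism. Then $F(\tau(R)R)$ and $\Psi_R$ have the same image (the underlying spaces of $\mathcal D(G)$ and $\mathcal D(G_E)$ being identified by the canonical isomorphism). Therefore $R$ is factorizable if and only if $\Psi_R\in\operatorname{Aut}(\mathcal D(G_E))$.
   Context: Double. For a finite group $K$, $\Bbbk^K$ is the algebra of functions $K\to\Bbbk$ with basis $e_g$ ($e_g(h)=\delta_{g,h}$) and unit $1=\varepsilon=\sum_g e_g$; $\Bbbk^{K\,\mathrm{co}}$ is the Hopf algebra $\Bbbk^K$ with opposite coproduct, $\Delta(e_x)=\sum_{s\in K}e_s\otimes e_{xs^{-1}}$. $K$ acts by conjugation: $g\rightharpoonup e_x=e_{gxg^{-1}}$. $\mathcal D(K)$ is $\Bbbk^{K\,\mathrm{co}}\otimes\Bbbk K$ as a coalgebra, with elements $f\bowtie g$ and product $(f\bowtie g)(f'\bowtie g')=f(g\rightharpoonup f')\bowtie gg'$. Quasitriangular structures. For a Hopf algebra $H$ with flip $\tau$, a quasitriangular structure is $R\in H\otimes H$ with $(\Delta\otimes\mathrm{id})(R)=R^{13}R^{23}$, $(\mathrm{id}\otimes\Delta)(R)=R^{13}R^{12}$,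 $(\varepsilon\otimes\mathrm{id})(R)=1=(\mathrm{id}\otimes\varepsilon)(R)$ (such $R$ is invertible) and $R\Delta(h)=\tau(\Delta(h))R$ for all $h\in H$. For $T\in H\otimes H$ let $F(T):H^*\to H$, $F(T)(\phi)=(\phi\otimes\mathrm{id})(T)$. $(H,R)$ (or $R$) is factorizable if $F(\tau(R)R)$ is bijective. Components. Let $f\# g\in\mathcal D(G)^*$ be the functional $e_s\bowtie h\mapsto\delta_{s,g}f(h)$. Write $R=(u,r,p,v)$, where, with $(\mathrm{id}\otimes\varepsilon)(f\bowtie g)=f$ and $(\mathrm{ev}_1\otimes\mathrm{id})(f\bowtie g)=f(1)g$: $u(f)=(\mathrm{id}\otimes\varepsilon)F(R)(f\#1)$, $r(g)=(\mathrm{id}\otimes\varepsilon)F(R)(\varepsilon\# g)$, $p(f)=(\mathrm{ev}_1\otimes\mathrm{id})F(R)(f\#1)$, $v(g)=(\mathrm{ev}_1\otimes\mathrm{id})F(R)(\varepsilon\# g)$. A superscript $*$ denotes the linear transpose, so $u^*:\Bbbk G\to\Bbbk G$, $v^*:\Bbbk^G\to\Bbbk^G$, $r^*:\Bbbk G\to\Bbbk^G$, $p^*:\Bbbk^G\to\Bbbk G$. It is known (classification of quasitriangular structures of $\mathcal D(G)$) that $u^*$ and $Sv:g\mapsto v(g)^{-1}$ are endomorphisms of $G$ commuting with all inner automorphisms, and that for each $1\le i\le n$, writing $w_i=\pi_i w\iota_i$ ($\iota_i:G_i\to G$, $\pi_i:G\to G_i$ canonical), exactly one of these holds: (a) $u_i^*$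 is a central automorphism of $G_i$ and $Sv_i\in\operatorname{Hom}(G_i,Z(G_i))$; (b) $Sv_i$ is a central automorphism of $G_i$ and $u_i^*\in\operatorname{Hom}(G_i,Z(G_i))$. (An automorphism $w$ is central if $x^{-1}w(x)\in Z$ for all $x$.) The set $E$ associated to $R$ is the set of $i\in\{1,\dots,n\}$ for which (a) holds. The group $G_E$ and $\Psi_R$. $G_E=G_0\times\prod_{i\in E}G_i\times\bigl(\prod_{i\ge1,\,i\notin E}G_i\bigr)^{\mathrm{op}}$; it has the same underlying set as $G$. The canonical isomorphism $\theta:G\to G_E$ is the identity on $G_0$ and on $G_i$, $i\in E$, and is inversion on $G_i$, $i\ge1$, $i\notin E$; it induces a Hopf algebra isomorphism $\Theta:\mathcal D(G)\to\mathcal D(G_E)$, $e_y\bowtie x\mapsto e_{\theta(y)}\bowtie\theta(x)$, used to identify these algebras. The matrix $$\Psi_R=\begin{pmatrix} v^*+u& r^*+r\\ p^*+p&u^*+v\end{pmatrix},$$ where $+$ is convolution product, denotes the linear map $\mathcal D(G_E)\to\mathcal D(G)$ given on $\Bbbk^G\otimes\Bbbk G$ by $f\bowtie x\mapsto (r^*+r)(x)\,(v^*+u)(f_{(1)})\bowtie(p^*+p)(f_{(2)})\,(u^*+v)(x)$, so that $(u^*+v)(x)=u^*(x)v(x)$ and $(r^*+r)(x)=r^*(x)r(x)$; composing with $\Theta$ it becomes the endomorphism $\Psi_R$ of the Hopf algebra $\mathcal D(G_E)$. Equality of images means that the image of this map in $\mathcal D(G)$ equals the image of $F(\tau(R)R)$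 in $\mathcal D(G)$. *)

theory Defs
  imports "HOL-Algebra.Product_Groups"
begin

section \<open>Finite-dimensional bialgebras with a distinguished basis\<close>

text \<open>
  The vector space with finite basis \<open>B\<close> is the set of functions \<open>'b \<Rightarrow> 'k\<close> that vanish outside
  \<open>B\<close>; a basis vector \<open>b\<close> is \<open>\<delta> b\<close>. The tensor product of the spaces on \<open>B\<close> and \<open>C\<close> is the space on
  \<open>B \<times> C\<close>. A linear functional \<open>\<phi>\<close> is represented by its values on the basis, so the dual space
  is again \<open>vecs B\<close>. The record holds the structure maps on basis vectors; they are extended
  (bi)linearly below. It is shared by algebras, coalgebras and bialgebras, and carries no axioms.
\<close>

record ('b, 'k) bialg =
  basis :: "'b set"
  bmult :: "'b \<Rightarrow> 'b \<Rightarrow> 'b \<Rightarrow> 'k"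
  bunit :: "'b \<Rightarrow> 'k"
  bcomult :: "'b \<Rightarrow> 'b \<times> 'b \<Rightarrow> 'k"
  bcounit :: "'b \<Rightarrow> 'k"

definition vecs :: "'b set \<Rightarrow> ('b \<Rightarrow> 'k::field) set" where
  "vecs B = {a. \<forall>b. b \<notin> B \<longrightarrow> a b = 0}"

definition \<delta> :: "'b \<Rightarrow> 'b \<Rightarrow> 'k::field" where
  "\<delta> x = (\<lambda>y. if y = x then 1 else 0)"

definition tens :: "('b \<Rightarrow> 'k::field) \<Rightarrow> ('c \<Rightarrow> 'k) \<Rightarrow> 'b \<times> 'c \<Rightarrow> 'k" where
  "tens a b = (\<lambda>(x, y). a x * b y)"

definition mul :: "('b, 'k::field) bialg \<Rightarrow> ('b \<Rightarrow> 'k) \<Rightarrow> ('b \<Rightarrow> 'k) \<Rightarrow> 'b \<Rightarrow> 'k" where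
  "mul H a b = (\<lambda>z. \<Sum>x\<in>basis H. \<Sum>y\<in>basis H. a x * b y * bmult H x y z)"

definition comul :: "('b, 'k::field) bialg \<Rightarrow> ('b \<Rightarrow> 'k) \<Rightarrow> 'b \<times> 'b \<Rightarrow> 'k" where
  "comul H a = (\<lambda>z. \<Sum>x\<in>basis H. a x * bcomult H x z)"

definition counit :: "('b, 'k::field) bialg \<Rightarrow> ('b \<Rightarrow> 'k) \<Rightarrow> 'k" where
  "counit H a = (\<Sum>x\<in>basis H. a x * bcounit H x)"

definition tensor :: "('b, 'k::field) bialg \<Rightarrow> ('c, 'k) bialg \<Rightarrow> ('b \<times> 'c, 'k) bialg" where
  "tensor A B = \<lparr>
     basis = basis A \<times> basis B,
     bmult = (\<lambda>(x, y) (x', y'). tens (bmult A x x') (bmult B y y')),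
     bunit = tens (bunit A) (bunit B),
     bcomult = (\<lambda>(x, y) ((x\<^sub>1, y\<^sub>1), (x\<^sub>2, y\<^sub>2)). bcomult A x (x\<^sub>1, x\<^sub>2) * bcomult B y (y\<^sub>1, y\<^sub>2)),
     bcounit = (\<lambda>(x, y). bcounit A x * bcounit B y)\<rparr>"

text \<open>Convolution product of linear maps from the coalgebra \<open>C\<close> to the algebra \<open>A\<close>:
  \<open>c \<mapsto> \<phi>(c\<^sub>1) \<psi>(c\<^sub>2)\<close>.\<close>

definition conv :: "('c, 'k::field) bialg \<Rightarrow> ('b, 'k) bialg \<Rightarrow>
    (('c \<Rightarrow> 'k) \<Rightarrow> 'b \<Rightarrow> 'k) \<Rightarrow> (('c \<Rightarrow> 'k) \<Rightarrow> 'b \<Rightarrow> 'k) \<Rightarrow> ('c \<Rightarrow> 'k) \<Rightarrow> 'b \<Rightarrow> 'k" where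
  "conv C A \<phi> \<psi> c =
     (\<lambda>z. \<Sum>(x, y)\<in>basis C \<times> basis C. comul C c (x, y) * mul A (\<phi> (\<delta> x)) (\<psi> (\<delta> y)) z)"

text \<open>The transpose of a linear map from the space on \<open>B\<close> to the space on \<open>C\<close>.\<close>

definition transp :: "'b set \<Rightarrow> 'c set \<Rightarrow> (('b \<Rightarrow> 'k::field) \<Rightarrow> 'c \<Rightarrow> 'k) \<Rightarrow> ('c \<Rightarrow> 'k) \<Rightarrow> 'b \<Rightarrow> 'k" where
  "transp B C L \<phi> = (\<lambda>x. if x \<in> B then \<Sum>y\<in>C. \<phi> y * L (\<delta> x) y else 0)"

definition linear_end :: "'b set \<Rightarrow> (('b \<Rightarrow> 'k::field) \<Rightarrow> 'b \<Rightarrow> 'k) \<Rightarrow> bool" where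
  "linear_end B L \<longleftrightarrow>
     (\<forall>a\<in>vecs B. L a \<in> vecs B) \<and>
     (\<forall>a\<in>vecs B. \<forall>b\<in>vecs B. L (\<lambda>x. a x + b x) = (\<lambda>x. L a x + L b x)) \<and>
     (\<forall>c. \<forall>a\<in>vecs B. L (\<lambda>x. c * a x) = (\<lambda>x. c * L a x))"

definition tensor_map :: "'b set \<Rightarrow> (('b \<Rightarrow> 'k::field) \<Rightarrow> 'b \<Rightarrow> 'k) \<Rightarrow> (('b \<Rightarrow> 'k) \<Rightarrow> 'b \<Rightarrow> 'k) \<Rightarrow>
    ('b \<times> 'b \<Rightarrow> 'k) \<Rightarrow> 'b \<times> 'b \<Rightarrow> 'k" where
  "tensor_map B L M t = (\<lambda>z. \<Sum>(x, y)\<in>B \<times> B. t (x, y) * tens (L (\<delta> x)) (M (\<delta> y)) z)"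

text \<open>Endomorphisms and automorphisms of a Hopf algebra. The antipode is not mentioned because every
  bialgebra map between Hopf algebras preserves it.\<close>

definition Hopf_End :: "('b, 'k::field) bialg \<Rightarrow> (('b \<Rightarrow> 'k) \<Rightarrow> 'b \<Rightarrow> 'k) set" where
  "Hopf_End H = {L. linear_end (basis H) L \<and>
     (\<forall>a\<in>vecs (basis H). \<forall>b\<in>vecs (basis H). L (mul H a b) = mul H (L a) (L b)) \<and>
     L (bunit H) = bunit H \<and>
     (\<forall>a\<in>vecs (basis H). comul H (L a) = tensor_map (basis H) L L (comul H a)) \<and>
     (\<forall>a\<in>vecs (basis H). counit H (L a) = counit H a)}"

definition Hopf_Aut :: "('b, 'k::field) bialg \<Rightarrow> (('b \<Rightarrow> 'k) \<Rightarrow> 'b \<Rightarrow> 'k) set" where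
  "Hopf_Aut H = {L \<in> Hopf_End H. bij_betw L (vecs (basis H)) (vecs (basis H))}"


section \<open>Quasitriangular structures\<close>

definition flip :: "('b \<times> 'b \<Rightarrow> 'k) \<Rightarrow> 'b \<times> 'b \<Rightarrow> 'k" where
  "flip T = (\<lambda>(x, y). T (y, x))"

text \<open>\<open>H \<otimes> H \<otimes> H\<close> is bracketed to the right.\<close>

definition leg12 :: "('b, 'k::field) bialg \<Rightarrow> ('b \<times> 'b \<Rightarrow> 'k) \<Rightarrow> 'b \<times> 'b \<times> 'b \<Rightarrow> 'k" where
  "leg12 H R = (\<lambda>(x, y, z). R (x, y) * bunit H z)"

definition leg13 :: "('b, 'k::field) bialg \<Rightarrow> ('b \<times> 'b \<Rightarrow> 'k) \<Rightarrow> 'b \<times> 'b \<times> 'b \<Rightarrow> 'k" where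
  "leg13 H R = (\<lambda>(x, y, z). R (x, z) * bunit H y)"

definition leg23 :: "('b, 'k::field) bialg \<Rightarrow> ('b \<times> 'b \<Rightarrow> 'k) \<Rightarrow> 'b \<times> 'b \<times> 'b \<Rightarrow> 'k" where
  "leg23 H R = (\<lambda>(x, y, z). R (y, z) * bunit H x)"

definition quasitriangular :: "('b, 'k::field) bialg \<Rightarrow> ('b \<times> 'b \<Rightarrow> 'k) \<Rightarrow> bool" where
  "quasitriangular H R \<longleftrightarrow>
     R \<in> vecs (basis H \<times> basis H) \<and>
     (\<lambda>(x, y, z). comul H (\<lambda>w. R (w, z)) (x, y)) = mul (tensor H (tensor H H)) (leg13 H R) (leg23 H R) \<and>
     (\<lambda>(x, y, z). comul H (\<lambda>w. R (x, w)) (y, z)) = mul (tensor H (tensor H H)) (leg13 H R) (leg12 H R) \<and>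
     (\<lambda>y. counit H (\<lambda>x. R (x, y))) = bunit H \<and>
     (\<lambda>x. counit H (\<lambda>y. R (x, y))) = bunit H \<and>
     (\<forall>h\<in>vecs (basis H).
        mul (tensor H H) R (comul H h) = mul (tensor H H) (flip (comul H h)) R)"

text \<open>\<open>F(T)(\<phi>) = (\<phi> \<otimes> id)(T)\<close>\<close>

definition F_map :: "('b, 'k::field) bialg \<Rightarrow> ('b \<times> 'b \<Rightarrow> 'k) \<Rightarrow> ('b \<Rightarrow> 'k) \<Rightarrow> 'b \<Rightarrow> 'k" where
  "F_map H T \<phi> = (\<lambda>y. \<Sum>x\<in>basis H. \<phi> x * T (x, y))"

definition monodromy :: "('b, 'k::field) bialg \<Rightarrow> ('b \<times> 'b \<Rightarrow> 'k) \<Rightarrow> 'b \<times> 'b \<Rightarrow> 'k" where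
  "monodromy H R = mul (tensor H H) (flip R) R"

text \<open>The first \<open>vecs (basis H)\<close> is the dual of \<open>H\<close>, the second is \<open>H\<close>.\<close>

definition factorizable :: "('b, 'k::field) bialg \<Rightarrow> ('b \<times> 'b \<Rightarrow> 'k) \<Rightarrow> bool" where
  "factorizable H R \<longleftrightarrow>
     bij_betw (F_map H (monodromy H R)) (vecs (basis H)) (vecs (basis H))"


section \<open>The double of a finite group\<close>

text \<open>\<open>fun_co K\<close> is the function algebra on \<open>K\<close> with the opposite coproduct and basis \<open>e\<^sub>x = \<delta> x\<close>;
  \<open>grp_alg K\<close> is the group algebra. Both have \<open>carrier K\<close> as basis.\<close>

definition fun_co :: "('g, 'm) monoid_scheme \<Rightarrow> ('g, 'k::field) bialg" where
  "fun_co K = \<lparr>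
     basis = carrier K,
     bmult = (\<lambda>x y. if x = y then \<delta> x else (\<lambda>_. 0)),
     bunit = (\<lambda>x. if x \<in> carrier K then 1 else 0),
     bcomult = (\<lambda>x z. \<Sum>s\<in>carrier K. tens (\<delta> s) (\<delta> (x \<otimes>\<^bsub>K\<^esub> inv\<^bsub>K\<^esub> s)) z),
     bcounit = \<delta> \<one>\<^bsub>K\<^esub>\<rparr>"

definition grp_alg :: "('g, 'm) monoid_scheme \<Rightarrow> ('g, 'k::field) bialg" where
  "grp_alg K = \<lparr>
     basis = carrier K,
     bmult = (\<lambda>g h. \<delta> (g \<otimes>\<^bsub>K\<^esub> h)),
     bunit = \<delta> \<one>\<^bsub>K\<^esub>,
     bcomult = (\<lambda>g. tens (\<delta> g) (\<delta> g)),
     bcounit = (\<lambda>g. 1)\<rparr>"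

definition conj_act :: "('g, 'm) monoid_scheme \<Rightarrow> 'g \<Rightarrow> ('g \<Rightarrow> 'k::field) \<Rightarrow> 'g \<Rightarrow> 'k" where
  "conj_act K g f = (\<lambda>y. \<Sum>x\<in>carrier K. f x * \<delta> (g \<otimes>\<^bsub>K\<^esub> x \<otimes>\<^bsub>K\<^esub> inv\<^bsub>K\<^esub> g) y)"

text \<open>The basis element \<open>(x, g)\<close> of the double is \<open>e\<^sub>x \<bowtie> g\<close>, and in general \<open>f \<bowtie> a\<close> is \<open>tens f a\<close>.\<close>

definition double :: "('g, 'm) monoid_scheme \<Rightarrow> ('g \<times> 'g, 'k::field) bialg" where
  "double K = (tensor (fun_co K) (grp_alg K))
     \<lparr>bmult := (\<lambda>(x, g) (y, h). tens (mul (fun_co K) (\<delta> x) (conj_act K g (\<delta> y))) (\<delta> (g \<otimes>\<^bsub>K\<^esub> h)))\<rparr>"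


section \<open>Components of an element of the tensor square of the double\<close>

text \<open>For \<open>a = \<delta> g\<close> this is the functional \<open>f # g\<close> sending \<open>e\<^sub>s \<bowtie> h\<close> to \<open>\<delta>\<^sub>s\<^sub>,\<^sub>g f(h)\<close>; it is extended
  linearly in \<open>g\<close>.\<close>

definition sharp :: "('g \<Rightarrow> 'k::field) \<Rightarrow> ('g \<Rightarrow> 'k) \<Rightarrow> 'g \<times> 'g \<Rightarrow> 'k" where
  "sharp f a = (\<lambda>(s, h). a s * f h)"

definition id_counit :: "('g, 'm) monoid_scheme \<Rightarrow> ('g \<times> 'g \<Rightarrow> 'k::field) \<Rightarrow> 'g \<Rightarrow> 'k" where
  "id_counit K a = (\<lambda>x. counit (grp_alg K) (\<lambda>g. a (x, g)))"

definition ev_id :: "('g, 'm) monoid_scheme \<Rightarrow> ('g \<times> 'g \<Rightarrow> 'k::field) \<Rightarrow> 'g \<Rightarrow> 'k" where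
  "ev_id K a = (\<lambda>g. a (\<one>\<^bsub>K\<^esub>, g))"

definition u_of :: "('g, 'm) monoid_scheme \<Rightarrow> (('g \<times> 'g) \<times> ('g \<times> 'g) \<Rightarrow> 'k::field) \<Rightarrow>
    ('g \<Rightarrow> 'k) \<Rightarrow> 'g \<Rightarrow> 'k" where
  "u_of K R f = id_counit K (F_map (double K) R (sharp f (\<delta> \<one>\<^bsub>K\<^esub>)))"

definition r_of :: "('g, 'm) monoid_scheme \<Rightarrow> (('g \<times> 'g) \<times> ('g \<times> 'g) \<Rightarrow> 'k::field) \<Rightarrow>
    ('g \<Rightarrow> 'k) \<Rightarrow> 'g \<Rightarrow> 'k" where
  "r_of K R a = id_counit K (F_map (double K) R (sharp (bunit (fun_co K)) a))"

definition p_of :: "('g, 'm) monoid_scheme \<Rightarrow> (('g \<times> 'g) \<times> ('g \<times> 'g) \<Rightarrow> 'k::field) \<Rightarrow>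
    ('g \<Rightarrow> 'k) \<Rightarrow> 'g \<Rightarrow> 'k" where
  "p_of K R f = ev_id K (F_map (double K) R (sharp f (\<delta> \<one>\<^bsub>K\<^esub>)))"

definition v_of :: "('g, 'm) monoid_scheme \<Rightarrow> (('g \<times> 'g) \<times> ('g \<times> 'g) \<Rightarrow> 'k::field) \<Rightarrow>
    ('g \<Rightarrow> 'k) \<Rightarrow> 'g \<Rightarrow> 'k" where
  "v_of K R a = ev_id K (F_map (double K) R (sharp (bunit (fun_co K)) a))"

abbreviation group_transp :: "('g, 'm) monoid_scheme \<Rightarrow> (('g \<Rightarrow> 'k::field) \<Rightarrow> 'g \<Rightarrow> 'k) \<Rightarrow>
    ('g \<Rightarrow> 'k) \<Rightarrow> 'g \<Rightarrow> 'k" where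
  "group_transp K L \<equiv> transp (carrier K) (carrier K) L"

text \<open>The linear map \<open>f \<bowtie> x \<mapsto> \<beta>(x) \<alpha>(f\<^sub>1) \<bowtie> \<gamma>(f\<^sub>2) \<eta>(x)\<close> given by the matrix with rows
  \<open>(\<alpha>, \<beta>)\<close> and \<open>(\<gamma>, \<eta>)\<close>. The Sweedler components of \<open>f\<close> and the convolutions in \<open>Psi_map\<close> are taken
  with respect to the coproduct of \<open>fun_co K\<close> (not of the twisted group \<open>G_E\<close>, on whose double
  the map is viewed as being defined).\<close>

definition matrix_map :: "('g, 'm) monoid_scheme \<Rightarrow>
    (('g \<Rightarrow> 'k::field) \<Rightarrow> 'g \<Rightarrow> 'k) \<Rightarrow> (('g \<Rightarrow> 'k) \<Rightarrow> 'g \<Rightarrow> 'k) \<Rightarrow>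
    (('g \<Rightarrow> 'k) \<Rightarrow> 'g \<Rightarrow> 'k) \<Rightarrow> (('g \<Rightarrow> 'k) \<Rightarrow> 'g \<Rightarrow> 'k) \<Rightarrow>
    ('g \<times> 'g \<Rightarrow> 'k) \<Rightarrow> 'g \<times> 'g \<Rightarrow> 'k" where
  "matrix_map K \<alpha> \<beta> \<gamma> \<eta> a = (\<lambda>z. \<Sum>x\<in>carrier K. \<Sum>(s, t)\<in>carrier K \<times> carrier K.
     comul (fun_co K) (\<lambda>y. a (y, x)) (s, t) *
     tens (mul (fun_co K) (\<beta> (\<delta> x)) (\<alpha> (\<delta> s))) (mul (grp_alg K) (\<gamma> (\<delta> t)) (\<eta> (\<delta> x))) z)"

definition Psi_map :: "('g, 'm) monoid_scheme \<Rightarrow> (('g \<times> 'g) \<times> ('g \<times> 'g) \<Rightarrow> 'k::field) \<Rightarrow>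
    ('g \<times> 'g \<Rightarrow> 'k) \<Rightarrow> 'g \<times> 'g \<Rightarrow> 'k" where
  "Psi_map K R = matrix_map K
     (conv (fun_co K) (fun_co K) (group_transp K (v_of K R)) (u_of K R))
     (conv (grp_alg K) (fun_co K) (group_transp K (r_of K R)) (r_of K R))
     (conv (fun_co K) (grp_alg K) (group_transp K (p_of K R)) (p_of K R))
     (conv (grp_alg K) (grp_alg K) (group_transp K (u_of K R)) (v_of K R))"


section \<open>Decomposed groups\<close>

definition centre :: "('a, 'm) monoid_scheme \<Rightarrow> 'a set" where
  "centre K = {z \<in> carrier K. \<forall>x\<in>carrier K. z \<otimes>\<^bsub>K\<^esub> x = x \<otimes>\<^bsub>K\<^esub> z}"

definition indecomposable_group :: "('a, 'm) monoid_scheme \<Rightarrow> bool" where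
  "indecomposable_group K \<longleftrightarrow> group K \<and> carrier K \<noteq> {\<one>\<^bsub>K\<^esub>} \<and>
     (\<forall>A B. A \<lhd> K \<and> B \<lhd> K \<and> A \<inter> B = {\<one>\<^bsub>K\<^esub>} \<and> A <#>\<^bsub>K\<^esub> B = carrier K
        \<longrightarrow> A = {\<one>\<^bsub>K\<^esub>} \<or> B = {\<one>\<^bsub>K\<^esub>})"

definition central_aut :: "('a, 'm) monoid_scheme \<Rightarrow> ('a \<Rightarrow> 'a) \<Rightarrow> bool" where
  "central_aut K w \<longleftrightarrow> w \<in> iso K K \<and> (\<forall>x\<in>carrier K. inv\<^bsub>K\<^esub> x \<otimes>\<^bsub>K\<^esub> w x \<in> centre K)"

definition op_group :: "'a monoid \<Rightarrow> 'a monoid" where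
  "op_group K = K\<lparr>monoid.mult := (\<lambda>x y. y \<otimes>\<^bsub>K\<^esub> x)\<rparr>"

text \<open>The map of groups underlying a linear map between group algebras that sends group elements to
  group elements (unspecified at \<open>g\<close> if the image of \<open>g\<close> is not a group element).\<close>

definition on_group :: "(('g \<Rightarrow> 'k::field) \<Rightarrow> 'g \<Rightarrow> 'k) \<Rightarrow> 'g \<Rightarrow> 'g" where
  "on_group L g = (THE h. L (\<delta> g) = \<delta> h)"

definition prod_group :: "nat \<Rightarrow> (nat \<Rightarrow> 'a monoid) \<Rightarrow> (nat \<Rightarrow> 'a) monoid" where
  "prod_group n Gs = product_group {0..n} Gs"

text \<open>\<open>w\<^sub>i = \<pi>\<^sub>i w \<iota>\<^sub>i\<close>\<close>

definition component :: "nat \<Rightarrow> (nat \<Rightarrow> 'a monoid) \<Rightarrow> nat \<Rightarrow>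
    ((nat \<Rightarrow> 'a) \<Rightarrow> (nat \<Rightarrow> 'a)) \<Rightarrow> 'a \<Rightarrow> 'a" where
  "component n Gs i w x = w (\<lambda>j\<in>{0..n}. if j = i then x else \<one>\<^bsub>Gs j\<^esub>) i"

definition u_star :: "('g, 'm) monoid_scheme \<Rightarrow> (('g \<times> 'g) \<times> ('g \<times> 'g) \<Rightarrow> 'k::field) \<Rightarrow> 'g \<Rightarrow> 'g" where
  "u_star K R = on_group (group_transp K (u_of K R))"

definition Sv :: "('g, 'm) monoid_scheme \<Rightarrow> (('g \<times> 'g) \<times> ('g \<times> 'g) \<Rightarrow> 'k::field) \<Rightarrow> 'g \<Rightarrow> 'g" where
  "Sv K R g = inv\<^bsub>K\<^esub> (on_group (v_of K R) g)"

definition E_set :: "nat \<Rightarrow> (nat \<Rightarrow> 'a monoid) \<Rightarrow>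
    (((nat \<Rightarrow> 'a) \<times> (nat \<Rightarrow> 'a)) \<times> ((nat \<Rightarrow> 'a) \<times> (nat \<Rightarrow> 'a)) \<Rightarrow> 'k::field) \<Rightarrow> nat set" where
  "E_set n Gs R = {i \<in> {1..n}.
     central_aut (Gs i) (component n Gs i (u_star (prod_group n Gs) R)) \<and>
     component n Gs i (Sv (prod_group n Gs) R) \<in> hom (Gs i) ((Gs i)\<lparr>carrier := centre (Gs i)\<rparr>)}"

text \<open>The factors of \<open>G\<^sub>E\<close> are kept in their original order, so that \<open>G\<^sub>E\<close> has the same underlying
  set as \<open>G\<close>.\<close>

definition G_E :: "nat \<Rightarrow> (nat \<Rightarrow> 'a monoid) \<Rightarrow> nat set \<Rightarrow> (nat \<Rightarrow> 'a) monoid" where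
  "G_E n Gs E = prod_group n (\<lambda>i. if i = 0 \<or> i \<in> E then Gs i else op_group (Gs i))"

definition theta :: "nat \<Rightarrow> (nat \<Rightarrow> 'a monoid) \<Rightarrow> nat set \<Rightarrow> (nat \<Rightarrow> 'a) \<Rightarrow> (nat \<Rightarrow> 'a)" where
  "theta n Gs E x = (\<lambda>i\<in>{0..n}. if i = 0 \<or> i \<in> E then x i else inv\<^bsub>Gs i\<^esub> (x i))"

definition Theta :: "nat \<Rightarrow> (nat \<Rightarrow> 'a monoid) \<Rightarrow> nat set \<Rightarrow>
    ((nat \<Rightarrow> 'a) \<times> (nat \<Rightarrow> 'a) \<Rightarrow> 'k::field) \<Rightarrow> (nat \<Rightarrow> 'a) \<times> (nat \<Rightarrow> 'a) \<Rightarrow> 'k" where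
  "Theta n Gs E a = (\<lambda>z. \<Sum>(y, x)\<in>carrier (prod_group n Gs) \<times> carrier (prod_group n Gs).
     a (y, x) * \<delta> (theta n Gs E y, theta n Gs E x) z)"

definition Psi :: "nat \<Rightarrow> (nat \<Rightarrow> 'a monoid) \<Rightarrow>
    (((nat \<Rightarrow> 'a) \<times> (nat \<Rightarrow> 'a)) \<times> ((nat \<Rightarrow> 'a) \<times> (nat \<Rightarrow> 'a)) \<Rightarrow> 'k::field) \<Rightarrow>
    ((nat \<Rightarrow> 'a) \<times> (nat \<Rightarrow> 'a) \<Rightarrow> 'k) \<Rightarrow> (nat \<Rightarrow> 'a) \<times> (nat \<Rightarrow> 'a) \<Rightarrow> 'k" where
  "Psi n Gs R = Theta n Gs (E_set n Gs R) \<circ> Psi_map (prod_group n Gs) R"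

end

theory Submission
  imports Defs "HOL-Library.Function_Algebras" "HOL.Vector_Spaces"
begin

text \<open>
  Let \<open>R x g y h\<close> be the coefficient of \<open>R\<close> at \<open>(e\<^sub>x \<bowtie> g) \<otimes> (e\<^sub>y \<bowtie> h)\<close>. The axioms become identities
  between these coefficients; the intertwining axiom, for example, says that they are invariant under
  simultaneous conjugation and vanish unless \<open>h\<^sup>-\<^sup>1yh g\<^sup>-\<^sup>1xg = xy\<close>. For \<open>x = 1\<close> the remaining axioms
  produce orthogonal idempotents of the field, which is why \<open>u\<close> is dual to an endomorphism \<open>U = u\<^sup>*\<close>
  of \<open>G\<close> that commutes with inner automorphisms, and the support condition forces \<open>p\<close> to live on the
  centre. Exchanging the two tensor factors gives the same for \<open>V = Sv\<close>. All coefficients are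
  then known (\<open>R_eq\<close>): \<open>R x g y h = r x y * p (U(y)\<^sup>-\<^sup>1 g) (V(x) h)\<close>.

  The support condition at a nonzero coefficient reads \<open>V(x)yV(x)\<^sup>-\<^sup>1 U(y)\<^sup>-\<^sup>1xU(y) = xy\<close>. In one
  indecomposable factor this means \<open>V(c)U(c) = c\<close> for commutators \<open>c\<close>, and by Fitting's lemma one of
  the two components is a central automorphism while the other one has central values
  (\<open>normal_endo_dichotomy\<close>). So \<open>G\<close> is a product of two parts such that, modulo the centre, \<open>U\<close> is
  the projection \<open>f\<close> to the first part and \<open>V\<close> is the projection \<open>e\<close> to the second one. In
  particular \<open>r\<close> is a bicharacter (\<open>multiplicative_if_twisted\<close>).

  Put \<open>A(x) = U(x)V(x)\<^sup>-\<^sup>1\<close>, \<open>b(x,y) = r(y,x)r(x,y)\<close> and let \<open>q\<close> be the matrix of \<open>p\<^sup>* + p\<close>. The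
  coefficient of \<open>\<Psi>\<^sub>R(e\<^sub>y \<bowtie> x)\<close> at \<open>e\<^sub>z \<bowtie> h\<close> is \<open>b(x,z) q(A(z)\<^sup>-\<^sup>1y, A(x)\<^sup>-\<^sup>1h)\<close> (\<open>Psi_map_eq\<close>), and a
  direct computation of \<open>\<tau>(R)R\<close> gives the same coefficients up to a permutation of the basis of the
  dual (\<open>monodromy_coefficient\<close>). This proves that the images agree.

  Modulo the centre, \<open>A\<close> is the canonical isomorphism \<open>\<theta>\<close>. Hence \<open>\<theta>A\<close> and \<open>A\<theta>\<close> are endomorphisms
  of \<open>G\<^sub>E\<close> that are the identity modulo the centre, and for such data the matrix above always
  defines a bialgebra endomorphism (\<open>Hopf_End_double_matrix\<close>). A linear endomorphism of a
  finite-dimensional space is bijective as soon as it is surjective, so the equality of the images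
  gives the criterion for factorizability.
\<close>

section \<open>Conjugation and central elements\<close>

context group
begin

lemma inv_mult_cancel:
  "x \<in> carrier G \<Longrightarrow> y \<in> carrier G \<Longrightarrow> inv x \<otimes> (x \<otimes> y) = y"
  "x \<in> carrier G \<Longrightarrow> y \<in> carrier G \<Longrightarrow> x \<otimes> (inv x \<otimes> y) = y"
  by (simp_all flip: m_assoc)

lemmas group_normalize = m_assoc inv_mult_group inv_mult_cancel

lemma inv_mult_eq_iff:
  assumes "x \<in> carrier G" "y \<in> carrier G" "z \<in> carrier G"
  shows "inv x \<otimes> y = z \<longleftrightarrow> y = x \<otimes> z"
  using assms by (auto simp: inv_mult_cancel)

lemma commute_inv:
  assumes "x \<in> carrier G" "y \<in> carrier G" "x \<otimes> y = y \<otimes> x"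
  shows "inv x \<otimes> y = y \<otimes> inv x"
proof -
  have "inv x \<otimes> y = inv x \<otimes> (y \<otimes> x) \<otimes> inv x" using assms(1,2) by (simp add: group_normalize)
  also have "\<dots> = y \<otimes> inv x" using assms(1,2) unfolding assms(3)[symmetric] by (simp add: group_normalize)
  finally show ?thesis .
qed

lemma centreD:
  assumes "c \<in> centre G"
  shows "c \<in> carrier G" "\<And>x. x \<in> carrier G \<Longrightarrow> c \<otimes> x = x \<otimes> c"
  using assms by (auto simp: centre_def)

lemma centreI:
  assumes "c \<in> carrier G" "\<And>x. x \<in> carrier G \<Longrightarrow> c \<otimes> x = x \<otimes> c"
  shows "c \<in> centre G"
  using assms by (auto simp: centre_def)

lemma centre_mult:
  assumes "c \<in> centre G" "d \<in> centre G"
  shows "c \<otimes> d \<in> centre G"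
proof (rule centreI)
  note c = centreD[OF assms(1)] and d = centreD[OF assms(2)]
  show "c \<otimes> d \<in> carrier G" using c(1) d(1) by simp
  fix x assume x: "x \<in> carrier G"
  have "c \<otimes> d \<otimes> x = c \<otimes> (x \<otimes> d)" using c(1) d(1) x d(2)[OF x] by (simp add: m_assoc)
  also have "\<dots> = x \<otimes> c \<otimes> d" using c(1) d(1) x c(2)[OF x] by (simp flip: m_assoc)
  finally show "c \<otimes> d \<otimes> x = x \<otimes> (c \<otimes> d)" using c(1) d(1) x by (simp add: m_assoc)
qed

lemma centre_inv:
  assumes "c \<in> centre G"
  shows "inv c \<in> centre G"
  using centreD[OF assms] commute_inv[of c] by (intro centreI) auto

lemma centre_conj:
  assumes "c \<in> centre G" "k \<in> carrier G"
  shows "k \<otimes> c \<otimes> inv k = c" "inv k \<otimes> c \<otimes> k = c"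
proof -
  note c = centreD[OF assms(1)]
  have "k \<otimes> c \<otimes> inv k = c \<otimes> k \<otimes> inv k" using c(2)[OF assms(2)] by simp
  then show "k \<otimes> c \<otimes> inv k = c" using c(1) assms(2) by (simp add: m_assoc)
  have "inv k \<otimes> c \<otimes> k = inv k \<otimes> (k \<otimes> c)" using c(1) assms(2) c(2)[OF assms(2)] by (simp add: m_assoc)
  then show "inv k \<otimes> c \<otimes> k = c" using c(1) assms(2) by (simp add: inv_mult_cancel)
qed

lemma conj_by_centre:
  assumes "c \<in> centre G" "x \<in> carrier G"
  shows "inv c \<otimes> x \<otimes> c = x" "c \<otimes> x \<otimes> inv c = x"
proof -
  note c = centreD(1)[OF assms(1)] centreD(2)[OF assms(1,2)]
  have "inv c \<otimes> x \<otimes> c = inv c \<otimes> (c \<otimes> x)" using c assms(2) by (simp add: m_assoc)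
  then show "inv c \<otimes> x \<otimes> c = x" using c(1) assms(2) by (simp add: inv_mult_cancel)
  show "c \<otimes> x \<otimes> inv c = x" using c assms(2) by (simp add: m_assoc)
qed

lemma centre_conj_iff:
  assumes "c \<in> carrier G" "k \<in> carrier G"
  shows "k \<otimes> c \<otimes> inv k \<in> centre G \<longleftrightarrow> c \<in> centre G"
proof
  assume a: "k \<otimes> c \<otimes> inv k \<in> centre G"
  have "inv k \<otimes> (k \<otimes> c \<otimes> inv k) \<otimes> k = c" using assms by (simp add: group_normalize)
  with centre_conj(2)[OF a assms(2)] a show "c \<in> centre G" by simp
next
  assume "c \<in> centre G" then show "k \<otimes> c \<otimes> inv k \<in> centre G" using centre_conj(1) assms by simp
qed

lemma sum_translate:
  fixes \<phi> :: "'a \<Rightarrow> 'k::comm_monoid_add"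
  assumes "a \<in> carrier G"
  shows "(\<Sum>k\<in>carrier G. \<phi> (a \<otimes> k)) = (\<Sum>k\<in>carrier G. \<phi> k)"
    and "(\<Sum>k\<in>carrier G. \<phi> (k \<otimes> a)) = (\<Sum>k\<in>carrier G. \<phi> k)"
    and "(\<Sum>k\<in>carrier G. \<phi> (a \<otimes> k \<otimes> inv a)) = (\<Sum>k\<in>carrier G. \<phi> k)"
proof -
  show "(\<Sum>k\<in>carrier G. \<phi> (a \<otimes> k)) = (\<Sum>k\<in>carrier G. \<phi> k)"
    by (rule sum.reindex_bij_witness[where i="\<lambda>k. inv a \<otimes> k" and j="\<lambda>k. a \<otimes> k"])
       (use assms in \<open>auto simp: group_normalize\<close>)
  show "(\<Sum>k\<in>carrier G. \<phi> (k \<otimes> a)) = (\<Sum>k\<in>carrier G. \<phi> k)"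
    by (rule sum.reindex_bij_witness[where i="\<lambda>k. k \<otimes> inv a" and j="\<lambda>k. k \<otimes> a"])
       (use assms in \<open>auto simp: group_normalize\<close>)
  show "(\<Sum>k\<in>carrier G. \<phi> (a \<otimes> k \<otimes> inv a)) = (\<Sum>k\<in>carrier G. \<phi> k)"
    by (rule sum.reindex_bij_witness[where i="\<lambda>k. inv a \<otimes> k \<otimes> a" and j="\<lambda>k. a \<otimes> k \<otimes> inv a"])
       (use assms in \<open>auto simp: group_normalize\<close>)
qed

end

definition normal_endo :: "('a, 'm) monoid_scheme \<Rightarrow> ('a \<Rightarrow> 'a) \<Rightarrow> bool" where
  "normal_endo G w \<longleftrightarrow> w \<in> hom G G \<and>
     (\<forall>k\<in>carrier G. \<forall>x\<in>carrier G. w (k \<otimes>\<^bsub>G\<^esub> x \<otimes>\<^bsub>G\<^esub> inv\<^bsub>G\<^esub> k) = k \<otimes>\<^bsub>G\<^esub> w x \<otimes>\<^bsub>G\<^esub> inv\<^bsub>G\<^esub> k)"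

lemma (in group) normal_endoD:
  assumes "normal_endo G w"
  shows "\<And>x. x \<in> carrier G \<Longrightarrow> w x \<in> carrier G"
    and "\<And>x y. x \<in> carrier G \<Longrightarrow> y \<in> carrier G \<Longrightarrow> w (x \<otimes> y) = w x \<otimes> w y"
    and "\<And>x. x \<in> carrier G \<Longrightarrow> w (inv x) = inv (w x)"
    and "w \<one> = \<one>"
    and "\<And>x k. x \<in> carrier G \<Longrightarrow> k \<in> carrier G \<Longrightarrow> w (k \<otimes> x \<otimes> inv k) = k \<otimes> w x \<otimes> inv k"
proof -
  have h: "w \<in> hom G G" using assms by (simp add: normal_endo_def)
  interpret group_hom G G w by (unfold_locales) (rule h)
  show "\<And>x. x \<in> carrier G \<Longrightarrow> w x \<in> carrier G"
    "\<And>x y. x \<in> carrier G \<Longrightarrow> y \<in> carrier G \<Longrightarrow> w (x \<otimes> y) = w x \<otimes> w y"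
    "\<And>x. x \<in> carrier G \<Longrightarrow> w (inv x) = inv (w x)"
    "w \<one> = \<one>"
    "\<And>x k. x \<in> carrier G \<Longrightarrow> k \<in> carrier G \<Longrightarrow> w (k \<otimes> x \<otimes> inv k) = k \<otimes> w x \<otimes> inv k"
    using assms by (auto simp: normal_endo_def)
qed

section \<open>Endomorphisms that commute with inner automorphisms\<close>

context group
begin

lemma normal_endo_funpow:
  assumes "normal_endo G w"
  shows "normal_endo G (w ^^ m)"
proof (induction m)
  case 0 show ?case by (simp add: normal_endo_def hom_def)
next
  case (Suc m)
  note d = normal_endoD[OF assms] and e = normal_endoD[OF Suc]
  show ?case unfolding normal_endo_def hom_def using d(1,2,5) e(1,2,5) by simp
qed

text \<open>
  Two powers of \<open>w\<close> agree on a finite group, so the powers are periodic from some exponent \<open>i\<close> on, with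
  period \<open>q\<close> say. The exponent \<open>m = (i + 1) q\<close> is a multiple of the period beyond \<open>i\<close>, so \<open>w\<^sup>m\<close> and
  \<open>w\<^sup>2\<^sup>m\<close> agree.
\<close>

lemma idempotent_power:
  assumes "finite (carrier G)" and w: "\<And>x. x \<in> carrier G \<Longrightarrow> w x \<in> carrier G"
  shows "\<exists>m\<ge>1. \<forall>x\<in>carrier G. (w ^^ m) ((w ^^ m) x) = (w ^^ m) x"
proof -
  have closed: "(w ^^ n) x \<in> carrier G" if "x \<in> carrier G" for n x
    using that w by (induction n) auto
  define F where "F n = restrict (w ^^ n) (carrier G)" for n
  have "range F \<subseteq> carrier G \<rightarrow>\<^sub>E carrier G" using closed by (auto simp: F_def)
  then have "finite (range F)" using finite_PiE[OF assms(1)] assms(1) finite_subset by metis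
  then have "\<not> inj F" using finite_imageD infinite_UNIV_nat by blast
  then obtain i j where "i < j" "F i = F j" by (metis injI linorder_neqE_nat)
  define q where "q = j - i"
  have base: "(w ^^ (i + q)) x = (w ^^ i) x" if "x \<in> carrier G" for x
    using \<open>F i = F j\<close> \<open>i < j\<close> that by (simp add: q_def F_def restrict_def fun_eq_iff) metis
  have step: "(w ^^ (n + q)) x = (w ^^ n) x" if "x \<in> carrier G" "n \<ge> i" for n x
  proof -
    have "n + q = (n - i) + (i + q)" using that by simp
    then have "(w ^^ (n + q)) x = (w ^^ (n - i)) ((w ^^ (i + q)) x)" by (metis comp_apply funpow_add)
    also have "\<dots> = (w ^^ (n - i + i)) x" using base that by (simp only: funpow_add comp_apply)
    finally show ?thesis using that by simp
  qed
  have steps: "(w ^^ (n + k * q)) x = (w ^^ n) x" if "x \<in> carrier G" "n \<ge> i" for n x k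
  proof (induction k)
    case (Suc k)
    have "n + Suc k * q = (n + k * q) + q" by simp
    then show ?case using step[of x "n + k * q"] Suc that by (metis trans_le_add1)
  qed simp
  define m where "m = (i + 1) * q"
  have "q \<ge> 1" using \<open>i < j\<close> by (simp add: q_def)
  then have "i + 1 \<le> m" unfolding m_def using mult_le_mono2[of 1 q "i + 1"] by simp
  then have m: "m \<ge> i" "m \<ge> 1" by auto
  have "(w ^^ m) ((w ^^ m) x) = (w ^^ m) x" if "x \<in> carrier G" for x
    using steps[of x m "i + 1"] that m by (metis comp_apply funpow_add m_def)
  with m show ?thesis by blast
qed

lemma normal_endo_image_kernel:
  assumes e: "normal_endo G e"
  shows "e ` carrier G \<lhd> G" "{x \<in> carrier G. e x = \<one>} \<lhd> G"
proof -
  note d = normal_endoD[OF e]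
  have "subgroup (e ` carrier G) G"
  proof (rule subgroupI)
    show "inv a \<in> e ` carrier G" if "a \<in> e ` carrier G" for a
    proof -
      from that obtain x where "x \<in> carrier G" "a = e x" by blast
      then show ?thesis using d(3)[of x] by (intro image_eqI[of _ _ "inv x"]) auto
    qed
    show "a \<otimes> b \<in> e ` carrier G" if "a \<in> e ` carrier G" "b \<in> e ` carrier G" for a b
    proof -
      from that obtain x y where "x \<in> carrier G" "a = e x" "y \<in> carrier G" "b = e y" by blast
      then show ?thesis using d(2)[of x y] by (intro image_eqI[of _ _ "x \<otimes> y"]) auto
    qed
  qed (use d(1) in auto)
  moreover have "k \<otimes> a \<otimes> inv k \<in> e ` carrier G" if k: "k \<in> carrier G" "a \<in> e ` carrier G" for k a
  proof -
    from k(2) obtain x where "x \<in> carrier G" "a = e x" by blast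
    then show ?thesis using d(5)[of x k] k(1) by (intro image_eqI[of _ _ "k \<otimes> x \<otimes> inv k"]) auto
  qed
  ultimately show "e ` carrier G \<lhd> G" by (auto simp: normal_inv_iff)
  have "subgroup {x \<in> carrier G. e x = \<one>} G"
  proof (rule subgroupI)
    show "{x \<in> carrier G. e x = \<one>} \<noteq> {}" using d(4) by auto
    show "inv a \<in> {x \<in> carrier G. e x = \<one>}" if "a \<in> {x \<in> carrier G. e x = \<one>}" for a
      using that d(3)[of a] by simp
    show "a \<otimes> b \<in> {x \<in> carrier G. e x = \<one>}"
      if "a \<in> {x \<in> carrier G. e x = \<one>}" "b \<in> {x \<in> carrier G. e x = \<one>}" for a b
      using that d(2)[of a b] by simp
  qed auto
  then show "{x \<in> carrier G. e x = \<one>} \<lhd> G" using d(5) by (auto simp: normal_inv_iff)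
qed

text \<open>
  Fitting's lemma: an idempotent power of \<open>w\<close> splits the group into the direct product of its image and
  its kernel, which are both normal, and indecomposability makes one of them trivial.
\<close>

lemma normal_endo_injective_or_nilpotent:
  assumes "finite (carrier G)" and ind: "indecomposable_group G" and w: "normal_endo G w"
  shows "inj_on w (carrier G) \<or> (\<exists>m. \<forall>x\<in>carrier G. (w ^^ m) x = \<one>)"
proof -
  from idempotent_power[OF assms(1), of w] normal_endoD(1)[OF w]
  obtain m where m: "m \<ge> 1" and idem: "\<And>x. x \<in> carrier G \<Longrightarrow> (w ^^ m) ((w ^^ m) x) = (w ^^ m) x" by blast
  define e where "e = w ^^ m"
  have e: "normal_endo G e" using normal_endo_funpow[OF w] by (simp add: e_def)
  note d = normal_endoD[OF e]
  let ?A = "e ` carrier G" and ?B = "{x \<in> carrier G. e x = \<one>}"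
  have "?A \<inter> ?B = {\<one>}" using idem d(4) one_closed by (force simp: e_def)
  moreover have "?A <#> ?B = carrier G"
  proof
    show "?A <#> ?B \<subseteq> carrier G" using d by (auto simp: set_mult_def)
    show "carrier G \<subseteq> ?A <#> ?B"
    proof
      fix x assume x: "x \<in> carrier G"
      have "e (inv (e x) \<otimes> x) = \<one>" using d x idem by (simp add: e_def)
      then show "x \<in> ?A <#> ?B"
        using x d(1) unfolding set_mult_def
        by (auto intro!: bexI[of _ x] exI[of _ "inv (e x) \<otimes> x"] simp: inv_mult_cancel)
    qed
  qed
  ultimately have "?A = {\<one>} \<or> ?B = {\<one>}"
    using ind normal_endo_image_kernel[OF e] unfolding indecomposable_group_def by blast
  then show ?thesis
  proof
    assume "?A = {\<one>}"
    then have "\<forall>x\<in>carrier G. (w ^^ m) x = \<one>" by (auto simp: e_def)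
    then show ?thesis by blast
  next
    assume B: "?B = {\<one>}"
    have "inj_on w (carrier G)"
    proof (rule inj_onI)
      fix x y assume xy: "x \<in> carrier G" "y \<in> carrier G" "w x = w y"
      obtain m' where "m = Suc m'" using m by (cases m) auto
      then have "e x = e y" using xy(3) by (simp add: e_def funpow_swap1 del: funpow.simps add: funpow_Suc_right)
      then have "e (inv y \<otimes> x) = \<one>" using d xy by simp
      then have "inv y \<otimes> x = \<one>" using B xy by blast
      then show "x = y" using inv_mult_eq_iff[of y x \<one>] xy by simp
    qed
    then show ?thesis ..
  qed
qed

abbreviation commutator :: "'a \<Rightarrow> 'a \<Rightarrow> 'a" where
  "commutator a b \<equiv> a \<otimes> b \<otimes> inv a \<otimes> inv b"

lemma commutator_eq_one_iff:
  assumes "a \<in> carrier G" "b \<in> carrier G"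
  shows "commutator a b = \<one> \<longleftrightarrow> a \<otimes> b = b \<otimes> a"
proof -
  have "commutator a b = \<one> \<longleftrightarrow> a \<otimes> b \<otimes> inv (b \<otimes> a) = \<one>" using assms by (simp add: group_normalize)
  also have "\<dots> \<longleftrightarrow> a \<otimes> b = b \<otimes> a" using assms by (metis inv_solve_right inv_closed l_one m_closed one_closed)
  finally show ?thesis .
qed

lemma normal_endo_commutator:
  assumes w: "normal_endo G w" and c: "a \<in> carrier G" "b \<in> carrier G"
  shows "w (commutator a b) = commutator (w a) b" "w (commutator a b) = commutator a (w b)"
proof -
  note d = normal_endoD[OF w]
  have "commutator a b = a \<otimes> (b \<otimes> inv a \<otimes> inv b)" using c by (simp add: m_assoc)
  then have "w (commutator a b) = w a \<otimes> (b \<otimes> w (inv a) \<otimes> inv b)" using c d(1,2,5) by simp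
  then show "w (commutator a b) = commutator (w a) b" using c d by (simp add: m_assoc)
  have "w (commutator a b) = (a \<otimes> w b \<otimes> inv a) \<otimes> w (inv b)" using c d(1,2,5) by simp
  then show "w (commutator a b) = commutator a (w b)" using c d by simp
qed

text \<open>
  Evaluating \<open>w (k x k\<^sup>-\<^sup>1)\<close> in two ways shows that \<open>w k\<close> and \<open>k\<close> induce the same conjugation on the
  image of \<open>w\<close>, which is the whole group.
\<close>

lemma injective_normal_endo_central:
  assumes fin: "finite (carrier G)" and w: "normal_endo G w" and inj: "inj_on w (carrier G)"
  shows "central_aut G w"
proof -
  note d = normal_endoD[OF w]
  have surj: "w ` carrier G = carrier G"
    using fin inj d(1) by (intro endo_inj_surj) auto
  then have "w \<in> iso G G" using w inj by (simp add: iso_def bij_betw_def normal_endo_def)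
  moreover have "inv k \<otimes> w k \<in> centre G" if k: "k \<in> carrier G" for k
  proof (rule centreI)
    fix y assume "y \<in> carrier G"
    then obtain x where x: "x \<in> carrier G" "y = w x" using surj by blast
    have "w k \<otimes> w x \<otimes> inv (w k) = k \<otimes> w x \<otimes> inv k"
      using d(5)[OF x(1) k] d(1)[OF x(1)] d(1)[OF k] d(2) d(3)[OF k] x k by simp
    then have "inv k \<otimes> (w k \<otimes> y \<otimes> inv (w k)) \<otimes> w k = inv k \<otimes> (k \<otimes> y \<otimes> inv k) \<otimes> w k"
      using x by simp
    then show "inv k \<otimes> w k \<otimes> y = y \<otimes> (inv k \<otimes> w k)"
      using x k d(1) by (simp add: group_normalize)
  qed (use k d in auto)
  ultimately show ?thesis by (simp add: central_aut_def)
qed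

lemma central_aut_commutator:
  assumes w: "normal_endo G w" "central_aut G w" and c: "a \<in> carrier G" "b \<in> carrier G"
  shows "w (commutator a b) = commutator a b"
proof -
  define z where "z = inv a \<otimes> w a"
  have wa: "w a \<in> carrier G" using normal_endoD(1)[OF w(1)] c by simp
  have z: "z \<in> centre G" "w a = a \<otimes> z"
    using w(2) c wa by (auto simp: central_aut_def z_def inv_mult_cancel)
  have "commutator (w a) b = a \<otimes> (z \<otimes> b \<otimes> inv z) \<otimes> inv a \<otimes> inv b"
    using centreD(1)[OF z(1)] c by (simp add: z(2) group_normalize)
  then show ?thesis
    using normal_endo_commutator(1)[OF w(1) c] conj_by_centre(2)[OF z(1) c(2)] by simp
qed

text \<open>
  An endomorphism that commutes with conjugation can be applied to either entry of a commutator. This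
  turns the hypothesis, which relates the conjugations by \<open>v a\<close> and \<open>u b\<close>, into a relation between the
  values of \<open>v\<close> and \<open>u\<close> at a single commutator.
\<close>

lemma commutator_factorisation:
  assumes u: "normal_endo G u" and v: "normal_endo G v"
    and rel: "\<And>a b. a \<in> carrier G \<Longrightarrow> b \<in> carrier G \<Longrightarrow>
      v a \<otimes> b \<otimes> inv (v a) \<otimes> (inv (u b) \<otimes> a \<otimes> u b) = a \<otimes> b"
    and c: "a \<in> carrier G" "b \<in> carrier G"
  shows "v (commutator a b) \<otimes> u (commutator a b) = commutator a b"
proof -
  note du = normal_endoD[OF u] and dv = normal_endoD[OF v]
  have cl: "u b \<in> carrier G" "v a \<in> carrier G" using du dv c by auto
  have 1: "v (commutator a b) = v a \<otimes> b \<otimes> inv (v a) \<otimes> inv b"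
    using normal_endo_commutator(1)[OF v c] .
  have "inv b \<otimes> u (commutator a b) \<otimes> b = inv (u b) \<otimes> u (commutator a b) \<otimes> u b"
    using du(5)[of "commutator a b" "inv b"] du c cl by (simp add: group_normalize)
  then have "inv b \<otimes> u (commutator a b) \<otimes> b = inv (u b) \<otimes> a \<otimes> u b \<otimes> inv a"
    using normal_endo_commutator(2)[OF u c] c cl by (simp add: group_normalize)
  then have "b \<otimes> (inv b \<otimes> u (commutator a b) \<otimes> b) \<otimes> inv b = b \<otimes> (inv (u b) \<otimes> a \<otimes> u b \<otimes> inv a) \<otimes> inv b"
    by simp
  moreover have uc: "u (commutator a b) \<in> carrier G" using du(1) c by simp
  ultimately have 2: "u (commutator a b) = b \<otimes> (inv (u b) \<otimes> a \<otimes> u b) \<otimes> inv a \<otimes> inv b"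
    using c cl by (simp only: m_assoc inv_mult_cancel m_closed inv_closed r_inv r_one)
  have "v (commutator a b) \<otimes> u (commutator a b) =
      (v a \<otimes> b \<otimes> inv (v a) \<otimes> (inv (u b) \<otimes> a \<otimes> u b)) \<otimes> inv a \<otimes> inv b"
    unfolding 1 2 using c cl by (simp add: group_normalize)
  then show ?thesis using rel[OF c] by simp
qed

text \<open>
  Iterating \<open>u\<close> on a commutator yields commutators and ends at \<open>\<one>\<close>. The last nontrivial one would be
  killed by \<open>u\<close>, hence fixed by \<open>v\<close>, which is impossible because \<open>v\<close> is nilpotent.
\<close>

lemma nilpotent_pair_imp_commutative:
  assumes u: "normal_endo G u" and v: "normal_endo G v"
    and prod: "\<And>a b. a \<in> carrier G \<Longrightarrow> b \<in> carrier G \<Longrightarrow>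
      v (commutator a b) \<otimes> u (commutator a b) = commutator a b"
    and nil: "\<And>x. x \<in> carrier G \<Longrightarrow> (u ^^ m) x = \<one>" "\<And>x. x \<in> carrier G \<Longrightarrow> (v ^^ n) x = \<one>"
    and c: "a \<in> carrier G" "b \<in> carrier G"
  shows "a \<otimes> b = b \<otimes> a"
proof -
  note du = normal_endoD[OF u] and dv = normal_endoD[OF v]
  \<comment> \<open>A commutator killed by \<open>u\<close> is fixed by \<open>v\<close>, hence trivial.\<close>
  have kernel: "commutator a b = \<one>" if ab: "a \<in> carrier G" "b \<in> carrier G" "u (commutator a b) = \<one>" for a b
  proof -
    have "v (commutator a b) \<in> carrier G" using dv(1) ab by simp
    then have fixed: "v (commutator a b) = commutator a b" using prod[of a b] ab by simp
    have "(v ^^ k) (commutator a b) = commutator a b" for k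
      by (induction k) (simp_all add: fixed)
    then show ?thesis using nil(2)[of "commutator a b"] ab by simp
  qed
  have "(u ^^ k) (commutator a b) = \<one> \<Longrightarrow> commutator a b = \<one>" if "a \<in> carrier G" for a k
    using that
  proof (induction k arbitrary: a)
    case (Suc k)
    have "(u ^^ k) (commutator (u a) b) = \<one>"
      using Suc.prems normal_endo_commutator(1)[OF u Suc.prems(2) c(2)] by (simp add: funpow_swap1)
    then have "commutator (u a) b = \<one>" using Suc du by simp
    then show ?case using kernel[OF Suc.prems(2) c(2)] normal_endo_commutator(1)[OF u Suc.prems(2) c(2)] by simp
  qed simp
  then have "commutator a b = \<one>" using nil(1)[of "commutator a b"] c by simp
  then show ?thesis using commutator_eq_one_iff c by simp
qed

lemma central_if_trivial_on_commutators:
  assumes w: "normal_endo G w" "\<And>a b. a \<in> carrier G \<Longrightarrow> b \<in> carrier G \<Longrightarrow> w (commutator a b) = \<one>"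
    and x: "x \<in> carrier G"
  shows "w x \<in> centre G"
proof (rule centreI)
  show "w x \<in> carrier G" using normal_endoD(1)[OF w(1)] x by simp
  fix y assume y: "y \<in> carrier G"
  have "commutator (w x) y = \<one>" using normal_endo_commutator(1)[OF w(1) x y] w(2)[OF x y] by simp
  then show "w x \<otimes> y = y \<otimes> w x" using commutator_eq_one_iff[of "w x" y] normal_endoD(1)[OF w(1) x] y by simp
qed

text \<open>
  If \<open>u\<close> is injective, it is central and fixes commutators; then \<open>v\<close> kills them, so its values are
  central. The same holds with \<open>u\<close> and \<open>v\<close> exchanged, and both cannot be nilpotent in a non-abelian
  group.
\<close>

lemma normal_endo_dichotomy:
  assumes fin: "finite (carrier G)" and ind: "indecomposable_group G" and nab: "\<not> comm_group G"
    and u: "normal_endo G u" and v: "normal_endo G v"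
    and rel: "\<And>a b. a \<in> carrier G \<Longrightarrow> b \<in> carrier G \<Longrightarrow>
      v a \<otimes> b \<otimes> inv (v a) \<otimes> (inv (u b) \<otimes> a \<otimes> u b) = a \<otimes> b"
  shows "central_aut G u \<and> (\<forall>x\<in>carrier G. v x \<in> centre G) \<or>
    central_aut G v \<and> (\<forall>x\<in>carrier G. u x \<in> centre G)"
proof -
  have prod: "v (commutator a b) \<otimes> u (commutator a b) = commutator a b"
    if "a \<in> carrier G" "b \<in> carrier G" for a b
    using commutator_factorisation[OF u v rel that] by simp
  have cl: "u c \<in> carrier G" "v c \<in> carrier G" if "c \<in> carrier G" for c
    using normal_endoD(1)[OF u that] normal_endoD(1)[OF v that] by auto
  have "inj_on u (carrier G) \<or> inj_on v (carrier G)"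
  proof (rule ccontr)
    assume "\<not> ?thesis"
    then obtain m n where "\<And>x. x \<in> carrier G \<Longrightarrow> (u ^^ m) x = \<one>" "\<And>x. x \<in> carrier G \<Longrightarrow> (v ^^ n) x = \<one>"
      using normal_endo_injective_or_nilpotent[OF fin ind u] normal_endo_injective_or_nilpotent[OF fin ind v] by blast
    then have "a \<otimes> b = b \<otimes> a" if "a \<in> carrier G" "b \<in> carrier G" for a b
      using nilpotent_pair_imp_commutative[OF u v prod] that by blast
    then show False using nab by (simp add: group_comm_groupI)
  qed
  then show ?thesis
  proof
    assume "inj_on u (carrier G)"
    then have ca: "central_aut G u" using injective_normal_endo_central fin u by simp
    have "v (commutator a b) = \<one>" if "a \<in> carrier G" "b \<in> carrier G" for a b
      using prod[OF that] central_aut_commutator[OF u ca that] that cl r_cancel_one by simp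
    then show ?thesis using ca central_if_trivial_on_commutators[OF v] by simp
  next
    assume "inj_on v (carrier G)"
    then have ca: "central_aut G v" using injective_normal_endo_central fin v by simp
    have "u (commutator a b) = \<one>" if "a \<in> carrier G" "b \<in> carrier G" for a b
      using prod[OF that] central_aut_commutator[OF v ca that] that cl l_cancel_one by simp
    then show ?thesis using ca central_if_trivial_on_commutators[OF u] by simp
  qed
qed

end

section \<open>The coefficients of a universal R-matrix of the double\<close>

text \<open>
  \<open>R x g y h\<close> stands for the coefficient at \<open>(e\<^sub>x \<bowtie> g) \<otimes> (e\<^sub>y \<bowtie> h)\<close>. The first two identities express
  \<open>R \<Delta>(a) = \<tau>(\<Delta>(a)) R\<close>, the next two the formulas for \<open>(\<Delta> \<otimes> id)(R)\<close> and \<open>(id \<otimes> \<Delta>)(R)\<close>.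
\<close>

locale rmatrix = group G for G (structure) +
  fixes R :: "'a \<Rightarrow> 'a \<Rightarrow> 'a \<Rightarrow> 'a \<Rightarrow> 'k::field"
  assumes fin: "finite (carrier G)"
    and conj_R: "\<lbrakk>k \<in> carrier G; x \<in> carrier G; g \<in> carrier G; y \<in> carrier G; h \<in> carrier G\<rbrakk> \<Longrightarrow>
      R (k \<otimes> x \<otimes> inv k) (k \<otimes> g \<otimes> inv k) (k \<otimes> y \<otimes> inv k) (k \<otimes> h \<otimes> inv k) = R x g y h"
    and supp: "\<lbrakk>x \<in> carrier G; g \<in> carrier G; y \<in> carrier G; h \<in> carrier G; R x g y h \<noteq> 0\<rbrakk> \<Longrightarrow>
      (inv h \<otimes> y \<otimes> h) \<otimes> (inv g \<otimes> x \<otimes> g) = x \<otimes> y"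
    and left_comul: "\<lbrakk>a \<in> carrier G; b \<in> carrier G; g \<in> carrier G; g' \<in> carrier G; y \<in> carrier G; k \<in> carrier G\<rbrakk> \<Longrightarrow>
      (\<Sum>h\<in>carrier G. R a g y h * R b g' (inv h \<otimes> y \<otimes> h) (inv h \<otimes> k)) = (if g = g' then R (b \<otimes> a) g y k else 0)"
    and right_comul: "\<lbrakk>x \<in> carrier G; k \<in> carrier G; c \<in> carrier G; b \<in> carrier G; h \<in> carrier G; h' \<in> carrier G\<rbrakk> \<Longrightarrow>
      (\<Sum>g\<in>carrier G. R x g c h * R (inv g \<otimes> x \<otimes> g) (inv g \<otimes> k) b h') = (if h = h' then R x k (c \<otimes> b) h else 0)"
    and left_counit: "\<lbrakk>y \<in> carrier G; h \<in> carrier G\<rbrakk> \<Longrightarrow> (\<Sum>g\<in>carrier G. R \<one> g y h) = (if h = \<one> then 1 else 0)"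
    and right_counit: "\<lbrakk>x \<in> carrier G; g \<in> carrier G\<rbrakk> \<Longrightarrow> (\<Sum>h\<in>carrier G. R x g \<one> h) = (if g = \<one> then 1 else 0)"
begin

text \<open>
  Exchanging the tensor factors gives an R-matrix for the opposite coproduct; inverting the indices of the
  functions restores the coproduct. The coefficient identities are invariant under the combination of
  both, so each statement about the first tensor factor has a mirror image for the second one.
\<close>

definition swapped :: "'a \<Rightarrow> 'a \<Rightarrow> 'a \<Rightarrow> 'a \<Rightarrow> 'k" where
  "swapped y h x g = R (inv x) g (inv y) h"

lemma rmatrix_swapped: "rmatrix G swapped"
proof
  show "finite (carrier G)" by (rule fin)
next
  fix k x g y h assume c: "k \<in> carrier G" "x \<in> carrier G" "g \<in> carrier G" "y \<in> carrier G" "h \<in> carrier G"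
  show "swapped (k \<otimes> x \<otimes> inv k) (k \<otimes> g \<otimes> inv k) (k \<otimes> y \<otimes> inv k) (k \<otimes> h \<otimes> inv k) = swapped x g y h"
    using conj_R[of k "inv y" h "inv x" g] c by (simp add: swapped_def inv_mult_group m_assoc)
next
  fix x g y h assume c: "x \<in> carrier G" "g \<in> carrier G" "y \<in> carrier G" "h \<in> carrier G" and "swapped x g y h \<noteq> 0"
  then have "(inv g \<otimes> inv x \<otimes> g) \<otimes> (inv h \<otimes> inv y \<otimes> h) = inv y \<otimes> inv x"
    using supp[of "inv y" h "inv x" g] by (simp add: swapped_def)
  then have "inv ((inv g \<otimes> inv x \<otimes> g) \<otimes> (inv h \<otimes> inv y \<otimes> h)) = inv (inv y \<otimes> inv x)" by simp
  then show "(inv h \<otimes> y \<otimes> h) \<otimes> (inv g \<otimes> x \<otimes> g) = x \<otimes> y"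
    using c by (simp add: group_normalize)
next
  fix a b g g' y k
  assume c: "a \<in> carrier G" "b \<in> carrier G" "g \<in> carrier G" "g' \<in> carrier G" "y \<in> carrier G" "k \<in> carrier G"
  show "(\<Sum>h\<in>carrier G. swapped a g y h * swapped b g' (inv h \<otimes> y \<otimes> h) (inv h \<otimes> k)) =
      (if g = g' then swapped (b \<otimes> a) g y k else 0)"
    using right_comul[of "inv y" k "inv a" "inv b" g g'] c
    by (simp add: swapped_def inv_mult_group m_assoc cong: sum.cong)
next
  fix x k c b h h'
  assume c: "x \<in> carrier G" "k \<in> carrier G" "c \<in> carrier G" "b \<in> carrier G" "h \<in> carrier G" "h' \<in> carrier G"
  show "(\<Sum>g\<in>carrier G. swapped x g c h * swapped (inv g \<otimes> x \<otimes> g) (inv g \<otimes> k) b h') =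
      (if h = h' then swapped x k (c \<otimes> b) h else 0)"
    using left_comul[of "inv c" "inv b" h h' "inv x" k] c
    by (simp add: swapped_def inv_mult_group m_assoc cong: sum.cong)
next
  fix y h assume "y \<in> carrier G" "h \<in> carrier G"
  then show "(\<Sum>g\<in>carrier G. swapped \<one> g y h) = (if h = \<one> then 1 else 0)"
    using right_counit[of "inv y" h] by (simp add: swapped_def)
next
  fix x g assume "x \<in> carrier G" "g \<in> carrier G"
  then show "(\<Sum>h\<in>carrier G. swapped x g \<one> h) = (if g = \<one> then 1 else 0)"
    using left_counit[of "inv x" g] by (simp add: swapped_def)
qed

lemma conj_one_left: "R \<one> g y h \<noteq> 0 \<Longrightarrow> g \<in> carrier G \<Longrightarrow> y \<in> carrier G \<Longrightarrow> h \<in> carrier G \<Longrightarrow> inv h \<otimes> y \<otimes> h = y"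
  using supp[of \<one> g y h] by simp

lemma conj_one_right: "R x g \<one> h \<noteq> 0 \<Longrightarrow> g \<in> carrier G \<Longrightarrow> x \<in> carrier G \<Longrightarrow> h \<in> carrier G \<Longrightarrow> inv g \<otimes> x \<otimes> g = x"
  using supp[of x g \<one> h] by simp

text \<open>
  Summing over \<open>h\<close> applies the counit of the group algebra: this is the value of \<open>u(e\<^sub>g)\<close> at \<open>y\<close>.
\<close>

definition u_coeff :: "'a \<Rightarrow> 'a \<Rightarrow> 'k" where
  "u_coeff g y = (\<Sum>h\<in>carrier G. R \<one> g y h)"

text \<open>
  The index \<open>h\<close> commutes with \<open>y\<close> wherever \<open>R \<one> g y h\<close> is nonzero, so the conjugation in the
  multiplication of the double is invisible here.
\<close>

lemma u_coeff_mult: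
  assumes "g \<in> carrier G" "g' \<in> carrier G" "y \<in> carrier G"
  shows "u_coeff g y * u_coeff g' y = (if g = g' then u_coeff g y else 0)"
proof -
  have "(if g = g' then u_coeff g y else 0) = (\<Sum>k\<in>carrier G. if g = g' then R (\<one> \<otimes> \<one>) g y k else 0)"
    by (simp add: u_coeff_def)
  also have "\<dots> = (\<Sum>k\<in>carrier G. \<Sum>h\<in>carrier G. R \<one> g y h * R \<one> g' (inv h \<otimes> y \<otimes> h) (inv h \<otimes> k))"
    using assms by (intro sum.cong refl, subst left_comul) auto
  also have "\<dots> = (\<Sum>h\<in>carrier G. \<Sum>k\<in>carrier G. R \<one> g y h * R \<one> g' (inv h \<otimes> y \<otimes> h) (inv h \<otimes> k))"
    by (rule sum.swap)
  also have "\<dots> = (\<Sum>h\<in>carrier G. R \<one> g y h * u_coeff g' y)"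
  proof (intro sum.cong refl)
    fix h assume h: "h \<in> carrier G"
    show "(\<Sum>k\<in>carrier G. R \<one> g y h * R \<one> g' (inv h \<otimes> y \<otimes> h) (inv h \<otimes> k)) = R \<one> g y h * u_coeff g' y"
    proof (cases "R \<one> g y h = 0")
      case False
      then have "inv h \<otimes> y \<otimes> h = y" using conj_one_left assms h by simp
      then show ?thesis
        using sum_translate(1)[of "inv h" "R \<one> g' y"] h by (simp add: u_coeff_def flip: sum_distrib_left)
    qed simp
  qed
  also have "\<dots> = u_coeff g y * u_coeff g' y" by (simp add: u_coeff_def sum_distrib_right)
  finally show ?thesis by simp
qed

lemma sum_u_coeff: "y \<in> carrier G \<Longrightarrow> (\<Sum>g\<in>carrier G. u_coeff g y) = 1"
  unfolding u_coeff_def using left_counit fin by (subst sum.swap) simp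

definition U :: "'a \<Rightarrow> 'a" where
  "U y = (THE g. g \<in> carrier G \<and> u_coeff g y \<noteq> 0)"

text \<open>
  Orthogonal idempotents of a field with sum \<open>1\<close>: exactly one of them is \<open>1\<close>.
\<close>

lemma U:
  assumes y: "y \<in> carrier G"
  shows U_closed: "U y \<in> carrier G"
    and u_coeff_eq: "g \<in> carrier G \<Longrightarrow> u_coeff g y = (if g = U y then 1 else 0)"
proof -
  have "\<exists>g\<in>carrier G. u_coeff g y \<noteq> 0"
    using sum_u_coeff[OF y] by (metis (mono_tags, lifting) sum.neutral zero_neq_one)
  moreover have "g = g'" if "g \<in> carrier G" "g' \<in> carrier G" "u_coeff g y \<noteq> 0" "u_coeff g' y \<noteq> 0" for g g'
    using u_coeff_mult[of g g' y] that y by (auto split: if_splits)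
  ultimately have ex1: "\<exists>!g. g \<in> carrier G \<and> u_coeff g y \<noteq> 0" by blast
  note * = theI'[OF ex1, folded U_def]
  then show "U y \<in> carrier G" by simp
  have "u_coeff (U y) y = 1" using u_coeff_mult[of "U y" "U y" y] * y by simp
  moreover have "u_coeff g y = 0" if "g \<in> carrier G" "g \<noteq> U y" using that ex1 * by blast
  ultimately show "g \<in> carrier G \<Longrightarrow> u_coeff g y = (if g = U y then 1 else 0)" by auto
qed

lemma u_coeff_eqD: "y \<in> carrier G \<Longrightarrow> g \<in> carrier G \<Longrightarrow> u_coeff g y \<noteq> 0 \<Longrightarrow> g = U y"
  using u_coeff_eq[of y g] by (auto split: if_splits)

lemma U_mult:
  assumes "c \<in> carrier G" "b \<in> carrier G"
  shows "U (c \<otimes> b) = U c \<otimes> U b"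
proof -
  define k where "k = U (c \<otimes> b)"
  have k: "k \<in> carrier G" using U_closed assms by (simp add: k_def)
  have "1 = u_coeff k (c \<otimes> b)" using u_coeff_eq[of "c \<otimes> b" k] k assms by (simp add: k_def)
  also have "\<dots> = (\<Sum>h\<in>carrier G. \<Sum>h'\<in>carrier G. if h = h' then R \<one> k (c \<otimes> b) h else 0)"
    using fin by (simp add: u_coeff_def)
  also have "\<dots> = (\<Sum>h\<in>carrier G. \<Sum>h'\<in>carrier G. \<Sum>g\<in>carrier G. R \<one> g c h * R (inv g \<otimes> \<one> \<otimes> g) (inv g \<otimes> k) b h')"
    using assms k by (intro sum.cong refl, subst right_comul) auto
  also have "\<dots> = (\<Sum>h\<in>carrier G. \<Sum>g\<in>carrier G. \<Sum>h'\<in>carrier G. R \<one> g c h * R (inv g \<otimes> \<one> \<otimes> g) (inv g \<otimes> k) b h')"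
    by (rule sum.cong[OF refl], rule sum.swap)
  also have "\<dots> = (\<Sum>g\<in>carrier G. \<Sum>h\<in>carrier G. \<Sum>h'\<in>carrier G. R \<one> g c h * R (inv g \<otimes> \<one> \<otimes> g) (inv g \<otimes> k) b h')"
    by (rule sum.swap)
  also have "\<dots> = (\<Sum>g\<in>carrier G. u_coeff g c * u_coeff (inv g \<otimes> k) b)"
    by (intro sum.cong refl) (simp add: u_coeff_def sum_product)
  finally have "(\<Sum>g\<in>carrier G. u_coeff g c * u_coeff (inv g \<otimes> k) b) \<noteq> 0" by simp
  then obtain g where g: "g \<in> carrier G" "u_coeff g c \<noteq> 0" "u_coeff (inv g \<otimes> k) b \<noteq> 0"
    by (metis (no_types, lifting) sum.neutral mult_eq_0_iff)
  then have "g = U c" "inv g \<otimes> k = U b" using u_coeff_eqD assms k by auto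
  then have "k = U c \<otimes> U b" using inv_mult_eq_iff[of g k "U b"] g k assms U_closed by simp
  then show ?thesis by (simp add: k_def)
qed

lemma U_conj:
  assumes "k \<in> carrier G" "y \<in> carrier G"
  shows "U (k \<otimes> y \<otimes> inv k) = k \<otimes> U y \<otimes> inv k"
proof -
  have "u_coeff (k \<otimes> U y \<otimes> inv k) (k \<otimes> y \<otimes> inv k) = (\<Sum>h\<in>carrier G. R \<one> (k \<otimes> U y \<otimes> inv k) (k \<otimes> y \<otimes> inv k) (k \<otimes> h \<otimes> inv k))"
    unfolding u_coeff_def
    using sum_translate(3)[OF assms(1), of "R \<one> (k \<otimes> U y \<otimes> inv k) (k \<otimes> y \<otimes> inv k)"] by simp
  also have "\<dots> = u_coeff (U y) y"
    unfolding u_coeff_def using conj_R[of k \<one> "U y" y] assms U_closed by (auto intro!: sum.cong)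
  also have "\<dots> = 1" using u_coeff_eq U_closed assms by simp
  finally show ?thesis using u_coeff_eqD[of "k \<otimes> y \<otimes> inv k" "k \<otimes> U y \<otimes> inv k"] assms U_closed by simp
qed

lemma normal_endo_U: "normal_endo G U"
  using U_closed U_mult U_conj by (simp add: normal_endo_def hom_def)

definition p :: "'a \<Rightarrow> 'a \<Rightarrow> 'k" where
  "p g h = R \<one> g \<one> h"

lemma R_one_left:
  assumes "g \<in> carrier G" "y \<in> carrier G" "h \<in> carrier G"
  shows "R \<one> g y h = p (inv (U y) \<otimes> g) h"
proof -
  have "R \<one> g y h = (\<Sum>h'\<in>carrier G. if h' = h then R \<one> g (y \<otimes> \<one>) h' else 0)"
    using fin assms by (simp add: sum.delta)
  also have "\<dots> = (\<Sum>h'\<in>carrier G. \<Sum>g'\<in>carrier G. R \<one> g' y h' * R (inv g' \<otimes> \<one> \<otimes> g') (inv g' \<otimes> g) \<one> h)"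
    using assms by (intro sum.cong refl, subst right_comul) auto
  also have "\<dots> = (\<Sum>g'\<in>carrier G. \<Sum>h'\<in>carrier G. R \<one> g' y h' * R (inv g' \<otimes> \<one> \<otimes> g') (inv g' \<otimes> g) \<one> h)"
    by (rule sum.swap)
  also have "\<dots> = (\<Sum>g'\<in>carrier G. u_coeff g' y * p (inv g' \<otimes> g) h)"
    by (intro sum.cong refl) (simp add: u_coeff_def p_def sum_distrib_right)
  also have "\<dots> = (\<Sum>g'\<in>carrier G. if g' = U y then p (inv g' \<otimes> g) h else 0)"
    using assms by (intro sum.cong refl) (simp add: u_coeff_eq)
  also have "\<dots> = p (inv (U y) \<otimes> g) h" using fin U_closed assms by simp
  finally show ?thesis .
qed

text \<open>
  The value \<open>p g h\<close> is the coefficient \<open>R \<one> (U y \<otimes> g) y h\<close> for every \<open>y\<close>, and the support condition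
  makes \<open>h\<close> commute with that \<open>y\<close>.
\<close>

lemma p_central_right:
  assumes "p g h \<noteq> 0" "g \<in> carrier G" "h \<in> carrier G"
  shows "h \<in> centre G"
proof -
  have "h \<otimes> y = y \<otimes> h" if y: "y \<in> carrier G" for y
  proof -
    have "R \<one> (U y \<otimes> g) y h \<noteq> 0"
      using R_one_left[of "U y \<otimes> g" y h] assms y U_closed by (simp add: inv_mult_cancel)
    then have "inv h \<otimes> y \<otimes> h = y" using conj_one_left assms y U_closed by simp
    then have "y \<otimes> h = h \<otimes> y" using inv_mult_eq_iff[of h "y \<otimes> h" y] assms y by (simp add: m_assoc)
    then show ?thesis by simp
  qed
  then show ?thesis using assms by (auto simp: centre_def)
qed

end

context rmatrix
begin

interpretation sw: rmatrix G swapped by (rule rmatrix_swapped)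

lemma p_swapped: "sw.p h g = p g h"
  by (simp add: sw.p_def p_def swapped_def)

lemma p_central_left:
  assumes "p g h \<noteq> 0" "g \<in> carrier G" "h \<in> carrier G"
  shows "g \<in> centre G"
  using sw.p_central_right[of h g] assms by (simp add: p_swapped)

lemma p_conj:
  assumes "g \<in> carrier G" "h \<in> carrier G" "k \<in> carrier G"
  shows "p (k \<otimes> g \<otimes> inv k) h = p g h" "p g (k \<otimes> h \<otimes> inv k) = p g h"
proof -
  have "p (k \<otimes> g \<otimes> inv k) h = p g h" "p g (k \<otimes> h \<otimes> inv k) = p g h"
    if a: "g \<in> carrier G" "h \<in> carrier G" "k \<in> carrier G" for g h k
  proof -
    show "p (k \<otimes> g \<otimes> inv k) h = p g h"
    proof (cases "g \<in> centre G")
      case True then show ?thesis using centre_conj a by simp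
    next
      case False
      then have "k \<otimes> g \<otimes> inv k \<notin> centre G" using centre_conj_iff a by simp
      with False show ?thesis using p_central_left a by (metis inv_closed m_closed)
    qed
    show "p g (k \<otimes> h \<otimes> inv k) = p g h"
    proof (cases "h \<in> centre G")
      case True then show ?thesis using centre_conj a by simp
    next
      case False
      then have "k \<otimes> h \<otimes> inv k \<notin> centre G" using centre_conj_iff a by simp
      with False show ?thesis using p_central_right a by (metis inv_closed m_closed)
    qed
  qed
  then show "p (k \<otimes> g \<otimes> inv k) h = p g h" "p g (k \<otimes> h \<otimes> inv k) = p g h" using assms by auto
qed

text \<open>
  The map \<open>g \<mapsto> v(g)\<^sup>-\<^sup>1\<close>. The inversion in \<open>swapped\<close> makes it multiplicative, whereas \<open>v\<close> itself reverses
  products.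
\<close>

definition V :: "'a \<Rightarrow> 'a" where "V = rmatrix.U G swapped"

lemma normal_endo_V: "normal_endo G V"
  unfolding V_def by (rule sw.normal_endo_U)

lemmas U_simps = normal_endoD[OF normal_endo_U]
lemmas V_simps = normal_endoD[OF normal_endo_V]

lemma sum_R_one_right:
  assumes "x \<in> carrier G" "h \<in> carrier G"
  shows "(\<Sum>g\<in>carrier G. R x g \<one> h) = (if h = inv (V x) then 1 else 0)"
  using sw.u_coeff_eq[of "inv x" h] assms V_simps by (simp add: sw.u_coeff_def swapped_def flip: V_def)

definition r :: "'a \<Rightarrow> 'a \<Rightarrow> 'k" where
  "r x y = (\<Sum>h\<in>carrier G. \<Sum>g\<in>carrier G. R x g y h)"

text \<open>
  The case \<open>c = \<one>\<close> of the second comultiplication identity relates the sums for any two values of \<open>h\<close>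
  to the known coefficients \<open>R x g \<one> h\<close>, and shows that only one of these sums can be nonzero.
\<close>

lemma sum_R:
  assumes "x \<in> carrier G" "y \<in> carrier G" "h \<in> carrier G"
  shows "(\<Sum>g\<in>carrier G. R x g y h) = (if h = inv (V x) then r x y else 0)"
proof -
  let ?w = "\<lambda>h. \<Sum>g\<in>carrier G. R x g y h"
  have *: "(if h = inv (V x) then ?w h' else 0) = (if h = h' then ?w h else 0)"
    if h: "h \<in> carrier G" "h' \<in> carrier G" for h h'
  proof -
    have "(if h = h' then ?w h else 0) = (\<Sum>k\<in>carrier G. if h = h' then R x k (\<one> \<otimes> y) h else 0)"
      using assms by simp
    also have "\<dots> = (\<Sum>k\<in>carrier G. \<Sum>g\<in>carrier G. R x g \<one> h * R (inv g \<otimes> x \<otimes> g) (inv g \<otimes> k) y h')"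
      using assms h by (intro sum.cong refl, subst right_comul) auto
    also have "\<dots> = (\<Sum>g\<in>carrier G. \<Sum>k\<in>carrier G. R x g \<one> h * R (inv g \<otimes> x \<otimes> g) (inv g \<otimes> k) y h')"
      by (rule sum.swap)
    also have "\<dots> = (\<Sum>g\<in>carrier G. R x g \<one> h * ?w h')"
    proof (intro sum.cong refl)
      fix g assume g: "g \<in> carrier G"
      show "(\<Sum>k\<in>carrier G. R x g \<one> h * R (inv g \<otimes> x \<otimes> g) (inv g \<otimes> k) y h') = R x g \<one> h * ?w h'"
      proof (cases "R x g \<one> h = 0")
        case False
        then have "inv g \<otimes> x \<otimes> g = x" using conj_one_right assms g h by simp
        then show ?thesis
          using sum_translate(1)[of "inv g" "\<lambda>k. R x k y h'"] g by (simp flip: sum_distrib_left)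
      qed simp
    qed
    also have "\<dots> = (if h = inv (V x) then ?w h' else 0)"
      using sum_R_one_right[OF assms(1) h(1)] by (simp flip: sum_distrib_right)
    finally show ?thesis by simp
  qed
  have zero: "?w h = 0" if "h \<in> carrier G" "h \<noteq> inv (V x)" for h
    using *[of h h] that by auto
  have V: "inv (V x) \<in> carrier G" using V_simps assms by simp
  have "r x y = (\<Sum>h\<in>carrier G. if h = inv (V x) then ?w h else 0)"
    unfolding r_def by (intro sum.cong refl) (use zero in auto)
  also have "\<dots> = ?w (inv (V x))" using fin V by simp
  finally show ?thesis using zero assms by auto
qed

text \<open>
  In the case \<open>a = \<one>\<close> of the first comultiplication identity sum over \<open>g'\<close>. On the left-hand side one
  factor becomes a value of \<open>p\<close> and the other one a value of \<open>r\<close>; on the right-hand side a single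
  coefficient remains.
\<close>

lemma R_eq:
  assumes "x \<in> carrier G" "g \<in> carrier G" "y \<in> carrier G" "k \<in> carrier G"
  shows "R x g y k = r x y * p (inv (U y) \<otimes> g) (V x \<otimes> k)"
proof -
  let ?c = "inv (U y) \<otimes> g"
  have c: "?c \<in> carrier G" using assms U_closed by simp
  have V: "V x \<in> carrier G" using V_simps assms by simp
  have "R x g y k = (\<Sum>g'\<in>carrier G. if g = g' then R (x \<otimes> \<one>) g y k else 0)"
    using fin assms by simp
  also have "\<dots> = (\<Sum>g'\<in>carrier G. \<Sum>h\<in>carrier G. R \<one> g y h * R x g' (inv h \<otimes> y \<otimes> h) (inv h \<otimes> k))"
    using assms by (intro sum.cong refl, subst left_comul) auto
  also have "\<dots> = (\<Sum>h\<in>carrier G. \<Sum>g'\<in>carrier G. R \<one> g y h * R x g' (inv h \<otimes> y \<otimes> h) (inv h \<otimes> k))"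
    by (rule sum.swap)
  also have "\<dots> = (\<Sum>h\<in>carrier G. if h = k \<otimes> V x then p ?c h * r x y else 0)"
  proof (intro sum.cong refl)
    fix h assume h: "h \<in> carrier G"
    show "(\<Sum>g'\<in>carrier G. R \<one> g y h * R x g' (inv h \<otimes> y \<otimes> h) (inv h \<otimes> k)) =
        (if h = k \<otimes> V x then p ?c h * r x y else 0)"
    proof (cases "R \<one> g y h = 0")
      case False
      have eq: "inv h \<otimes> k = inv (V x) \<longleftrightarrow> h = k \<otimes> V x"
        using inv_mult_eq_iff[of h k "inv (V x)"] h assms V
          by (metis inv_closed inv_solve_right m_closed)
      from False have "inv h \<otimes> y \<otimes> h = y" using conj_one_left assms h by simp
      then have "(\<Sum>g'\<in>carrier G. R \<one> g y h * R x g' (inv h \<otimes> y \<otimes> h) (inv h \<otimes> k)) =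
          R \<one> g y h * (if inv h \<otimes> k = inv (V x) then r x y else 0)"
        using sum_R[of x y "inv h \<otimes> k"] h assms by (simp flip: sum_distrib_left)
      then show ?thesis using R_one_left[of g y h] assms h by (simp add: eq)
    next
      case True
      then show ?thesis using R_one_left[of g y h] assms h by auto
    qed
  qed
  also have "\<dots> = p ?c (k \<otimes> V x) * r x y" using fin assms V by simp
  also have "p ?c (k \<otimes> V x) = p ?c (V x \<otimes> k)"
    using p_conj(2)[of ?c "k \<otimes> V x" "V x"] c V assms by (simp add: group_normalize)
  finally show ?thesis by simp
qed

lemma r_twisted_left:
  assumes "a \<in> carrier G" "b \<in> carrier G" "y \<in> carrier G"
  shows "r (b \<otimes> a) y = r a y * r b (V a \<otimes> y \<otimes> inv (V a))"
proof -
  have V: "V a \<in> carrier G" using V_simps assms by simp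
  let ?F = "\<lambda>h g g' k. R a g y h * R b g' (inv h \<otimes> y \<otimes> h) (inv h \<otimes> k)"
  have "r (b \<otimes> a) y = (\<Sum>k\<in>carrier G. \<Sum>g\<in>carrier G. \<Sum>g'\<in>carrier G. if g = g' then R (b \<otimes> a) g y k else 0)"
    using fin by (simp add: r_def)
  also have "\<dots> = (\<Sum>k\<in>carrier G. \<Sum>g\<in>carrier G. \<Sum>g'\<in>carrier G. \<Sum>h\<in>carrier G. ?F h g g' k)"
    using assms by (intro sum.cong refl, subst left_comul) auto
  also have "\<dots> = (\<Sum>k\<in>carrier G. \<Sum>g\<in>carrier G. \<Sum>h\<in>carrier G. \<Sum>g'\<in>carrier G. ?F h g g' k)"
    by (rule sum.cong[OF refl], rule sum.cong[OF refl], rule sum.swap)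
  also have "\<dots> = (\<Sum>k\<in>carrier G. \<Sum>h\<in>carrier G. \<Sum>g\<in>carrier G. \<Sum>g'\<in>carrier G. ?F h g g' k)"
    by (rule sum.cong[OF refl], rule sum.swap)
  also have "\<dots> = (\<Sum>h\<in>carrier G. \<Sum>k\<in>carrier G. \<Sum>g\<in>carrier G. \<Sum>g'\<in>carrier G. ?F h g g' k)"
    by (rule sum.swap)
  also have "\<dots> = (\<Sum>h\<in>carrier G. if h = inv (V a) then r a y * r b (inv h \<otimes> y \<otimes> h) else 0)"
  proof (intro sum.cong refl)
    fix h assume h: "h \<in> carrier G"
    have "(\<Sum>k\<in>carrier G. \<Sum>g\<in>carrier G. \<Sum>g'\<in>carrier G. R a g y h * R b g' (inv h \<otimes> y \<otimes> h) (inv h \<otimes> k)) =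
      (\<Sum>g\<in>carrier G. R a g y h) * (\<Sum>k\<in>carrier G. \<Sum>g'\<in>carrier G. R b g' (inv h \<otimes> y \<otimes> h) (inv h \<otimes> k))"
      by (simp add: sum_distrib_left sum_product flip: sum_product)
    also have "(\<Sum>k\<in>carrier G. \<Sum>g'\<in>carrier G. R b g' (inv h \<otimes> y \<otimes> h) (inv h \<otimes> k)) = r b (inv h \<otimes> y \<otimes> h)"
      unfolding r_def using sum_translate(1)[of "inv h" "\<lambda>k. \<Sum>g'\<in>carrier G. R b g' (inv h \<otimes> y \<otimes> h) k"] h by simp
    finally show "(\<Sum>k\<in>carrier G. \<Sum>g\<in>carrier G. \<Sum>g'\<in>carrier G. R a g y h * R b g' (inv h \<otimes> y \<otimes> h) (inv h \<otimes> k)) =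
      (if h = inv (V a) then r a y * r b (inv h \<otimes> y \<otimes> h) else 0)"
      using sum_R[of a y h] assms h by simp
  qed
  also have "\<dots> = r a y * r b (V a \<otimes> y \<otimes> inv (V a))" using fin V by simp
  finally show ?thesis .
qed

lemma r_conj:
  assumes "k \<in> carrier G" "x \<in> carrier G" "y \<in> carrier G"
  shows "r (k \<otimes> x \<otimes> inv k) (k \<otimes> y \<otimes> inv k) = r x y"
proof -
  have "r (k \<otimes> x \<otimes> inv k) (k \<otimes> y \<otimes> inv k) = (\<Sum>h\<in>carrier G. \<Sum>g\<in>carrier G.
      R (k \<otimes> x \<otimes> inv k) (k \<otimes> g \<otimes> inv k) (k \<otimes> y \<otimes> inv k) (k \<otimes> h \<otimes> inv k))"
    unfolding r_def
    by (simp add: sum_translate(3)[OF assms(1), where \<phi> = "\<lambda>h. \<Sum>g\<in>carrier G. R _ g _ h"]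
      sum_translate(3)[OF assms(1), where \<phi> = "\<lambda>g. R _ g _ _"])
  then show ?thesis using conj_R assms by (simp add: r_def)
qed

lemma r_one: "y \<in> carrier G \<Longrightarrow> r \<one> y = 1"
  unfolding r_def using left_counit fin by simp

lemma r_nonzero:
  assumes "x \<in> carrier G" "y \<in> carrier G"
  shows "r x y \<noteq> 0"
  using r_twisted_left[of x "inv x" y] r_one[of y] assms by auto

end

context rmatrix
begin

interpretation sw: rmatrix G swapped by (rule rmatrix_swapped)

lemma r_swapped: "rmatrix.r G swapped y x = r (inv x) (inv y)"
  unfolding sw.r_def r_def swapped_def by (rule sum.swap)

lemma V_swapped: "y \<in> carrier G \<Longrightarrow> rmatrix.V G swapped y = U y"
  unfolding sw.V_def rmatrix.U_def[OF sw.rmatrix_swapped] U_def rmatrix.u_coeff_def[OF sw.rmatrix_swapped] u_coeff_def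
  by (simp add: sw.swapped_def swapped_def)

lemma r_twisted_right:
  assumes "c \<in> carrier G" "b \<in> carrier G" "x \<in> carrier G"
  shows "r x (c \<otimes> b) = r x c * r (inv (U c) \<otimes> x \<otimes> U c) b"
  using sw.r_twisted_left[of "inv c" "inv b" "inv x"] assms U_simps
  by (simp add: r_swapped V_swapped inv_mult_group m_assoc)

text \<open>
  As \<open>r x y\<close> is nonzero, there is a nonzero coefficient \<open>R x g y h\<close>. Its indices \<open>g\<close> and \<open>h\<close> agree with
  \<open>U y\<close> and \<open>V(x)\<^sup>-\<^sup>1\<close> up to the centre, and the support condition is insensitive to the centre.
\<close>

lemma double_conj:
  assumes "x \<in> carrier G" "y \<in> carrier G"
  shows "V x \<otimes> y \<otimes> inv (V x) \<otimes> (inv (U y) \<otimes> x \<otimes> U y) = x \<otimes> y"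
proof -
  have c: "V x \<in> carrier G" "U y \<in> carrier G" using assms V_simps U_simps by auto
  from r_nonzero[OF assms] obtain h g where "h \<in> carrier G" "g \<in> carrier G" "R x g y h \<noteq> 0"
    unfolding r_def by (metis (no_types, lifting) sum.neutral)
  note gh = this
  define a b where "a = inv (U y) \<otimes> g" and "b = V x \<otimes> h"
  have ab: "a \<in> carrier G" "b \<in> carrier G" using c gh by (auto simp: a_def b_def)
  have "p a b \<noteq> 0" using R_eq[of x g y h] gh assms by (auto simp: a_def b_def)
  then have Z: "a \<in> centre G" "b \<in> centre G" using p_central_left p_central_right ab by auto
  have g: "g = U y \<otimes> a" and h: "h = inv (V x) \<otimes> b"
    using c gh by (auto simp: a_def b_def inv_mult_cancel)
  have "inv h \<otimes> y \<otimes> h = inv b \<otimes> (V x \<otimes> y \<otimes> inv (V x)) \<otimes> b"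
    using c ab assms by (simp add: h group_normalize)
  also have "\<dots> = V x \<otimes> y \<otimes> inv (V x)"
    using conj_by_centre(1)[OF Z(2)] c assms by simp
  finally have 1: "inv h \<otimes> y \<otimes> h = V x \<otimes> y \<otimes> inv (V x)" .
  have "inv g \<otimes> x \<otimes> g = inv a \<otimes> (inv (U y) \<otimes> x \<otimes> U y) \<otimes> a"
    using c ab assms by (simp add: g group_normalize)
  also have "\<dots> = inv (U y) \<otimes> x \<otimes> U y"
    using conj_by_centre(1)[OF Z(1)] c assms by simp
  finally show ?thesis using supp[OF assms(1) gh(2) assms(2) gh(1) gh(3)] 1 by simp
qed

end

section \<open>Hopf algebra maps from functions to the group algebra of the centre\<close>

text \<open>
  The linear map \<open>e\<^sub>c \<mapsto> \<Sum>\<^sub>d q(c,d) d\<close> from \<open>k\<^sup>K\<close> to \<open>kK\<close> is a homomorphism of bialgebras whose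
  matrix is supported on the centre: the clauses after the support express compatibility with product,
  coproduct, unit and counit.
\<close>

definition central_Hopf_matrix :: "('a, 'm) monoid_scheme \<Rightarrow> ('a \<Rightarrow> 'a \<Rightarrow> 'k::field) \<Rightarrow> bool" where
  "central_Hopf_matrix K q \<longleftrightarrow>
     (\<forall>c\<in>carrier K. \<forall>d\<in>carrier K. q c d \<noteq> 0 \<longrightarrow> c \<in> centre K \<and> d \<in> centre K) \<and>
     (\<forall>c\<in>carrier K. \<forall>c'\<in>carrier K. \<forall>d\<in>carrier K.
        (\<Sum>h\<in>carrier K. q c h * q c' (inv\<^bsub>K\<^esub> h \<otimes>\<^bsub>K\<^esub> d)) = (if c = c' then q c d else 0)) \<and>
     (\<forall>c\<in>carrier K. \<forall>d\<in>carrier K. \<forall>d'\<in>carrier K.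
        (\<Sum>g\<in>carrier K. q g d * q (inv\<^bsub>K\<^esub> g \<otimes>\<^bsub>K\<^esub> c) d') = (if d = d' then q c d else 0)) \<and>
     (\<forall>d\<in>carrier K. (\<Sum>c\<in>carrier K. q c d) = (if d = \<one>\<^bsub>K\<^esub> then 1 else 0)) \<and>
     (\<forall>c\<in>carrier K. (\<Sum>d\<in>carrier K. q c d) = (if c = \<one>\<^bsub>K\<^esub> then 1 else 0))"

lemma central_Hopf_matrixD:
  assumes "central_Hopf_matrix K q"
  shows "\<And>c d. c \<in> carrier K \<Longrightarrow> d \<in> carrier K \<Longrightarrow> q c d \<noteq> 0 \<Longrightarrow> c \<in> centre K"
    and "\<And>c d. c \<in> carrier K \<Longrightarrow> d \<in> carrier K \<Longrightarrow> q c d \<noteq> 0 \<Longrightarrow> d \<in> centre K"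
    and "\<And>c c' d. c \<in> carrier K \<Longrightarrow> c' \<in> carrier K \<Longrightarrow> d \<in> carrier K \<Longrightarrow>
        (\<Sum>h\<in>carrier K. q c h * q c' (inv\<^bsub>K\<^esub> h \<otimes>\<^bsub>K\<^esub> d)) = (if c = c' then q c d else 0)"
    and "\<And>c d d'. c \<in> carrier K \<Longrightarrow> d \<in> carrier K \<Longrightarrow> d' \<in> carrier K \<Longrightarrow>
        (\<Sum>g\<in>carrier K. q g d * q (inv\<^bsub>K\<^esub> g \<otimes>\<^bsub>K\<^esub> c) d') = (if d = d' then q c d else 0)"
    and "\<And>d. d \<in> carrier K \<Longrightarrow> (\<Sum>c\<in>carrier K. q c d) = (if d = \<one>\<^bsub>K\<^esub> then 1 else 0)"
    and "\<And>c. c \<in> carrier K \<Longrightarrow> (\<Sum>d\<in>carrier K. q c d) = (if c = \<one>\<^bsub>K\<^esub> then 1 else 0)"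
  using assms unfolding central_Hopf_matrix_def by blast+

lemma central_Hopf_matrix_transpose:
  "central_Hopf_matrix K q \<Longrightarrow> central_Hopf_matrix K (\<lambda>c d. q d c)"
  unfolding central_Hopf_matrix_def by blast

text \<open>
  The matrix of the convolution product of the two maps.
\<close>

definition convolve :: "('a, 'm) monoid_scheme \<Rightarrow> ('a \<Rightarrow> 'a \<Rightarrow> 'k::field) \<Rightarrow> ('a \<Rightarrow> 'a \<Rightarrow> 'k) \<Rightarrow> 'a \<Rightarrow> 'a \<Rightarrow> 'k" where
  "convolve K P Q c d =
     (\<Sum>s\<in>carrier K. \<Sum>t\<in>carrier K. P s t * Q (inv\<^bsub>K\<^esub> s \<otimes>\<^bsub>K\<^esub> c) (inv\<^bsub>K\<^esub> t \<otimes>\<^bsub>K\<^esub> d))"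

lemma convolve_transpose: "convolve K (\<lambda>c d. P d c) (\<lambda>c d. Q d c) = (\<lambda>c d. convolve K P Q d c)"
  unfolding convolve_def by (intro ext, rule sum.swap)

context group
begin

lemma central_Hopf_matrix_conj:
  assumes q: "central_Hopf_matrix G q" and c: "c \<in> carrier G" "d \<in> carrier G" "k \<in> carrier G"
  shows "q (k \<otimes> c \<otimes> inv k) d = q c d"
proof (cases "c \<in> centre G")
  case True then show ?thesis using centre_conj c by simp
next
  case False
  then have "k \<otimes> c \<otimes> inv k \<notin> centre G" using centre_conj_iff c by simp
  then have "q (k \<otimes> c \<otimes> inv k) d = 0" "q c d = 0"
    using False central_Hopf_matrixD(1)[OF q] c by (metis inv_closed m_closed)+
  then show ?thesis by simp
qed

text \<open>
  A convolution product of algebra maps into a commutative algebra is an algebra map. Commutativity enters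
  where the central element \<open>t'\<close> is moved past the summation index.
\<close>

lemma convolve_mult:
  fixes P Q :: "'a \<Rightarrow> 'a \<Rightarrow> 'k::field"
  assumes fin: "finite (carrier G)" and P: "central_Hopf_matrix G P" and Q: "central_Hopf_matrix G Q"
    and c: "c \<in> carrier G" "c' \<in> carrier G" "d \<in> carrier G"
  shows "(\<Sum>h\<in>carrier G. convolve G P Q c h * convolve G P Q c' (inv h \<otimes> d)) =
    (if c = c' then convolve G P Q c d else 0)"
proof -
  let ?C = "carrier G"
  have step1: "(\<Sum>h\<in>?C. P s t * Q (inv s \<otimes> c) (inv t \<otimes> h) * (P s' t' * Q (inv s' \<otimes> c') (inv t' \<otimes> (inv h \<otimes> d)))) =
      P s t * P s' t' * (if inv s \<otimes> c = inv s' \<otimes> c' then Q (inv s \<otimes> c) (inv (t \<otimes> t') \<otimes> d) else 0)"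
    if s: "s \<in> ?C" "t \<in> ?C" "s' \<in> ?C" "t' \<in> ?C" for s t s' t'
  proof (cases "P s' t' = 0")
    case False
    then have t': "t' \<in> centre G" using central_Hopf_matrixD(2)[OF P] s by blast
    have "(\<Sum>h\<in>?C. Q (inv s \<otimes> c) (inv t \<otimes> h) * Q (inv s' \<otimes> c') (inv t' \<otimes> (inv h \<otimes> d))) =
       (\<Sum>u\<in>?C. Q (inv s \<otimes> c) u * Q (inv s' \<otimes> c') (inv u \<otimes> (inv (t \<otimes> t') \<otimes> d)))"
    proof (subst sum_translate(1)[OF s(2), symmetric], intro sum.cong refl)
      fix u assume u: "u \<in> ?C"
      have "inv t' \<otimes> (inv (t \<otimes> u) \<otimes> d) = (inv t' \<otimes> inv u) \<otimes> (inv t \<otimes> d)"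
        using s u c by (simp add: group_normalize)
      also have "inv t' \<otimes> inv u = inv u \<otimes> inv t'"
        using centreD(2)[OF centre_inv[OF t']] u by simp
      finally have "inv t' \<otimes> (inv (t \<otimes> u) \<otimes> d) = inv u \<otimes> (inv (t \<otimes> t') \<otimes> d)"
        using s u c by (simp add: group_normalize)
      then show "Q (inv s \<otimes> c) (inv t \<otimes> (t \<otimes> u)) * Q (inv s' \<otimes> c') (inv t' \<otimes> (inv (t \<otimes> u) \<otimes> d)) =
          Q (inv s \<otimes> c) u * Q (inv s' \<otimes> c') (inv u \<otimes> (inv (t \<otimes> t') \<otimes> d))"
        using s u by (simp add: inv_mult_cancel)
    qed
    also have "\<dots> = (if inv s \<otimes> c = inv s' \<otimes> c' then Q (inv s \<otimes> c) (inv (t \<otimes> t') \<otimes> d) else 0)"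
      using central_Hopf_matrixD(3)[OF Q] s c by simp
    finally have "(\<Sum>h\<in>?C. Q (inv s \<otimes> c) (inv t \<otimes> h) * Q (inv s' \<otimes> c') (inv t' \<otimes> (inv h \<otimes> d))) =
        (if inv s \<otimes> c = inv s' \<otimes> c' then Q (inv s \<otimes> c) (inv (t \<otimes> t') \<otimes> d) else 0)" .
    from arg_cong[OF this, of "\<lambda>x. P s t * P s' t' * x"] show ?thesis
      by (simp only: sum_distrib_left mult.assoc mult.left_commute)
  qed simp
  have step2: "(\<Sum>t\<in>?C. \<Sum>t'\<in>?C. P s t * P s' t' * \<phi> (t \<otimes> t')) = (if s = s' then (\<Sum>m\<in>?C. P s m * \<phi> m) else 0)"
    if s: "s \<in> ?C" "s' \<in> ?C" for s s' and \<phi> :: "'a \<Rightarrow> 'k"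
  proof -
    have "(\<Sum>t\<in>?C. \<Sum>t'\<in>?C. P s t * P s' t' * \<phi> (t \<otimes> t')) = (\<Sum>t\<in>?C. \<Sum>m\<in>?C. P s t * P s' (inv t \<otimes> m) * \<phi> m)"
    proof (rule sum.cong[OF refl])
      fix t assume t: "t \<in> ?C"
      show "(\<Sum>t'\<in>?C. P s t * P s' t' * \<phi> (t \<otimes> t')) = (\<Sum>m\<in>?C. P s t * P s' (inv t \<otimes> m) * \<phi> m)"
        using sum_translate(1)[OF t, of "\<lambda>m. P s t * P s' (inv t \<otimes> m) * \<phi> m"] t
        by (simp add: inv_mult_cancel cong: sum.cong)
    qed
    also have "\<dots> = (\<Sum>m\<in>?C. (\<Sum>t\<in>?C. P s t * P s' (inv t \<otimes> m)) * \<phi> m)"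
      by (subst sum.swap) (simp add: sum_distrib_right)
    also have "\<dots> = (\<Sum>m\<in>?C. (if s = s' then P s m else 0) * \<phi> m)"
      using central_Hopf_matrixD(3)[OF P] s by simp
    finally show ?thesis by simp
  qed
  let ?F = "\<lambda>h s s' t t'. P s t * Q (inv s \<otimes> c) (inv t \<otimes> h) * (P s' t' * Q (inv s' \<otimes> c') (inv t' \<otimes> (inv h \<otimes> d)))"
  have "(\<Sum>h\<in>?C. convolve G P Q c h * convolve G P Q c' (inv h \<otimes> d)) =
     (\<Sum>h\<in>?C. \<Sum>s\<in>?C. \<Sum>s'\<in>?C. \<Sum>t\<in>?C. \<Sum>t'\<in>?C. ?F h s s' t t')"
    unfolding convolve_def by (simp only: sum_product)
  also have "\<dots> = (\<Sum>s\<in>?C. \<Sum>h\<in>?C. \<Sum>s'\<in>?C. \<Sum>t\<in>?C. \<Sum>t'\<in>?C. ?F h s s' t t')"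
    by (rule sum.swap)
  also have "\<dots> = (\<Sum>s\<in>?C. \<Sum>s'\<in>?C. \<Sum>h\<in>?C. \<Sum>t\<in>?C. \<Sum>t'\<in>?C. ?F h s s' t t')"
    by (rule sum.cong[OF refl], rule sum.swap)
  also have "\<dots> = (\<Sum>s\<in>?C. \<Sum>s'\<in>?C. \<Sum>t\<in>?C. \<Sum>h\<in>?C. \<Sum>t'\<in>?C. ?F h s s' t t')"
    by (rule sum.cong[OF refl], rule sum.cong[OF refl], rule sum.swap)
  also have "\<dots> = (\<Sum>s\<in>?C. \<Sum>s'\<in>?C. \<Sum>t\<in>?C. \<Sum>t'\<in>?C. \<Sum>h\<in>?C. ?F h s s' t t')"
    by (rule sum.cong[OF refl], rule sum.cong[OF refl], rule sum.cong[OF refl], rule sum.swap)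
  also have "\<dots> = (\<Sum>s\<in>?C. \<Sum>s'\<in>?C. \<Sum>t\<in>?C. \<Sum>t'\<in>?C.
      P s t * P s' t' * (\<lambda>m. if inv s \<otimes> c = inv s' \<otimes> c' then Q (inv s \<otimes> c) (inv m \<otimes> d) else 0) (t \<otimes> t'))"
    by (intro sum.cong refl) (simp only: step1)
  also have "\<dots> = (\<Sum>s\<in>?C. \<Sum>s'\<in>?C. if s = s' then \<Sum>m\<in>?C. P s m * (if inv s \<otimes> c = inv s' \<otimes> c' then Q (inv s \<otimes> c) (inv m \<otimes> d) else 0) else 0)"
  proof (rule sum.cong[OF refl], rule sum.cong[OF refl])
    fix s s' assume "s \<in> ?C" "s' \<in> ?C"
    from step2[OF this, of "\<lambda>m. if inv s \<otimes> c = inv s' \<otimes> c' then Q (inv s \<otimes> c) (inv m \<otimes> d) else 0"]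
    show "(\<Sum>t\<in>?C. \<Sum>t'\<in>?C. P s t * P s' t' *
        (\<lambda>m. if inv s \<otimes> c = inv s' \<otimes> c' then Q (inv s \<otimes> c) (inv m \<otimes> d) else 0) (t \<otimes> t')) =
      (if s = s' then \<Sum>m\<in>?C. P s m * (if inv s \<otimes> c = inv s' \<otimes> c' then Q (inv s \<otimes> c) (inv m \<otimes> d) else 0) else 0)" .
  qed
  also have "\<dots> = (\<Sum>s\<in>?C. \<Sum>m\<in>?C. P s m * (if inv s \<otimes> c = inv s \<otimes> c' then Q (inv s \<otimes> c) (inv m \<otimes> d) else 0))"
    using fin by (simp add: sum.delta')
  also have "\<dots> = (\<Sum>s\<in>?C. \<Sum>m\<in>?C. P s m * (if c = c' then Q (inv s \<otimes> c) (inv m \<otimes> d) else 0))"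
    using c by (intro sum.cong refl) (simp add: inv_mult_eq_iff inv_mult_cancel)
  also have "\<dots> = (if c = c' then convolve G P Q c d else 0)"
    by (simp add: convolve_def)
  finally show ?thesis .
qed

lemma convolve_unit:
  assumes fin: "finite (carrier G)" and P: "central_Hopf_matrix G P" and Q: "central_Hopf_matrix G Q"
    and d: "d \<in> carrier G"
  shows "(\<Sum>c\<in>carrier G. convolve G P Q c d) = (if d = \<one> then 1 else 0)"
proof -
  let ?C = "carrier G"
  have "(\<Sum>c\<in>?C. convolve G P Q c d) = (\<Sum>s\<in>?C. \<Sum>t\<in>?C. \<Sum>c\<in>?C. P s t * Q (inv s \<otimes> c) (inv t \<otimes> d))"
    unfolding convolve_def by (subst sum.swap, rule sum.cong[OF refl], rule sum.swap)
  also have "\<dots> = (\<Sum>s\<in>?C. \<Sum>t\<in>?C. if d = t then P s t else 0)"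
  proof (intro sum.cong refl)
    fix s t assume s: "s \<in> ?C" "t \<in> ?C"
    have "(\<Sum>c\<in>?C. Q (inv s \<otimes> c) (inv t \<otimes> d)) = (if inv t \<otimes> d = \<one> then 1 else 0)"
      using sum_translate(1)[of "inv s" "\<lambda>c. Q c (inv t \<otimes> d)"] central_Hopf_matrixD(5)[OF Q] s d by simp
    then show "(\<Sum>c\<in>?C. P s t * Q (inv s \<otimes> c) (inv t \<otimes> d)) = (if d = t then P s t else 0)"
      using inv_mult_eq_iff[of t d \<one>] s d by (simp flip: sum_distrib_left)
  qed
  also have "\<dots> = (\<Sum>s\<in>?C. P s d)" using fin d by simp
  finally show ?thesis using central_Hopf_matrixD(5)[OF P d] by simp
qed

lemma convolve_support:
  assumes P: "central_Hopf_matrix G P" and Q: "central_Hopf_matrix G Q"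
    and c: "c \<in> carrier G" "d \<in> carrier G" "convolve G P Q c d \<noteq> 0"
  shows "c \<in> centre G" "d \<in> centre G"
proof -
  obtain s t where s: "s \<in> carrier G" "t \<in> carrier G" "P s t * Q (inv s \<otimes> c) (inv t \<otimes> d) \<noteq> 0"
    using c(3) unfolding convolve_def by (metis (mono_tags, lifting) sum.neutral)
  have "s \<in> centre G" "inv s \<otimes> c \<in> centre G" "t \<in> centre G" "inv t \<otimes> d \<in> centre G"
    using s c central_Hopf_matrixD(1,2)[OF P, of s t]
      central_Hopf_matrixD(1,2)[OF Q, of "inv s \<otimes> c" "inv t \<otimes> d"] by auto
  then have "s \<otimes> (inv s \<otimes> c) \<in> centre G" "t \<otimes> (inv t \<otimes> d) \<in> centre G"
    using centre_mult by blast+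
  then show "c \<in> centre G" "d \<in> centre G" using s c by (simp_all add: inv_mult_cancel)
qed

text \<open>
  The clauses for coproduct and counit follow from those for product and unit: transposition exchanges
  them and respects convolution.
\<close>

lemma central_Hopf_matrix_convolve:
  assumes fin: "finite (carrier G)" and P: "central_Hopf_matrix G P" and Q: "central_Hopf_matrix G Q"
  shows "central_Hopf_matrix G (convolve G P Q)"
proof -
  note P' = central_Hopf_matrix_transpose[OF P] and Q' = central_Hopf_matrix_transpose[OF Q]
  show ?thesis
    unfolding central_Hopf_matrix_def
    by (intro conjI ballI impI convolve_support[OF P Q] convolve_mult[OF fin P Q] convolve_unit[OF fin P Q]
        convolve_mult[OF fin P' Q', unfolded convolve_transpose[of G P Q]]
        convolve_unit[OF fin P' Q', unfolded convolve_transpose[of G P Q]])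
qed

end

lemma (in rmatrix) central_Hopf_matrix_p: "central_Hopf_matrix G p"
proof -
  have 1: "(\<Sum>h\<in>carrier G. p c h * p c' (inv h \<otimes> d)) = (if c = c' then p c d else 0)"
    if "c \<in> carrier G" "c' \<in> carrier G" "d \<in> carrier G" for c c' d
    using left_comul[of \<one> \<one> c c' \<one> d] that by (simp add: p_def cong: sum.cong)
  have 2: "(\<Sum>g\<in>carrier G. p g d * p (inv g \<otimes> c) d') = (if d = d' then p c d else 0)"
    if "c \<in> carrier G" "d \<in> carrier G" "d' \<in> carrier G" for c d d'
    using right_comul[of \<one> c \<one> \<one> d d'] that by (simp add: p_def cong: sum.cong)
  have 3: "(\<Sum>c\<in>carrier G. p c d) = (if d = \<one> then 1 else 0)" if "d \<in> carrier G" for d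
    using left_counit[of \<one> d] that by (simp add: p_def)
  have 4: "(\<Sum>d\<in>carrier G. p c d) = (if c = \<one> then 1 else 0)" if "c \<in> carrier G" for c
    using right_counit[of \<one> c] that by (simp add: p_def)
  show ?thesis
    unfolding central_Hopf_matrix_def
    by (intro conjI ballI impI 1 2 3 4) (auto dest: p_central_left p_central_right)
qed

section \<open>The structure maps of the double of a group\<close>

lemma sum_delta_product:
  assumes "finite A" "finite B"
  shows "(\<Sum>(x, y)\<in>A \<times> B. if x = a \<and> y = b then \<phi> x y else 0) = (if a \<in> A \<and> b \<in> B then \<phi> a b else (0::'k::comm_monoid_add))"
proof -
  have "(\<Sum>(x, y)\<in>A \<times> B. if x = a \<and> y = b then \<phi> x y else 0) =
      (\<Sum>z\<in>A \<times> B. if z = (a, b) then \<phi> a b else 0)"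
    by (rule sum.cong) (auto simp: prod_eq_iff split: prod.split if_splits)
  then show ?thesis using assms by simp
qed

lemma basis_fun_co: "basis (fun_co K) = carrier K"
  by (simp add: fun_co_def)

lemma basis_grp_alg: "basis (grp_alg K) = carrier K"
  by (simp add: grp_alg_def)

lemma basis_double: "basis (double K :: ('g \<times> 'g, 'k::field) bialg) = carrier K \<times> carrier K"
  by (simp add: double_def tensor_def basis_fun_co basis_grp_alg)

context group
begin

context
  assumes fin: "finite (carrier G)"
begin

lemma mul_fun_co: "mul (fun_co G) a b z = (if z \<in> carrier G then a z * b z else (0::'k::field))"
proof -
  have "mul (fun_co G) a b z = (\<Sum>x\<in>carrier G. \<Sum>y\<in>carrier G. if y = x then (if x = z then a x * b x else 0) else 0)"
    unfolding mul_def basis_fun_co by (intro sum.cong refl) (auto simp: fun_co_def \<delta>_def)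
  also have "\<dots> = (\<Sum>x\<in>carrier G. if x = z then a x * b x else 0)" using fin by simp
  finally show ?thesis using fin by simp
qed

lemma mul_grp_alg:
  "mul (grp_alg G) a b z = (if z \<in> carrier G then \<Sum>g\<in>carrier G. a g * b (inv g \<otimes> z) else (0::'k::field))"
proof (cases "z \<in> carrier G")
  case True
  have "mul (grp_alg G) a b z = (\<Sum>g\<in>carrier G. \<Sum>h\<in>carrier G. if h = inv g \<otimes> z then a g * b h else 0)"
    unfolding mul_def
  proof (simp add: grp_alg_def \<delta>_def, intro sum.cong refl)
    fix g h assume "g \<in> carrier G" "h \<in> carrier G"
    then have "z = g \<otimes> h \<longleftrightarrow> h = inv g \<otimes> z" using inv_mult_eq_iff[of g z h] True by auto
    then show "a g * b h * (if z = g \<otimes> h then 1 else 0) = (if h = inv g \<otimes> z then a g * b h else 0)" by simp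
  qed
  then show ?thesis using fin True by simp
next
  case False
  then show ?thesis unfolding mul_def by (auto simp: grp_alg_def \<delta>_def intro!: sum.neutral)
qed

lemma bcomult_fun_co:
  assumes "x \<in> carrier G"
  shows "bcomult (fun_co G) x (s, t) = (if s \<in> carrier G \<and> t \<in> carrier G \<and> x = t \<otimes> s then 1 else (0::'k::field))"
proof -
  have "bcomult (fun_co G) x (s, t) = (\<Sum>s'\<in>carrier G. if s' = s then if t = x \<otimes> inv s then 1 else 0 else (0::'k))"
    unfolding fun_co_def bialg.select_convs by (intro sum.cong refl) (auto simp: tens_def \<delta>_def)
  also have "\<dots> = (if s \<in> carrier G \<and> t = x \<otimes> inv s then 1 else 0)" using fin by simp
  also have "s \<in> carrier G \<and> t = x \<otimes> inv s \<longleftrightarrow> s \<in> carrier G \<and> t \<in> carrier G \<and> x = t \<otimes> s"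
    using assms inv_solve_right[of t x s] by auto
  finally show ?thesis .
qed

lemma comul_fun_co:
  "comul (fun_co G) a (s, t) = (if s \<in> carrier G \<and> t \<in> carrier G then a (t \<otimes> s) else (0::'k::field))"
proof -
  have "comul (fun_co G) a (s, t) = (\<Sum>x\<in>carrier G. if x = t \<otimes> s then if s \<in> carrier G \<and> t \<in> carrier G then a x else 0 else 0)"
    unfolding comul_def basis_fun_co by (intro sum.cong refl) (auto simp: bcomult_fun_co)
  then show ?thesis using fin by auto
qed

lemma comul_grp_alg:
  "comul (grp_alg G) a (s, t) = (if s \<in> carrier G \<and> s = t then a s else (0::'k::field))"
proof -
  have "comul (grp_alg G) a (s, t) = (\<Sum>x\<in>carrier G. if x = s then if s = t then a s else 0 else 0)"
    unfolding comul_def grp_alg_def bialg.select_convs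
    by (intro sum.cong refl) (auto simp: tens_def \<delta>_def)
  then show ?thesis using fin by auto
qed

lemma bunit_double: "bunit (double G) (x, g) = (if x \<in> carrier G \<and> g = \<one> then 1 else (0::'k::field))"
  by (simp add: double_def tensor_def fun_co_def grp_alg_def tens_def \<delta>_def)

lemma bcounit_double: "bcounit (double G) (x, g) = (if x = \<one> then 1 else (0::'k::field))"
  by (simp add: double_def tensor_def fun_co_def grp_alg_def tens_def \<delta>_def)

lemma bmult_double:
  assumes "x \<in> carrier G" "g \<in> carrier G" "y \<in> carrier G" "h \<in> carrier G"
  shows "bmult (double G) (x, g) (y, h) (w, k) =
    (if x = w \<and> g \<otimes> y \<otimes> inv g = w \<and> g \<otimes> h = k then 1 else (0::'k::field))"
proof -
  have "conj_act G g (\<delta> y) w = (if g \<otimes> y \<otimes> inv g = w then 1 else (0::'k))" for w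
  proof -
    have "conj_act G g (\<delta> y) w = (\<Sum>x\<in>carrier G. if x = y then if g \<otimes> y \<otimes> inv g = w then 1 else 0 else (0::'k))"
      unfolding conj_act_def by (intro sum.cong refl) (auto simp: \<delta>_def)
    then show ?thesis using fin assms by simp
  qed
  then show ?thesis using assms by (auto simp: double_def tens_def mul_fun_co \<delta>_def)
qed

text \<open>
  A product of basis vectors is a basis vector or \<open>0\<close>. For a left factor \<open>e\<^sub>w \<bowtie> h\<close> there is exactly one
  right factor that produces \<open>e\<^sub>w \<bowtie> k\<close>.
\<close>

lemma sum_bmult_double:
  "(\<Sum>x\<in>basis (double G). \<Sum>y\<in>basis (double G). \<phi> x y * bmult (double G) x y (w, k)) =
    (if w \<in> carrier G \<and> k \<in> carrier G
     then \<Sum>h\<in>carrier G. \<phi> (w, h) (inv h \<otimes> w \<otimes> h, inv h \<otimes> k) else (0::'k::field))"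
proof -
  let ?C = "carrier G"
  have inner: "(\<Sum>y\<in>?C \<times> ?C. \<phi> (x, g) y * bmult (double G) (x, g) y (w, k)) =
      (if x = w then if w \<in> ?C \<and> k \<in> ?C then \<phi> (w, g) (inv g \<otimes> w \<otimes> g, inv g \<otimes> k) else 0 else 0)"
    if xg: "x \<in> ?C" "g \<in> ?C" for x g
  proof -
    have "(\<Sum>y\<in>?C \<times> ?C. \<phi> (x, g) y * bmult (double G) (x, g) y (w, k)) =
       (\<Sum>(y, h)\<in>?C \<times> ?C. if y = inv g \<otimes> w \<otimes> g \<and> h = inv g \<otimes> k
          then if x = w \<and> w \<in> ?C \<and> k \<in> ?C then \<phi> (x, g) (y, h) else 0 else 0)"
    proof (intro sum.cong refl)
      fix z assume "z \<in> ?C \<times> ?C"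
      then obtain y h where z: "z = (y, h)" and yh: "y \<in> ?C" "h \<in> ?C" by blast
      have 1: "g \<otimes> h = k \<longleftrightarrow> k \<in> ?C \<and> h = inv g \<otimes> k"
        using inv_mult_eq_iff[of g k h] xg yh by auto
      have 2: "g \<otimes> y \<otimes> inv g = w \<longleftrightarrow> w \<in> ?C \<and> y = inv g \<otimes> w \<otimes> g"
        using xg yh by (auto simp: group_normalize)
      have "\<phi> (x, g) (y, h) * bmult (double G) (x, g) (y, h) (w, k) =
          (if y = inv g \<otimes> w \<otimes> g \<and> h = inv g \<otimes> k then if x = w \<and> w \<in> ?C \<and> k \<in> ?C then \<phi> (x, g) (y, h) else 0 else 0)"
        unfolding bmult_double[OF xg yh] 1 2 by auto
      then show "\<phi> (x, g) z * bmult (double G) (x, g) z (w, k) = (case z of (y, h) \<Rightarrow>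
          if y = inv g \<otimes> w \<otimes> g \<and> h = inv g \<otimes> k then if x = w \<and> w \<in> ?C \<and> k \<in> ?C then \<phi> (x, g) (y, h) else 0 else 0)"
        by (simp only: z prod.case)
    qed
    also have "\<dots> = (if inv g \<otimes> w \<otimes> g \<in> ?C \<and> inv g \<otimes> k \<in> ?C then
        if x = w \<and> w \<in> ?C \<and> k \<in> ?C then \<phi> (x, g) (inv g \<otimes> w \<otimes> g, inv g \<otimes> k) else 0 else 0)"
      by (rule sum_delta_product[OF fin fin])
    finally show ?thesis using xg by auto
  qed
  have "(\<Sum>x\<in>basis (double G). \<Sum>y\<in>basis (double G). \<phi> x y * bmult (double G) x y (w, k)) =
     (\<Sum>(x, g)\<in>?C \<times> ?C. if x = w then if w \<in> ?C \<and> k \<in> ?C then \<phi> (w, g) (inv g \<otimes> w \<otimes> g, inv g \<otimes> k) else 0 else 0)"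
    unfolding basis_double by (intro sum.cong refl) (auto simp: inner)
  also have "\<dots> = (\<Sum>g\<in>?C. \<Sum>x\<in>?C. if x = w then if w \<in> ?C \<and> k \<in> ?C then \<phi> (w, g) (inv g \<otimes> w \<otimes> g, inv g \<otimes> k) else 0 else 0)"
    by (subst sum.cartesian_product[symmetric], rule sum.swap)
  finally show ?thesis using fin by (cases "w \<in> ?C") auto
qed

lemma mul_double:
  "mul (double G) a b (w, k) = (if w \<in> carrier G \<and> k \<in> carrier G
     then \<Sum>h\<in>carrier G. a (w, h) * b (inv h \<otimes> w \<otimes> h, inv h \<otimes> k) else (0::'k::field))"
  unfolding mul_def by (rule sum_bmult_double)

lemma bcomult_double:
  assumes "x \<in> carrier G"
  shows "bcomult (double G) (x, g) ((x1, g1), (x2, g2)) =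
    (if x1 \<in> carrier G \<and> x2 \<in> carrier G \<and> x = x2 \<otimes> x1 \<and> g1 = g \<and> g2 = g then 1 else (0::'k::field))"
proof -
  have "bcomult (double G) (x, g) ((x1, g1), (x2, g2)) = bcomult (fun_co G) x (x1, x2) * bcomult (grp_alg G) g (g1, g2)"
    by (simp add: double_def tensor_def)
  then show ?thesis using assms by (auto simp: bcomult_fun_co grp_alg_def tens_def \<delta>_def)
qed

lemma comul_double:
  "comul (double G) a ((x1, g1), (x2, g2)) =
    (if x1 \<in> carrier G \<and> x2 \<in> carrier G \<and> g1 \<in> carrier G \<and> g1 = g2 then a (x2 \<otimes> x1, g1) else (0::'k::field))"
proof -
  have "comul (double G) a ((x1, g1), (x2, g2)) =
     (\<Sum>(x, g)\<in>carrier G \<times> carrier G. if x = x2 \<otimes> x1 \<and> g = g1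
        then if x1 \<in> carrier G \<and> x2 \<in> carrier G \<and> g1 = g2 then a (x, g) else 0 else 0)"
    unfolding comul_def basis_double by (intro sum.cong refl) (auto simp: bcomult_double)
  also have "\<dots> = (if x2 \<otimes> x1 \<in> carrier G \<and> g1 \<in> carrier G then
      if x1 \<in> carrier G \<and> x2 \<in> carrier G \<and> g1 = g2 then a (x2 \<otimes> x1, g1) else 0 else 0)"
    by (rule sum_delta_product[OF fin fin])
  finally show ?thesis by auto
qed

lemma counit_double: "counit (double G) a = (\<Sum>g\<in>carrier G. a (\<one>, g) :: 'k::field)"
proof -
  have "counit (double G) a = (\<Sum>(x, g)\<in>carrier G \<times> carrier G. if x = \<one> then a (x, g) else 0)"
    unfolding counit_def basis_double by (intro sum.cong refl) (auto simp: bcounit_double)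
  also have "\<dots> = (\<Sum>g\<in>carrier G. \<Sum>x\<in>carrier G. if x = \<one> then a (x, g) else 0)"
    by (subst sum.cartesian_product[symmetric], rule sum.swap)
  finally show ?thesis using fin by simp
qed

end

end

section \<open>Bialgebra endomorphisms in coordinates\<close>

definition linear_of :: "'b set \<Rightarrow> ('b \<Rightarrow> 'b \<Rightarrow> 'k::field) \<Rightarrow> ('b \<Rightarrow> 'k) \<Rightarrow> 'b \<Rightarrow> 'k" where
  "linear_of B N a = (\<lambda>z. \<Sum>x\<in>B. a x * N x z)"

lemma linear_of_\<delta>: "finite B \<Longrightarrow> x \<in> B \<Longrightarrow> linear_of B N (\<delta> x) = N x"
  unfolding linear_of_def \<delta>_def by (simp add: sum.delta if_distrib[of "\<lambda>a. a * _"] cong: if_cong)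

lemma linear_end_linear_of:
  assumes "\<And>x z. x \<in> B \<Longrightarrow> z \<notin> B \<Longrightarrow> N x z = 0"
  shows "linear_end B (linear_of B N)"
  using assms unfolding linear_end_def linear_of_def vecs_def
  by (auto simp: sum.distrib distrib_right sum_distrib_left mult.assoc intro!: sum.neutral)

lemma Hopf_End_linear_ofI:
  fixes H :: "('b, 'k::field) bialg"
  assumes fin: "finite (basis H)"
    and closed: "\<And>x z. x \<in> basis H \<Longrightarrow> z \<notin> basis H \<Longrightarrow> N x z = 0"
    and mult: "\<And>x y z. x \<in> basis H \<Longrightarrow> y \<in> basis H \<Longrightarrow>
      (\<Sum>w\<in>basis H. bmult H x y w * N w z) = mul H (N x) (N y) z"
    and unit: "\<And>z. (\<Sum>x\<in>basis H. bunit H x * N x z) = bunit H z"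
    and comult: "\<And>x z. x \<in> basis H \<Longrightarrow>
      comul H (N x) z = (\<Sum>(b, c)\<in>basis H \<times> basis H. bcomult H x (b, c) * tens (N b) (N c) z)"
    and counit: "\<And>x. x \<in> basis H \<Longrightarrow> counit H (N x) = bcounit H x"
  shows "linear_of (basis H) N \<in> Hopf_End H"
proof -
  let ?B = "basis H" and ?L = "linear_of (basis H) N"
  have "?L (mul H a b) z = mul H (?L a) (?L b) z" for a b z
  proof -
    let ?F = "\<lambda>x x' y y'. (a x * N x x') * (b y * N y y') * bmult H x' y' z"
    have "?L (mul H a b) z = (\<Sum>w\<in>?B. \<Sum>x\<in>?B. \<Sum>y\<in>?B. a x * b y * (bmult H x y w * N w z))"
      unfolding linear_of_def mul_def by (simp add: sum_distrib_right mult.assoc)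
    also have "\<dots> = (\<Sum>x\<in>?B. \<Sum>w\<in>?B. \<Sum>y\<in>?B. a x * b y * (bmult H x y w * N w z))" by (rule sum.swap)
    also have "\<dots> = (\<Sum>x\<in>?B. \<Sum>y\<in>?B. \<Sum>w\<in>?B. a x * b y * (bmult H x y w * N w z))"
      by (rule sum.cong[OF refl], rule sum.swap)
    also have "\<dots> = (\<Sum>x\<in>?B. \<Sum>y\<in>?B. a x * b y * mul H (N x) (N y) z)"
      by (intro sum.cong refl) (simp add: mult flip: sum_distrib_left)
    also have "\<dots> = (\<Sum>x\<in>?B. \<Sum>y\<in>?B. \<Sum>x'\<in>?B. \<Sum>y'\<in>?B. ?F x x' y y')"
      unfolding mul_def by (simp add: sum_distrib_left algebra_simps)
    also have "\<dots> = (\<Sum>x\<in>?B. \<Sum>x'\<in>?B. \<Sum>y\<in>?B. \<Sum>y'\<in>?B. ?F x x' y y')"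
      by (rule sum.cong[OF refl], rule sum.swap)
    also have "\<dots> = (\<Sum>x'\<in>?B. \<Sum>x\<in>?B. \<Sum>y\<in>?B. \<Sum>y'\<in>?B. ?F x x' y y')"
      by (rule sum.swap)
    also have "\<dots> = (\<Sum>x'\<in>?B. \<Sum>x\<in>?B. \<Sum>y'\<in>?B. \<Sum>y\<in>?B. ?F x x' y y')"
      by (rule sum.cong[OF refl], rule sum.cong[OF refl], rule sum.swap)
    also have "\<dots> = (\<Sum>x'\<in>?B. \<Sum>y'\<in>?B. \<Sum>x\<in>?B. \<Sum>y\<in>?B. ?F x x' y y')"
      by (rule sum.cong[OF refl], rule sum.swap)
    also have "\<dots> = mul H (?L a) (?L b) z"
      unfolding linear_of_def mul_def sum_product by (simp only: sum_distrib_right)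
    finally show ?thesis .
  qed
  moreover have "?L (bunit H) = bunit H" unfolding linear_of_def using unit by (simp add: fun_eq_iff)
  moreover have "comul H (?L a) z = tensor_map ?B ?L ?L (comul H a) z" for a z
  proof -
    have "comul H (?L a) z = (\<Sum>x\<in>?B. a x * comul H (N x) z)"
      unfolding linear_of_def comul_def
      by (simp add: sum_distrib_left sum_distrib_right mult.assoc) (rule sum.swap)
    also have "\<dots> = (\<Sum>x\<in>?B. \<Sum>(b, c)\<in>?B \<times> ?B. a x * bcomult H x (b, c) * tens (N b) (N c) z)"
      by (intro sum.cong refl) (simp add: comult sum_distrib_left case_prod_unfold mult.assoc)
    also have "\<dots> = (\<Sum>(b, c)\<in>?B \<times> ?B. \<Sum>x\<in>?B. a x * bcomult H x (b, c) * tens (N b) (N c) z)"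
      unfolding case_prod_unfold by (rule sum.swap)
    also have "\<dots> = tensor_map ?B ?L ?L (comul H a) z"
      unfolding tensor_map_def comul_def using fin
      by (intro sum.cong refl) (auto simp: linear_of_\<delta> sum_distrib_right)
    finally show ?thesis .
  qed
  moreover have "counit H (?L a) = counit H a" for a
  proof -
    have "counit H (?L a) = (\<Sum>x\<in>?B. a x * counit H (N x))"
      unfolding linear_of_def counit_def
      by (simp add: sum_distrib_left sum_distrib_right mult.assoc) (rule sum.swap)
    then show ?thesis using counit by (simp add: counit_def)
  qed
  ultimately show ?thesis
    unfolding Hopf_End_def using linear_end_linear_of[of ?B N] closed by (auto simp: fun_eq_iff)
qed

section \<open>Endomorphisms of the double from endomorphisms of the group\<close>

text \<open>
  The matrix of \<open>f \<bowtie> x \<mapsto> \<beta>(x) (f\<^sub>1 \<circ> a) \<bowtie> \<gamma>(f\<^sub>2) a'(x)\<close>, where \<open>\<gamma>(e\<^sub>c) = \<Sum>\<^sub>d q(c,d) d\<close> has central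
  values. In this form no Sweedler components remain.
\<close>

definition double_matrix :: "('a, 'm) monoid_scheme \<Rightarrow> ('a \<Rightarrow> 'a) \<Rightarrow> ('a \<Rightarrow> 'a) \<Rightarrow> ('a \<Rightarrow> 'a \<Rightarrow> 'k::field) \<Rightarrow>
    ('a \<Rightarrow> 'a \<Rightarrow> 'k) \<Rightarrow> 'a \<times> 'a \<Rightarrow> 'a \<times> 'a \<Rightarrow> 'k" where
  "double_matrix K a a' \<beta> q = (\<lambda>(y, x) (w, k).
     if w \<in> carrier K \<and> k \<in> carrier K
     then \<beta> x w * q (inv\<^bsub>K\<^esub> (a w) \<otimes>\<^bsub>K\<^esub> y) (inv\<^bsub>K\<^esub> (a' x) \<otimes>\<^bsub>K\<^esub> k) else 0)"

lemma double_matrix_outside: "v \<notin> carrier K \<times> carrier K \<Longrightarrow> double_matrix K a a' \<beta> q w v = 0"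
  by (cases w; cases v) (auto simp: double_matrix_def)

definition bicharacter :: "('a, 'm) monoid_scheme \<Rightarrow> ('a \<Rightarrow> 'a \<Rightarrow> 'k::field) \<Rightarrow> bool" where
  "bicharacter K \<beta> \<longleftrightarrow>
     (\<forall>x\<in>carrier K. \<forall>y\<in>carrier K. \<beta> x y \<noteq> 0) \<and>
     (\<forall>x\<in>carrier K. \<forall>x'\<in>carrier K. \<forall>y\<in>carrier K. \<beta> (x \<otimes>\<^bsub>K\<^esub> x') y = \<beta> x y * \<beta> x' y) \<and>
     (\<forall>x\<in>carrier K. \<forall>y\<in>carrier K. \<forall>y'\<in>carrier K. \<beta> x (y \<otimes>\<^bsub>K\<^esub> y') = \<beta> x y * \<beta> x y')"

lemma (in group) bicharacterD:
  assumes "bicharacter G \<beta>"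
  shows "\<And>x y. x \<in> carrier G \<Longrightarrow> y \<in> carrier G \<Longrightarrow> \<beta> x y \<noteq> 0"
    and "\<And>x x' y. x \<in> carrier G \<Longrightarrow> x' \<in> carrier G \<Longrightarrow> y \<in> carrier G \<Longrightarrow> \<beta> (x \<otimes> x') y = \<beta> x y * \<beta> x' y"
    and "\<And>x y y'. x \<in> carrier G \<Longrightarrow> y \<in> carrier G \<Longrightarrow> y' \<in> carrier G \<Longrightarrow> \<beta> x (y \<otimes> y') = \<beta> x y * \<beta> x y'"
    and "\<And>y. y \<in> carrier G \<Longrightarrow> \<beta> \<one> y = 1"
    and "\<And>x. x \<in> carrier G \<Longrightarrow> \<beta> x \<one> = 1"
    and "\<And>x y k. x \<in> carrier G \<Longrightarrow> y \<in> carrier G \<Longrightarrow> k \<in> carrier G \<Longrightarrow> \<beta> (inv k \<otimes> x \<otimes> k) y = \<beta> x y"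
    and "\<And>x y k. x \<in> carrier G \<Longrightarrow> y \<in> carrier G \<Longrightarrow> k \<in> carrier G \<Longrightarrow> \<beta> x (inv k \<otimes> y \<otimes> k) = \<beta> x y"
proof -
  show 0: "\<And>x y. x \<in> carrier G \<Longrightarrow> y \<in> carrier G \<Longrightarrow> \<beta> x y \<noteq> 0"
    and 1: "\<And>x x' y. x \<in> carrier G \<Longrightarrow> x' \<in> carrier G \<Longrightarrow> y \<in> carrier G \<Longrightarrow> \<beta> (x \<otimes> x') y = \<beta> x y * \<beta> x' y"
    and 2: "\<And>x y y'. x \<in> carrier G \<Longrightarrow> y \<in> carrier G \<Longrightarrow> y' \<in> carrier G \<Longrightarrow> \<beta> x (y \<otimes> y') = \<beta> x y * \<beta> x y'"
    using assms by (auto simp: bicharacter_def)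
  show 3: "\<beta> \<one> y = 1" if "y \<in> carrier G" for y using 1[of \<one> \<one> y] 0[of \<one> y] that by simp
  show 4: "\<beta> x \<one> = 1" if "x \<in> carrier G" for x using 2[of x \<one> \<one>] 0[of x \<one>] that by simp
  show "\<beta> (inv k \<otimes> x \<otimes> k) y = \<beta> x y" if "x \<in> carrier G" "y \<in> carrier G" "k \<in> carrier G" for x y k
    using 1[of "inv k" k y] 3[of y] that by (simp add: 1 mult.assoc mult.left_commute)
  show "\<beta> x (inv k \<otimes> y \<otimes> k) = \<beta> x y" if "x \<in> carrier G" "y \<in> carrier G" "k \<in> carrier G" for x y k
    using 2[of x "inv k" k] 4[of x] that by (simp add: 2 mult.assoc mult.left_commute)
qed

definition central_endo :: "('a, 'm) monoid_scheme \<Rightarrow> ('a \<Rightarrow> 'a) \<Rightarrow> bool" where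
  "central_endo K a \<longleftrightarrow> a \<in> hom K K \<and> (\<forall>x\<in>carrier K. inv\<^bsub>K\<^esub> x \<otimes>\<^bsub>K\<^esub> a x \<in> centre K)"

context group
begin

lemma conj_eq_of_central_quotient:
  assumes "x \<in> carrier G" "y \<in> carrier G" "inv x \<otimes> y \<in> centre G" "m \<in> carrier G"
  shows "y \<otimes> m \<otimes> inv y = x \<otimes> m \<otimes> inv x" "inv y \<otimes> m \<otimes> y = inv x \<otimes> m \<otimes> x"
proof -
  define z where "z = inv x \<otimes> y"
  have z: "z \<in> centre G" "z \<in> carrier G" and y: "y = x \<otimes> z"
    using assms by (auto simp: z_def inv_mult_cancel)
  have "y \<otimes> m \<otimes> inv y = x \<otimes> (z \<otimes> m \<otimes> inv z) \<otimes> inv x" using assms z by (simp add: y group_normalize)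
  then show "y \<otimes> m \<otimes> inv y = x \<otimes> m \<otimes> inv x" using conj_by_centre(2)[OF z(1) assms(4)] by simp
  have "inv y \<otimes> m \<otimes> y = inv z \<otimes> (inv x \<otimes> m \<otimes> x) \<otimes> z" using assms z by (simp add: y group_normalize)
  then show "inv y \<otimes> m \<otimes> y = inv x \<otimes> m \<otimes> x" using conj_by_centre(1)[OF z(1), of "inv x \<otimes> m \<otimes> x"] assms by simp
qed

lemma central_endoD:
  assumes "central_endo G a"
  shows "\<And>x. x \<in> carrier G \<Longrightarrow> a x \<in> carrier G"
    and "\<And>x y. x \<in> carrier G \<Longrightarrow> y \<in> carrier G \<Longrightarrow> a (x \<otimes> y) = a x \<otimes> a y"
    and "\<And>x. x \<in> carrier G \<Longrightarrow> a (inv x) = inv (a x)"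
    and "a \<one> = \<one>"
    and "\<And>x m. x \<in> carrier G \<Longrightarrow> m \<in> carrier G \<Longrightarrow> a x \<otimes> m \<otimes> inv (a x) = x \<otimes> m \<otimes> inv x"
    and "\<And>x m. x \<in> carrier G \<Longrightarrow> m \<in> carrier G \<Longrightarrow> inv (a x) \<otimes> m \<otimes> a x = inv x \<otimes> m \<otimes> x"
proof -
  have h: "a \<in> hom G G" using assms by (simp add: central_endo_def)
  interpret group_hom G G a by (unfold_locales) (rule h)
  show "\<And>x. x \<in> carrier G \<Longrightarrow> a x \<in> carrier G"
    "\<And>x y. x \<in> carrier G \<Longrightarrow> y \<in> carrier G \<Longrightarrow> a (x \<otimes> y) = a x \<otimes> a y"
    "\<And>x. x \<in> carrier G \<Longrightarrow> a (inv x) = inv (a x)"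
    "a \<one> = \<one>"
    by auto
  show "a x \<otimes> m \<otimes> inv (a x) = x \<otimes> m \<otimes> inv x" "inv (a x) \<otimes> m \<otimes> a x = inv x \<otimes> m \<otimes> x"
    if "x \<in> carrier G" "m \<in> carrier G" for x m
    using assms that conj_eq_of_central_quotient[of x "a x" m] by (auto simp: central_endo_def)
qed

lemma sum_bcomult_double:
  assumes fin: "finite (carrier G)" and y: "y \<in> carrier G" "x \<in> carrier G"
  shows "(\<Sum>(b, c)\<in>basis (double G) \<times> basis (double G). bcomult (double G) (y, x) (b, c) * \<phi> b c) =
    (\<Sum>s\<in>carrier G. \<phi> (s, x) (y \<otimes> inv s, x) :: 'k::field)"
proof -
  let ?C = "carrier G"
  have inner: "(\<Sum>c\<in>?C \<times> ?C. bcomult (double G) (y, x) (b, c) * \<phi> b c) =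
      (case b of (s, g) \<Rightarrow> if g = x then \<phi> (s, x) (y \<otimes> inv s, x) else 0)" if b: "b \<in> ?C \<times> ?C" for b
  proof -
    obtain s g where sg: "b = (s, g)" "s \<in> ?C" "g \<in> ?C" using b by blast
    have "(\<Sum>c\<in>?C \<times> ?C. bcomult (double G) (y, x) (b, c) * \<phi> b c) =
        (\<Sum>(t, g')\<in>?C \<times> ?C. if t = y \<otimes> inv s \<and> g' = x then (if g = x then \<phi> (s, g) (t, g') else 0) else 0)"
    proof (rule sum.cong[OF refl])
      fix c assume "c \<in> ?C \<times> ?C"
      then obtain t g' where c: "c = (t, g')" "t \<in> ?C" "g' \<in> ?C" by blast
      have "y = t \<otimes> s \<longleftrightarrow> t = y \<otimes> inv s" using inv_solve_right[of t y s] sg c y by auto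
      then show "bcomult (double G) (y, x) (b, c) * \<phi> b c = (case c of (t, g') \<Rightarrow>
          if t = y \<otimes> inv s \<and> g' = x then (if g = x then \<phi> (s, g) (t, g') else 0) else 0)"
        using sg c y by (auto simp: bcomult_double[OF fin])
    qed
    also have "\<dots> = (if y \<otimes> inv s \<in> ?C \<and> x \<in> ?C then (if g = x then \<phi> (s, g) (y \<otimes> inv s, x) else 0) else 0)"
      by (rule sum_delta_product[OF fin fin])
    finally show ?thesis using y sg by auto
  qed
  have "(\<Sum>(b, c)\<in>basis (double G) \<times> basis (double G). bcomult (double G) (y, x) (b, c) * \<phi> b c) =
     (\<Sum>b\<in>?C \<times> ?C. \<Sum>c\<in>?C \<times> ?C. bcomult (double G) (y, x) (b, c) * \<phi> b c)"
    unfolding basis_double by (rule sum.cartesian_product[symmetric])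
  also have "\<dots> = (\<Sum>(s, g)\<in>?C \<times> ?C. if g = x then \<phi> (s, x) (y \<otimes> inv s, x) else 0)"
    by (rule sum.cong[OF refl inner])
  also have "\<dots> = (\<Sum>s\<in>?C. \<Sum>g\<in>?C. if g = x then \<phi> (s, x) (y \<otimes> inv s, x) else 0)"
    by (rule sum.cartesian_product[symmetric])
  finally show ?thesis using fin y by simp
qed

text \<open>
  Conjugation by \<open>a x\<close> or \<open>a' x\<close> is the same as conjugation by \<open>x\<close>, and \<open>q\<close> and \<open>\<beta>\<close> do not notice
  conjugation at all. After a translation of the summation index by \<open>a' x\<close> (for the product) or
  \<open>a w1\<close> (for the coproduct) each identity at basis vectors therefore reduces to the corresponding
  identity for \<open>q\<close>, while the values of \<open>\<beta>\<close> combine by bimultiplicativity.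
\<close>

proposition Hopf_End_double_matrix:
  assumes fin: "finite (carrier G)" and a: "central_endo G a" and a': "central_endo G a'"
    and \<beta>: "bicharacter G \<beta>" and q: "central_Hopf_matrix G (q :: 'a \<Rightarrow> 'a \<Rightarrow> 'k::field)"
  shows "linear_of (carrier G \<times> carrier G) (double_matrix G a a' \<beta> q) \<in> Hopf_End (double G)"
  unfolding basis_double[of G, where ?'k = 'k, symmetric]
proof (rule Hopf_End_linear_ofI)
  note a = central_endoD[OF a] and a' = central_endoD[OF a'] and \<beta> = bicharacterD[OF \<beta>]
    and q_conj = central_Hopf_matrix_conj[OF q] and q = central_Hopf_matrixD[OF q]
  let ?C = "carrier G" and ?N = "double_matrix G a a' \<beta> q" and ?H = "double G :: ('a \<times> 'a, 'k) bialg"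
  show "finite (basis ?H)" using fin by (simp add: basis_double)
  show "?N v z = 0" if "v \<in> basis ?H" "z \<notin> basis ?H" for v z
    using that by (cases z) (auto simp: basis_double double_matrix_def)
  show "(\<Sum>v\<in>basis ?H. bmult ?H b b' v * ?N v z) = mul ?H (?N b) (?N b') z"
    if b: "b \<in> basis ?H" "b' \<in> basis ?H" for b b' z
  proof -
    obtain y x y' x' w k where [simp]: "b = (y, x)" "b' = (y', x')" "z = (w, k)" by (metis surj_pair)
    have c: "y \<in> ?C" "x \<in> ?C" "y' \<in> ?C" "x' \<in> ?C" using b by (auto simp: basis_double)
    have "(\<Sum>v\<in>basis ?H. bmult ?H b b' v * ?N v z) =
       (\<Sum>(v, g)\<in>?C \<times> ?C. if v = y \<and> g = x \<otimes> x' then if x \<otimes> y' \<otimes> inv x = y then ?N (v, g) (w, k) else 0 else 0)"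
      unfolding basis_double by (intro sum.cong refl) (use c in \<open>auto simp: bmult_double[OF fin]\<close>)
    also have "\<dots> = (if x \<otimes> y' \<otimes> inv x = y then ?N (y, x \<otimes> x') (w, k) else 0)"
      using c by (simp only: sum_delta_product[OF fin fin]) simp
    finally have L: "(\<Sum>v\<in>basis ?H. bmult ?H b b' v * ?N v z) =
      (if x \<otimes> y' \<otimes> inv x = y then ?N (y, x \<otimes> x') (w, k) else 0)" .
    show ?thesis
    proof (cases "w \<in> ?C \<and> k \<in> ?C")
      case True
      then have wk: "w \<in> ?C" "k \<in> ?C" by auto
      define w' where "w' = inv x \<otimes> w \<otimes> x"
      define d where "d = inv (a w) \<otimes> y"
      define d' where "d' = inv (a w') \<otimes> y'"
      define m where "m = inv (a' (x \<otimes> x')) \<otimes> k"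
      have cl: "w' \<in> ?C" "d \<in> ?C" "d' \<in> ?C" "m \<in> ?C" "a w \<in> ?C" "a' x \<in> ?C" "a' x' \<in> ?C"
        using c wk a(1) a'(1) by (auto simp: w'_def d_def d'_def m_def)
      have "mul ?H (?N b) (?N b') z = (\<Sum>h\<in>?C. ?N b (w, h) * ?N b' (inv h \<otimes> w \<otimes> h, inv h \<otimes> k))"
        using wk by (simp add: mul_double[OF fin])
      also have "\<dots> = (\<Sum>h\<in>?C. ?N b (w, a' x \<otimes> h) * ?N b' (inv (a' x \<otimes> h) \<otimes> w \<otimes> (a' x \<otimes> h), inv (a' x \<otimes> h) \<otimes> k))"
        using sum_translate(1)[OF cl(6), of "\<lambda>h. ?N b (w, h) * ?N b' (inv h \<otimes> w \<otimes> h, inv h \<otimes> k)"] by simp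
      also have "\<dots> = (\<Sum>h\<in>?C. \<beta> x w * \<beta> x' w * (q d h * q d' (inv h \<otimes> m)))"
      proof (rule sum.cong[OF refl])
        fix h assume h: "h \<in> ?C"
        have N1: "?N b (w, a' x \<otimes> h) = \<beta> x w * q d h"
          using c cl wk h by (simp add: double_matrix_def d_def inv_mult_cancel)
        show "?N b (w, a' x \<otimes> h) * ?N b' (inv (a' x \<otimes> h) \<otimes> w \<otimes> (a' x \<otimes> h), inv (a' x \<otimes> h) \<otimes> k) =
          \<beta> x w * \<beta> x' w * (q d h * q d' (inv h \<otimes> m))"
        proof (cases "q d h = 0")
          case True then show ?thesis unfolding N1 by simp
        next
          case False
          then have hZ: "h \<in> centre G" using q(2) cl h by blast
          have "inv (a' x \<otimes> h) \<otimes> w \<otimes> (a' x \<otimes> h) = inv h \<otimes> (inv (a' x) \<otimes> w \<otimes> a' x) \<otimes> h"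
            using c cl wk h by (simp add: group_normalize)
          also have "\<dots> = w'" using conj_by_centre(1)[OF hZ cl(1)] a'(6)[of x w] c wk by (simp add: w'_def)
          finally have w': "inv (a' x \<otimes> h) \<otimes> w \<otimes> (a' x \<otimes> h) = w'" .
          have "inv (a' x') \<otimes> (inv (a' x \<otimes> h) \<otimes> k) = (inv (a' x') \<otimes> inv h) \<otimes> (inv (a' x) \<otimes> k)"
            using c cl wk h by (simp add: group_normalize)
          also have "inv (a' x') \<otimes> inv h = inv h \<otimes> inv (a' x')"
            using centreD(2)[OF centre_inv[OF hZ]] cl by simp
          also have "inv h \<otimes> inv (a' x') \<otimes> (inv (a' x) \<otimes> k) = inv h \<otimes> m"
            using c cl wk h by (simp add: m_def a'(2) group_normalize)
          finally have k': "inv (a' x') \<otimes> (inv (a' x \<otimes> h) \<otimes> k) = inv h \<otimes> m" .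
          have "\<beta> x' w' = \<beta> x' w" using \<beta>(7)[of x' w x] c wk by (simp add: w'_def)
          then show ?thesis
            unfolding N1 w' using k' cl c wk h by (simp add: double_matrix_def d'_def)
        qed
      qed
      also have "\<dots> = \<beta> x w * \<beta> x' w * (if d = d' then q d m else 0)"
        using q(3) cl by (simp flip: sum_distrib_left)
      also have "(if d = d' then q d m else 0) = (if x \<otimes> y' \<otimes> inv x = y then q d m else 0)"
      proof (cases "q d m = 0")
        case False
        then have dZ: "d \<in> centre G" using q(1) cl by blast
        have aw': "a w' = inv x \<otimes> a w \<otimes> x"
          using a(6)[of x "a w"] a(2,3) c cl wk a(1)[of x] by (simp add: w'_def)
        have "a w' \<otimes> d = inv x \<otimes> a w \<otimes> (x \<otimes> d)" using c cl by (simp add: aw' m_assoc)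
        also have "x \<otimes> d = d \<otimes> x" using centreD(2)[OF dZ] c by simp
        also have "inv x \<otimes> a w \<otimes> (d \<otimes> x) = inv x \<otimes> y \<otimes> x" using c cl by (simp add: d_def group_normalize)
        finally have "d = d' \<longleftrightarrow> y' = inv x \<otimes> y \<otimes> x"
          using inv_mult_eq_iff[of "a w'" y' d] c cl a(1) by (auto simp: d'_def)
        also have "\<dots> \<longleftrightarrow> x \<otimes> y' \<otimes> inv x = y" using c by (auto simp: group_normalize)
        finally show ?thesis by simp
      qed auto
      also have "\<beta> x w * \<beta> x' w * (if x \<otimes> y' \<otimes> inv x = y then q d m else 0) = (\<Sum>v\<in>basis ?H. bmult ?H b b' v * ?N v z)"
        unfolding L using c wk \<beta>(2) by (simp add: double_matrix_def d_def m_def)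
      finally show ?thesis by simp
    next
      case False
      then show ?thesis unfolding L by (auto simp: mul_double[OF fin] double_matrix_def)
    qed
  qed
  show "(\<Sum>v\<in>basis ?H. bunit ?H v * ?N v z) = bunit ?H z" for z
  proof -
    obtain w k where [simp]: "z = (w, k)" by (metis surj_pair)
    have "(\<Sum>v\<in>basis ?H. bunit ?H v * ?N v z) = (\<Sum>(y, x)\<in>?C \<times> ?C. if x = \<one> then ?N (y, \<one>) z else 0)"
      unfolding basis_double by (intro sum.cong refl) (auto simp: bunit_double[OF fin])
    also have "\<dots> = (\<Sum>y\<in>?C. ?N (y, \<one>) z)"
      using fin by (subst sum.cartesian_product[symmetric]) simp
    also have "\<dots> = bunit ?H z"
    proof (cases "w \<in> ?C \<and> k \<in> ?C")
      case True
      then have "(\<Sum>y\<in>?C. ?N (y, \<one>) z) = (\<Sum>y\<in>?C. q (inv (a w) \<otimes> y) k)"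
        using \<beta>(4) a'(4) by (simp add: double_matrix_def)
      also have "\<dots> = (if k = \<one> then 1 else 0)"
        using sum_translate(1)[of "inv (a w)" "\<lambda>y. q y k"] q(5) a(1) True by simp
      finally show ?thesis using True by (simp add: bunit_double[OF fin])
    next
      case False
      then show ?thesis by (auto simp: double_matrix_def bunit_double[OF fin])
    qed
    finally show ?thesis .
  qed
  show "counit ?H (?N v) = bcounit ?H v" if v: "v \<in> basis ?H" for v
  proof -
    obtain y x where [simp]: "v = (y, x)" by (metis surj_pair)
    have c: "y \<in> ?C" "x \<in> ?C" using v by (auto simp: basis_double)
    have "counit ?H (?N v) = (\<Sum>k\<in>?C. q y (inv (a' x) \<otimes> k))"
      using c by (simp add: counit_double[OF fin] double_matrix_def \<beta>(5) a(4))
    also have "\<dots> = (if y = \<one> then 1 else 0)"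
      using sum_translate(1)[of "inv (a' x)" "q y"] q(6) a'(1) c by simp
    finally show ?thesis by (simp add: bcounit_double[OF fin])
  qed
  show "comul ?H (?N v) z = (\<Sum>(b, c)\<in>basis ?H \<times> basis ?H. bcomult ?H v (b, c) * tens (?N b) (?N c) z)"
    if v: "v \<in> basis ?H" for v z
  proof -
    obtain y x w1 k1 w2 k2 where [simp]: "v = (y, x)" "z = ((w1, k1), (w2, k2))" by (metis surj_pair)
    have c: "y \<in> ?C" "x \<in> ?C" using v by (auto simp: basis_double)
    have R: "(\<Sum>(b, c)\<in>basis ?H \<times> basis ?H. bcomult ?H v (b, c) * tens (?N b) (?N c) z) =
        (\<Sum>s\<in>?C. ?N (s, x) (w1, k1) * ?N (y \<otimes> inv s, x) (w2, k2))"
      using sum_bcomult_double[OF fin c, of "\<lambda>b c. tens (?N b) (?N c) z"] by (simp add: tens_def)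
    show ?thesis
    proof (cases "w1 \<in> ?C \<and> w2 \<in> ?C \<and> k1 \<in> ?C \<and> k2 \<in> ?C")
      case True
      then have wk: "w1 \<in> ?C" "w2 \<in> ?C" "k1 \<in> ?C" "k2 \<in> ?C" by auto
      define d where "d = inv (a (w2 \<otimes> w1)) \<otimes> y"
      define m1 where "m1 = inv (a' x) \<otimes> k1"
      define m2 where "m2 = inv (a' x) \<otimes> k2"
      have cl: "d \<in> ?C" "m1 \<in> ?C" "m2 \<in> ?C" "a w1 \<in> ?C" "a w2 \<in> ?C" "a' x \<in> ?C"
        using c wk a(1) a'(1) by (auto simp: d_def m1_def m2_def)
      have "(\<Sum>s\<in>?C. ?N (s, x) (w1, k1) * ?N (y \<otimes> inv s, x) (w2, k2)) =
          (\<Sum>s\<in>?C. ?N (a w1 \<otimes> s, x) (w1, k1) * ?N (y \<otimes> inv (a w1 \<otimes> s), x) (w2, k2))"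
        using sum_translate(1)[OF cl(4), of "\<lambda>s. ?N (s, x) (w1, k1) * ?N (y \<otimes> inv s, x) (w2, k2)"] by simp
      also have "\<dots> = (\<Sum>s\<in>?C. \<beta> x w1 * \<beta> x w2 * (q s m1 * q (inv s \<otimes> d) m2))"
      proof (rule sum.cong[OF refl])
        fix s assume s: "s \<in> ?C"
        have N1: "?N (a w1 \<otimes> s, x) (w1, k1) = \<beta> x w1 * q s m1"
          using wk cl s by (simp add: double_matrix_def m1_def inv_mult_cancel)
        show "?N (a w1 \<otimes> s, x) (w1, k1) * ?N (y \<otimes> inv (a w1 \<otimes> s), x) (w2, k2) =
            \<beta> x w1 * \<beta> x w2 * (q s m1 * q (inv s \<otimes> d) m2)"
        proof (cases "q s m1 = 0")
          case True then show ?thesis unfolding N1 by simp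
        next
          case False
          then have sZ: "s \<in> centre G" using q(1) cl s by blast
          let ?t = "inv (a w2) \<otimes> (y \<otimes> inv (a w1 \<otimes> s))"
          have "inv (a w1) \<otimes> ?t \<otimes> inv (inv (a w1)) = (inv (a w1) \<otimes> inv (a w2) \<otimes> y) \<otimes> inv s"
            using c cl s by (simp add: group_normalize)
          also have "\<dots> = d \<otimes> inv s" using c cl wk by (simp add: d_def a(2) inv_mult_group)
          also have "\<dots> = inv s \<otimes> d" using centreD(2)[OF centre_inv[OF sZ] cl(1)] by simp
          finally have "q ?t m2 = q (inv s \<otimes> d) m2"
            using q_conj[of ?t m2 "inv (a w1)"] c cl s by simp
          then show ?thesis unfolding N1 using wk by (simp add: double_matrix_def m2_def)
        qed
      qed
      also have "\<dots> = \<beta> x w1 * \<beta> x w2 * (if m1 = m2 then q d m1 else 0)"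
        using q(4) cl by (simp flip: sum_distrib_left)
      also have "m1 = m2 \<longleftrightarrow> k1 = k2"
        using wk cl by (simp add: m1_def m2_def inv_mult_eq_iff inv_mult_cancel)
      also have "\<beta> x w1 * \<beta> x w2 * (if k1 = k2 then q d m1 else 0) = comul ?H (?N v) z"
        using wk c by (simp add: comul_double[OF fin] double_matrix_def d_def m1_def \<beta>(3))
      finally show ?thesis unfolding R by simp
    next
      case False
      then show ?thesis unfolding R by (auto simp: comul_double[OF fin] double_matrix_def)
    qed
  qed
qed

end

section \<open>Reversing one factor of a product\<close>

lemma (in group) normal_endo_centre:
  assumes w: "normal_endo G w" and c: "c \<in> centre G"
  shows "w c \<in> centre G"
proof (rule centreI)
  note d = normal_endoD[OF w] and cc = centreD[OF c]
  show wc: "w c \<in> carrier G" using d(1) cc(1) by simp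
  fix x assume x: "x \<in> carrier G"
  have "x \<otimes> w c \<otimes> inv x = w c" using d(5)[OF cc(1) x] centre_conj(1)[OF c x] by simp
  then have "x \<otimes> w c \<otimes> inv x \<otimes> x = w c \<otimes> x" by simp
  then show "w c \<otimes> x = x \<otimes> w c" using x wc by (simp add: group_normalize)
qed

text \<open>
  The group is the internal direct product of the kernel and the image of \<open>e\<close>.
\<close>

locale split_group = group G for G (structure) +
  fixes e :: "'a \<Rightarrow> 'a"
  assumes e_hom: "e \<in> hom G G"
    and e_idem: "x \<in> carrier G \<Longrightarrow> e (e x) = e x"
    and e_commute: "x \<in> carrier G \<Longrightarrow> y \<in> carrier G \<Longrightarrow> e x \<otimes> (y \<otimes> inv (e y)) = (y \<otimes> inv (e y)) \<otimes> e x"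
begin

definition f :: "'a \<Rightarrow> 'a" where "f x = x \<otimes> inv (e x)"

lemma e_closed [simp]: "x \<in> carrier G \<Longrightarrow> e x \<in> carrier G"
  using e_hom by (auto simp: hom_def)

lemma f_closed [simp]: "x \<in> carrier G \<Longrightarrow> f x \<in> carrier G"
  by (simp add: f_def)

lemma e_mult: "x \<in> carrier G \<Longrightarrow> y \<in> carrier G \<Longrightarrow> e (x \<otimes> y) = e x \<otimes> e y"
  using e_hom by (auto simp: hom_def)

lemma ef_commute: "x \<in> carrier G \<Longrightarrow> y \<in> carrier G \<Longrightarrow> e x \<otimes> f y = f y \<otimes> e x"
  using e_commute by (simp add: f_def)

lemma f_e: "x \<in> carrier G \<Longrightarrow> f x \<otimes> e x = x"
  by (simp add: f_def m_assoc)

lemma e_f: "x \<in> carrier G \<Longrightarrow> e x \<otimes> f x = x"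
  using ef_commute f_e by simp

lemma normal_endo_e: "normal_endo G e"
  unfolding normal_endo_def
proof (intro conjI ballI e_hom)
  fix k x assume c: "k \<in> carrier G" "x \<in> carrier G"
  interpret group_hom G G e by (unfold_locales) (rule e_hom)
  have "k \<otimes> e x \<otimes> inv k = (e k \<otimes> f k) \<otimes> e x \<otimes> inv (e k \<otimes> f k)" using e_f c by simp
  also have "\<dots> = e k \<otimes> (f k \<otimes> e x) \<otimes> inv (f k) \<otimes> inv (e k)" using c by (simp add: group_normalize)
  also have "\<dots> = e k \<otimes> (e x \<otimes> f k) \<otimes> inv (f k) \<otimes> inv (e k)" using ef_commute c by simp
  also have "\<dots> = e (k \<otimes> x \<otimes> inv k)" using c by (simp add: group_normalize)
  finally show "e (k \<otimes> x \<otimes> inv k) = k \<otimes> e x \<otimes> inv k" by simp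
qed

lemmas e_simps = normal_endoD[OF normal_endo_e]

lemma e_of_f: "x \<in> carrier G \<Longrightarrow> e (f x) = \<one>"
  by (simp add: f_def e_simps e_idem)

lemma f_of_e: "x \<in> carrier G \<Longrightarrow> f (e x) = \<one>"
  by (simp add: f_def e_idem)

lemma f_of_f: "x \<in> carrier G \<Longrightarrow> f (f x) = f x"
  using f_e[of "f x"] by (simp add: e_of_f)

lemma f_mult:
  assumes "x \<in> carrier G" "y \<in> carrier G"
  shows "f (x \<otimes> y) = f x \<otimes> f y"
proof -
  have "f (x \<otimes> y) = x \<otimes> (f y \<otimes> inv (e x))" using assms by (simp add: f_def e_mult group_normalize)
  also have "f y \<otimes> inv (e x) = inv (e x) \<otimes> f y"
    using commute_inv[OF _ _ ef_commute[OF assms]] assms by simp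
  finally show ?thesis using assms by (simp add: f_def m_assoc)
qed

lemma split_group_f: "split_group G f"
proof
  show "f \<in> hom G G" using f_mult by (auto simp: hom_def)
  show "f (f x) = f x" if "x \<in> carrier G" for x using f_of_f that .
  have "y \<otimes> inv (f y) = e y" if "y \<in> carrier G" for y
    using e_f[of y] that by (metis e_closed f_closed inv_solve_right)
  then show "f x \<otimes> (y \<otimes> inv (f y)) = y \<otimes> inv (f y) \<otimes> f x" if "x \<in> carrier G" "y \<in> carrier G" for x y
    using ef_commute that by simp
qed

lemma normal_endo_f: "normal_endo G f"
  using split_group.normal_endo_e[OF split_group_f] .

lemmas f_simps = normal_endoD[OF normal_endo_f]

text \<open>
  The twist is trivial for \<open>a\<close> in the kernel of \<open>e\<close>, and for \<open>a\<close> in the image of \<open>e\<close> it amounts to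
  reading products in the opposite order. A map into a commutative monoid that is multiplicative for the
  opposite order on one factor is multiplicative.
\<close>

lemma multiplicative_if_twisted:
  fixes \<chi> :: "'a \<Rightarrow> 'k::comm_monoid_mult"
  assumes twisted: "\<And>a b. a \<in> carrier G \<Longrightarrow> b \<in> carrier G \<Longrightarrow> \<chi> (b \<otimes> a) = \<chi> a * \<chi> (inv (e a) \<otimes> b \<otimes> e a)"
    and c: "a \<in> carrier G" "b \<in> carrier G"
  shows "\<chi> (a \<otimes> b) = \<chi> a * \<chi> b"
proof -
  have f_right: "\<chi> (b \<otimes> f a) = \<chi> (f a) * \<chi> b" if "a \<in> carrier G" "b \<in> carrier G" for a b
    using twisted[of "f a" b] that by (simp add: e_of_f)
  have e_left: "\<chi> (e a \<otimes> b) = \<chi> (e a) * \<chi> b" if "a \<in> carrier G" "b \<in> carrier G" for a b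
    using twisted[of "e a" "e a \<otimes> b \<otimes> inv (e a)"] that by (simp add: e_idem group_normalize)
  have e_right: "\<chi> (b \<otimes> e a) = \<chi> b * \<chi> (e a)" if ab: "a \<in> carrier G" "b \<in> carrier G" for a b
  proof -
    have "b \<otimes> e a = e b \<otimes> (f b \<otimes> e a)" using e_f[of b] ab by (simp flip: m_assoc)
    also have "\<dots> = e (b \<otimes> a) \<otimes> f b" using ef_commute[of a b] ab by (simp add: e_mult m_assoc)
    finally have "\<chi> (b \<otimes> e a) = \<chi> (f b) * (\<chi> (e b) * \<chi> (e a))"
      using f_right[of b "e (b \<otimes> a)"] e_left[of b "e a"] ab by (simp add: e_mult)
    also have "\<dots> = \<chi> (e b \<otimes> f b) * \<chi> (e a)" using e_left[of b "f b"] ab by (simp add: ac_simps)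
    finally show ?thesis using e_f ab by simp
  qed
  have "\<chi> (a \<otimes> b) = \<chi> (a \<otimes> e b \<otimes> f b)" using e_f[of b] c by (simp add: m_assoc)
  also have "\<dots> = \<chi> (f b) * (\<chi> a * \<chi> (e b))" using f_right[of b "a \<otimes> e b"] e_right[of b a] c by simp
  also have "\<dots> = \<chi> a * \<chi> (e b \<otimes> f b)" using e_left[of b "f b"] c by (simp add: ac_simps)
  finally show ?thesis using e_f c by simp
qed

definition theta_of :: "'a \<Rightarrow> 'a" where "theta_of x = f x \<otimes> inv (e x)"

lemma theta_closed [simp]: "x \<in> carrier G \<Longrightarrow> theta_of x \<in> carrier G"
  by (simp add: theta_of_def)

lemma e_theta: "x \<in> carrier G \<Longrightarrow> e (theta_of x) = inv (e x)"
  by (simp add: theta_of_def e_simps e_of_f e_idem)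

lemma f_theta: "x \<in> carrier G \<Longrightarrow> f (theta_of x) = f x"
  by (simp add: theta_of_def f_simps f_of_f f_of_e)

lemma theta_theta: "x \<in> carrier G \<Longrightarrow> theta_of (theta_of x) = x"
  using f_e by (simp add: theta_of_def[of "theta_of x"] e_theta f_theta)

lemma theta_centre: "c \<in> centre G \<Longrightarrow> theta_of c \<in> centre G"
  unfolding theta_of_def
  by (intro centre_mult centre_inv normal_endo_centre[OF normal_endo_e] normal_endo_centre[OF normal_endo_f])

lemma bij_theta: "bij_betw theta_of (carrier G) (carrier G)"
  by (rule bij_betw_byWitness[where f' = theta_of]) (auto simp: theta_theta)

end

text \<open>
  \<open>K\<close> arises from \<open>G\<close> by reversing the multiplication of the image of \<open>e\<close>: this is the product
  \<open>f x \<otimes> y \<otimes> e x\<close>, because the image of \<open>f\<close> commutes with that of \<open>e\<close>.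
\<close>

locale half_opposite = split_group G e for G (structure) and e +
  fixes K :: "('a, 'n) monoid_scheme"
  assumes group_K: "group K"
    and carrier_K: "carrier K = carrier G"
    and mult_K: "x \<in> carrier G \<Longrightarrow> y \<in> carrier G \<Longrightarrow> x \<otimes>\<^bsub>K\<^esub> y = f x \<otimes> y \<otimes> e x"
begin

sublocale K: group K by (rule group_K)

lemma one_K: "\<one>\<^bsub>K\<^esub> = \<one>"
proof -
  have "\<one> \<otimes>\<^bsub>K\<^esub> \<one> = \<one>" by (simp add: mult_K e_simps f_simps)
  then show ?thesis using K.r_cancel_one[of \<one> \<one>] by (simp add: carrier_K)
qed

lemma inv_K:
  assumes "x \<in> carrier G"
  shows "inv\<^bsub>K\<^esub> x = inv x"
proof (rule K.inv_equality)
  have "inv x \<otimes>\<^bsub>K\<^esub> x = inv (f x) \<otimes> (e x \<otimes> f x) \<otimes> inv (e x)"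
    using assms e_f by (simp add: mult_K e_simps f_simps)
  also have "\<dots> = inv (f x) \<otimes> (f x \<otimes> e x) \<otimes> inv (e x)" using ef_commute assms by simp
  also have "\<dots> = \<one>" using assms by (simp add: group_normalize)
  finally show "inv x \<otimes>\<^bsub>K\<^esub> x = \<one>\<^bsub>K\<^esub>" by (simp add: one_K)
qed (use assms in \<open>simp_all add: carrier_K\<close>)

lemma mult_K_centre:
  assumes c: "c \<in> centre G" and x: "x \<in> carrier G"
  shows "c \<otimes>\<^bsub>K\<^esub> x = c \<otimes> x" "x \<otimes>\<^bsub>K\<^esub> c = c \<otimes> x"
proof -
  have cc: "c \<in> carrier G" using centreD(1)[OF c] .
  have ec: "e c \<in> centre G" using normal_endo_centre[OF normal_endo_e c] .
  have "c \<otimes>\<^bsub>K\<^esub> x = f c \<otimes> (e c \<otimes> x)" using cc x centreD(2)[OF ec x] by (simp add: mult_K m_assoc)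
  then show "c \<otimes>\<^bsub>K\<^esub> x = c \<otimes> x" using f_e[OF cc] cc x by (simp flip: m_assoc)
  have "x \<otimes>\<^bsub>K\<^esub> c = c \<otimes> (f x \<otimes> e x)"
    using cc x centreD(2)[OF c, of "f x"] by (simp add: mult_K m_assoc flip: m_assoc)
  then show "x \<otimes>\<^bsub>K\<^esub> c = c \<otimes> x" using f_e x by simp
qed

lemma centre_K: "c \<in> centre G \<Longrightarrow> c \<in> centre K"
  using mult_K_centre centreD(1) unfolding centre_def[of K] by (auto simp: carrier_K)

text \<open>
  Quotients in \<open>G\<close> and in \<open>K\<close> differ by a conjugation only. A function supported on the centre cannot
  distinguish them, so that \<open>q\<close> can be used for both groups.
\<close>

lemma quotient_K:
  assumes "x \<in> carrier G" "y \<in> carrier G"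
  shows "inv\<^bsub>K\<^esub> x \<otimes>\<^bsub>K\<^esub> y = e x \<otimes> (inv x \<otimes> y) \<otimes> inv (e x)"
proof -
  have "e x \<otimes> inv x = inv (x \<otimes> inv (e x))" using assms by (simp add: inv_mult_group)
  also have "\<dots> = inv (f x)" by (simp add: f_def)
  finally have "e x \<otimes> inv x = inv (f x)" .
  then have "e x \<otimes> (inv x \<otimes> y) \<otimes> inv (e x) = inv (f x) \<otimes> y \<otimes> inv (e x)"
    using assms by (simp flip: m_assoc)
  then show ?thesis using assms by (simp add: inv_K mult_K e_simps f_simps)
qed

lemma quotient_K_centre:
  assumes "x \<in> carrier G" "y \<in> carrier G" "inv x \<otimes> y \<in> centre G"
  shows "inv\<^bsub>K\<^esub> x \<otimes>\<^bsub>K\<^esub> y \<in> centre K"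
  using quotient_K[OF assms(1,2)] centre_conj(1)[OF assms(3), of "e x"] centre_K[OF assms(3)] assms by simp

lemma theta_hom: "x \<in> carrier G \<Longrightarrow> y \<in> carrier G \<Longrightarrow> theta_of (x \<otimes> y) = theta_of x \<otimes>\<^bsub>K\<^esub> theta_of y"
  by (simp add: mult_K f_theta e_theta) (simp add: theta_of_def e_mult f_mult group_normalize)

lemma theta_hom': "x \<in> carrier G \<Longrightarrow> y \<in> carrier G \<Longrightarrow> theta_of (x \<otimes>\<^bsub>K\<^esub> y) = theta_of x \<otimes> theta_of y"
  using theta_hom[of "theta_of x" "theta_of y"] by (metis m_closed theta_closed theta_theta)

lemma theta_inv: "x \<in> carrier G \<Longrightarrow> theta_of (inv x) = inv (theta_of x)"
proof -
  assume x: "x \<in> carrier G"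
  have "theta_of (inv x) \<otimes> theta_of x = theta_of (inv\<^bsub>K\<^esub> x \<otimes>\<^bsub>K\<^esub> x)"
    using theta_hom'[of "inv x" x] x by (simp add: inv_K)
  also have "\<dots> = \<one>" using x K.l_inv[of x] by (simp add: carrier_K one_K theta_of_def e_simps f_simps)
  finally show ?thesis using x by (simp add: inv_equality)
qed

lemma central_Hopf_matrix_K:
  assumes q: "central_Hopf_matrix G (q :: 'a \<Rightarrow> 'a \<Rightarrow> 'k::field)"
  shows "central_Hopf_matrix K (\<lambda>c d. q c (theta_of d))"
proof -
  note qD = central_Hopf_matrixD[OF q] and q_conj = central_Hopf_matrix_conj[OF q]
  have reindex: "(\<Sum>h\<in>carrier G. \<phi> (theta_of h)) = sum \<phi> (carrier G)" for \<phi> :: "'a \<Rightarrow> 'k"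
    by (rule sum.reindex_bij_betw[OF bij_theta])
  have eq: "theta_of x = theta_of y \<longleftrightarrow> x = y" if "x \<in> carrier G" "y \<in> carrier G" for x y
    using that theta_theta by metis
  have one: "theta_of x = \<one> \<longleftrightarrow> x = \<one>" if "x \<in> carrier G" for x
    using that eq[of x \<one>] by (simp add: theta_of_def e_simps f_simps)
  have "c \<in> centre K \<and> d \<in> centre K" if c: "c \<in> carrier G" "d \<in> carrier G" "q c (theta_of d) \<noteq> 0" for c d
  proof -
    have "theta_of d \<in> centre G" using qD(2)[of c "theta_of d"] c by simp
    then have "d \<in> centre G" using theta_centre[of "theta_of d"] theta_theta c by simp
    then show ?thesis using centre_K qD(1)[of c "theta_of d"] c by simp
  qed
  moreover have "(\<Sum>h\<in>carrier G. q c (theta_of h) * q c' (theta_of (inv\<^bsub>K\<^esub> h \<otimes>\<^bsub>K\<^esub> d))) = (if c = c' then q c (theta_of d) else 0)"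
    if c: "c \<in> carrier G" "c' \<in> carrier G" "d \<in> carrier G" for c c' d
  proof -
    have "(\<Sum>h\<in>carrier G. q c (theta_of h) * q c' (theta_of (inv\<^bsub>K\<^esub> h \<otimes>\<^bsub>K\<^esub> d))) =
        (\<Sum>h\<in>carrier G. q c (theta_of h) * q c' (inv (theta_of h) \<otimes> theta_of d))"
      using c by (intro sum.cong refl) (simp add: theta_hom' inv_K theta_inv)
    also have "\<dots> = (\<Sum>h\<in>carrier G. q c h * q c' (inv h \<otimes> theta_of d))"
      by (rule reindex[of "\<lambda>h. q c h * q c' (inv h \<otimes> theta_of d)"])
    finally show ?thesis using qD(3) c by simp
  qed
  moreover have "(\<Sum>g\<in>carrier G. q g (theta_of d) * q (inv\<^bsub>K\<^esub> g \<otimes>\<^bsub>K\<^esub> c) (theta_of d')) = (if d = d' then q c (theta_of d) else 0)"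
    if c: "c \<in> carrier G" "d \<in> carrier G" "d' \<in> carrier G" for c d d'
    using qD(4)[of c "theta_of d" "theta_of d'"] c
    by (simp add: quotient_K q_conj eq)
  moreover have "(\<Sum>d\<in>carrier G. q c (theta_of d)) = (if c = \<one> then 1 else 0)" if c: "c \<in> carrier G" for c
    using qD(6)[of c] reindex[of "q c"] c by simp
  ultimately show ?thesis
    unfolding central_Hopf_matrix_def carrier_K one_K using qD(5) by (simp add: one)
qed

lemma bicharacter_K:
  assumes b: "bicharacter G \<beta>"
  shows "bicharacter K (\<lambda>x w. \<beta> x (theta_of w))"
proof -
  note bD = bicharacterD[OF b]
  have "\<beta> (x \<otimes>\<^bsub>K\<^esub> x') y = \<beta> x y * \<beta> x' y" if c: "x \<in> carrier G" "x' \<in> carrier G" "y \<in> carrier G" for x x' y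
  proof -
    have "\<beta> (x \<otimes>\<^bsub>K\<^esub> x') y = \<beta> (f x \<otimes> e x) y * \<beta> x' y"
      using c by (simp only: mult_K bD(2) f_closed e_closed m_closed mult_ac)
    then show ?thesis using f_e c by simp
  qed
  then show ?thesis
    unfolding bicharacter_def carrier_K using bD(1,3) by (simp add: theta_hom')
qed

end

section \<open>The monodromy of a decomposed R-matrix\<close>

text \<open>
  This is what the dichotomy provides for a decomposed group: modulo the centre, \<open>U\<close> and \<open>V\<close> are the
  projections to two complementary factors.
\<close>

locale split_rmatrix = rmatrix G R + split_group G e for G (structure) and R :: "'a \<Rightarrow> 'a \<Rightarrow> 'a \<Rightarrow> 'a \<Rightarrow> 'k::field" and e +
  assumes U_central: "x \<in> carrier G \<Longrightarrow> inv (f x) \<otimes> U x \<in> centre G"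
    and V_central: "x \<in> carrier G \<Longrightarrow> inv (e x) \<otimes> V x \<in> centre G"
begin

lemma conj_U:
  assumes "x \<in> carrier G" "m \<in> carrier G"
  shows "U x \<otimes> m \<otimes> inv (U x) = f x \<otimes> m \<otimes> inv (f x)" "inv (U x) \<otimes> m \<otimes> U x = inv (f x) \<otimes> m \<otimes> f x"
  using conj_eq_of_central_quotient[OF _ _ U_central[OF assms(1)] assms(2)] assms U_simps(1) by auto

lemma conj_V:
  assumes "x \<in> carrier G" "m \<in> carrier G"
  shows "V x \<otimes> m \<otimes> inv (V x) = e x \<otimes> m \<otimes> inv (e x)" "inv (V x) \<otimes> m \<otimes> V x = inv (e x) \<otimes> m \<otimes> e x"
  using conj_eq_of_central_quotient[OF _ _ V_central[OF assms(1)] assms(2)] assms V_simps(1) by auto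

lemma UV_commute:
  assumes "x \<in> carrier G" "y \<in> carrier G"
  shows "U x \<otimes> V y = V y \<otimes> U x"
proof -
  define z where "z = inv (f x) \<otimes> U x"
  have z: "z \<in> centre G" "z \<in> carrier G" "U x = f x \<otimes> z"
    using U_central[OF assms(1)] U_simps(1)[OF assms(1)] assms by (auto simp: z_def inv_mult_cancel)
  have Vy: "V y \<in> carrier G" using V_simps assms by simp
  have "V y \<otimes> U x \<otimes> inv (V y) = e y \<otimes> U x \<otimes> inv (e y)"
    using conj_V[OF assms(2), of "U x"] U_simps(1)[OF assms(1)] by simp
  also have "\<dots> = (e y \<otimes> f x) \<otimes> (z \<otimes> inv (e y))" using assms z by (simp add: m_assoc)
  also have "\<dots> = f x \<otimes> (e y \<otimes> z \<otimes> inv (e y))" using assms z ef_commute by (simp add: m_assoc)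
  also have "\<dots> = U x" using centre_conj(1)[OF z(1)] assms z by simp
  finally have "V y \<otimes> U x \<otimes> inv (V y) \<otimes> V y = U x \<otimes> V y" by simp
  then show ?thesis using Vy U_simps(1)[OF assms(1)] by (simp add: m_assoc)
qed

text \<open>
  Invariance under conjugation moves the twist in \<open>r_twisted_left\<close> to the first argument, where \<open>V a\<close> may
  be replaced by \<open>e a\<close>.
\<close>

lemma r_bimult_left:
  assumes "x \<in> carrier G" "x' \<in> carrier G" "y \<in> carrier G"
  shows "r (x \<otimes> x') y = r x y * r x' y"
proof (rule multiplicative_if_twisted[of "\<lambda>x. r x y"])
  fix a b assume c: "a \<in> carrier G" "b \<in> carrier G"
  have Va: "V a \<in> carrier G" using V_simps c by simp
  have "r b (V a \<otimes> y \<otimes> inv (V a)) = r (inv (V a) \<otimes> b \<otimes> V a) y"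
    using r_conj[of "V a" "inv (V a) \<otimes> b \<otimes> V a" y] Va c assms by (simp add: group_normalize)
  then show "r (b \<otimes> a) y = r a y * r (inv (e a) \<otimes> b \<otimes> e a) y"
    using r_twisted_left[of a b y] conj_V(2)[of a b] c assms by simp
qed (use assms in auto)

lemma r_bimult_right:
  assumes "x \<in> carrier G" "y \<in> carrier G" "y' \<in> carrier G"
  shows "r x (y \<otimes> y') = r x y * r x y'"
proof -
  interpret f: split_group G f by (rule split_group_f)
  have "r x (inv (inv y' \<otimes> inv y)) = r x (inv (inv y')) * r x (inv (inv y))"
  proof (rule f.multiplicative_if_twisted[of "\<lambda>y. r x (inv y)"])
    fix a b assume c: "a \<in> carrier G" "b \<in> carrier G"
    have Ua: "U a \<in> carrier G" using U_simps c by simp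
    have "r x (inv (b \<otimes> a)) = r x (inv a) * r (U a \<otimes> x \<otimes> inv (U a)) (inv b)"
      using r_twisted_right[of "inv a" "inv b" x] c assms U_simps by (simp add: inv_mult_group)
    also have "r (U a \<otimes> x \<otimes> inv (U a)) (inv b) = r x (inv (U a) \<otimes> inv b \<otimes> U a)"
      using r_conj[of "U a" x "inv (U a) \<otimes> inv b \<otimes> U a"] Ua c assms by (simp add: group_normalize)
    also have "inv (U a) \<otimes> inv b \<otimes> U a = inv (inv (f a) \<otimes> b \<otimes> f a)"
      using conj_U(2)[of a "inv b"] c by (simp add: group_normalize)
    finally show "r x (inv (b \<otimes> a)) = r x (inv a) * r x (inv (inv (f a) \<otimes> b \<otimes> f a))" .
  qed (use assms in auto)
  then show ?thesis using assms by (simp add: inv_mult_group mult.commute)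
qed

text \<open>
  \<open>b\<close>, \<open>A\<close> and \<open>q\<close> describe the entries of \<open>\<Psi>\<^sub>R\<close>: the entry \<open>r\<^sup>* + r\<close> has the values \<open>b\<close>, the entry
  \<open>p\<^sup>* + p\<close> has the matrix \<open>q\<close>, and \<open>A\<close> is \<open>u\<^sup>* + v\<close> on group elements.
\<close>

definition b :: "'a \<Rightarrow> 'a \<Rightarrow> 'k" where "b x y = r y x * r x y"

definition A :: "'a \<Rightarrow> 'a" where "A x = U x \<otimes> inv (V x)"

definition q :: "'a \<Rightarrow> 'a \<Rightarrow> 'k" where "q = convolve G (\<lambda>c d. p d c) p"

lemma bicharacter_r: "bicharacter G r"
  unfolding bicharacter_def by (intro conjI ballI r_nonzero r_bimult_left r_bimult_right)

lemma bicharacter_b: "bicharacter G b"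
  unfolding bicharacter_def b_def
  by (intro conjI ballI) (simp_all add: r_nonzero r_bimult_left r_bimult_right)

lemma central_Hopf_matrix_q: "central_Hopf_matrix G q"
  unfolding q_def
  by (intro central_Hopf_matrix_convolve fin central_Hopf_matrix_p central_Hopf_matrix_transpose)

lemma A_closed [simp]: "x \<in> carrier G \<Longrightarrow> A x \<in> carrier G"
  using U_simps V_simps by (simp add: A_def)

lemma A_conj:
  assumes "x \<in> carrier G" "k \<in> carrier G"
  shows "A (k \<otimes> x \<otimes> inv k) = k \<otimes> A x \<otimes> inv k"
  using assms U_simps(1)[OF assms(1)] V_simps(1)[OF assms(1)] U_simps(5)[OF assms] V_simps(5)[OF assms]
  by (simp add: A_def group_normalize)

text \<open>
  Modulo the centre \<open>U x\<close> is \<open>f x\<close> and \<open>V(x)\<^sup>-\<^sup>1\<close> is \<open>e(x)\<^sup>-\<^sup>1\<close>, so \<open>A x\<close> is their product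
  \<open>theta_of x\<close>.
\<close>

lemma A_split:
  assumes x: "x \<in> carrier G"
  obtains z z' where "z \<in> centre G" "z' \<in> centre G" "U x = f x \<otimes> z" "inv (V x) = inv (e x) \<otimes> z'"
    "A x = theta_of x \<otimes> (z \<otimes> z')"
proof -
  have UV: "U x \<in> carrier G" "V x \<in> carrier G" using U_simps V_simps x by auto
  define z z' where "z = inv (f x) \<otimes> U x" and "z' = inv (inv (e x) \<otimes> V x)"
  have z: "z \<in> centre G" "z' \<in> centre G"
    using U_central[OF x] centre_inv[OF V_central[OF x]] by (simp_all only: z_def z'_def)
  note zc = centreD(1)[OF z(1)] centreD(1)[OF z(2)]
  have 1: "U x = f x \<otimes> z" using x UV by (simp add: z_def inv_mult_cancel)
  have "inv (V x) = z' \<otimes> inv (e x)" using x UV by (simp add: z'_def group_normalize)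
  also have "\<dots> = inv (e x) \<otimes> z'" using centreD(2)[OF z(2)] x by simp
  finally have 2: "inv (V x) = inv (e x) \<otimes> z'" .
  have "A x = f x \<otimes> (z \<otimes> inv (e x)) \<otimes> z'" using x zc by (simp add: A_def 1 2 m_assoc)
  also have "\<dots> = theta_of x \<otimes> (z \<otimes> z')"
    using x zc centreD(2)[OF z(1), of "inv (e x)"] by (simp add: theta_of_def m_assoc)
  finally show ?thesis using that z 1 2 by blast
qed

lemma A_central: "x \<in> carrier G \<Longrightarrow> inv (theta_of x) \<otimes> A x \<in> centre G"
proof -
  assume x: "x \<in> carrier G"
  from A_split[OF x] obtain z z' where z: "z \<in> centre G" "z' \<in> centre G" and A: "A x = theta_of x \<otimes> (z \<otimes> z')" by metis
  then show ?thesis using centre_mult[OF z] centreD(1)[OF centre_mult[OF z]] x by (simp add: inv_mult_cancel)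
qed

text \<open>
  The substitution \<open>h' = U x \<otimes> t\<close>, \<open>g' = V(y)\<^sup>-\<^sup>1 \<otimes> s\<close> turns the first factor into \<open>r y x * p t s\<close>, so only
  central \<open>s\<close> and \<open>t\<close> contribute. They can be moved to the front in the second factor, and the double sum
  becomes a convolution, that is, a value of \<open>q\<close>. Its second argument is still conjugated by \<open>V y\<close>; but
  where \<open>q\<close> does not vanish, its first argument determines \<open>y\<close> well enough to replace \<open>V y\<close> by
  \<open>e(g)\<^sup>-\<^sup>1\<close>.
\<close>

lemma monodromy_coefficient:
  assumes c: "x \<in> carrier G" "g \<in> carrier G" "y \<in> carrier G" "h \<in> carrier G"
  shows "(\<Sum>g'\<in>carrier G. \<Sum>h'\<in>carrier G.
      R y h' x g' * R (inv g' \<otimes> x \<otimes> g') (inv g' \<otimes> g) (inv h' \<otimes> y \<otimes> h') (inv h' \<otimes> h)) =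
    double_matrix G A A b q (f x \<otimes> g \<otimes> inv (f x), inv (e g) \<otimes> x \<otimes> e g) (y, h)"
proof -
  let ?C = "carrier G" and ?W = "U x" and ?E = "V y"
  define x1 where "x1 = ?E \<otimes> x \<otimes> inv ?E"
  define y1 where "y1 = inv ?W \<otimes> y \<otimes> ?W"
  define \<kappa> where "\<kappa> = inv ?W \<otimes> inv (A y) \<otimes> ?W \<otimes> g"
  define \<mu> where "\<mu> = ?E \<otimes> inv (A x) \<otimes> inv ?E \<otimes> h"
  have cl: "?W \<in> ?C" "?E \<in> ?C" "U y \<in> ?C" "V x \<in> ?C" using c U_simps V_simps by auto
  have cl': "x1 \<in> ?C" "y1 \<in> ?C" "\<kappa> \<in> ?C" "\<mu> \<in> ?C" using c cl by (auto simp: x1_def y1_def \<kappa>_def \<mu>_def)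
  have Uy1: "U y1 = inv ?W \<otimes> U y \<otimes> ?W" using U_simps(5)[of y "inv ?W"] c cl by (simp add: y1_def)
  have Vx1: "V x1 = ?E \<otimes> V x \<otimes> inv ?E" using V_simps(5)[of x ?E] c cl by (simp add: x1_def)
  have r1: "r x1 y1 = r x y"
    using bicharacterD(6)[OF bicharacter_r, of x y1 "inv ?E"] bicharacterD(7)[OF bicharacter_r, of x y ?W] c cl cl'
    by (simp add: x1_def y1_def)
  have summand: "R y (?W \<otimes> t) x (inv ?E \<otimes> s) *
      R (inv (inv ?E \<otimes> s) \<otimes> x \<otimes> (inv ?E \<otimes> s)) (inv (inv ?E \<otimes> s) \<otimes> g) (inv (?W \<otimes> t) \<otimes> y \<otimes> (?W \<otimes> t)) (inv (?W \<otimes> t) \<otimes> h) =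
      b x y * (p t s * p (inv s \<otimes> \<kappa>) (inv t \<otimes> \<mu>))" if s: "s \<in> ?C" "t \<in> ?C" for s t
  proof -
    have R1: "R y (?W \<otimes> t) x (inv ?E \<otimes> s) = r y x * p t s"
      using R_eq[of y "?W \<otimes> t" x "inv ?E \<otimes> s"] c cl s by (simp add: inv_mult_cancel)
    show ?thesis
    proof (cases "p t s = 0")
      case True then show ?thesis by (simp add: R1)
    next
      case False
      then have Z: "t \<in> centre G" "s \<in> centre G" using p_central_left p_central_right s by blast+
      have "inv (inv ?E \<otimes> s) \<otimes> x \<otimes> (inv ?E \<otimes> s) = inv s \<otimes> x1 \<otimes> s"
        using c cl s by (simp add: x1_def group_normalize)
      then have e1: "inv (inv ?E \<otimes> s) \<otimes> x \<otimes> (inv ?E \<otimes> s) = x1" using conj_by_centre(1)[OF Z(2) cl'(1)] by simp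
      have "inv (?W \<otimes> t) \<otimes> y \<otimes> (?W \<otimes> t) = inv t \<otimes> y1 \<otimes> t"
        using c cl s by (simp add: y1_def group_normalize)
      then have e2: "inv (?W \<otimes> t) \<otimes> y \<otimes> (?W \<otimes> t) = y1" using conj_by_centre(1)[OF Z(1) cl'(2)] by simp
      have "inv (U y1) \<otimes> (inv (inv ?E \<otimes> s) \<otimes> g) = (inv ?W \<otimes> inv (U y) \<otimes> ?W) \<otimes> inv s \<otimes> (?E \<otimes> g)"
        using c cl s by (simp add: Uy1 group_normalize)
      also have "(inv ?W \<otimes> inv (U y) \<otimes> ?W) \<otimes> inv s = inv s \<otimes> (inv ?W \<otimes> inv (U y) \<otimes> ?W)"
        using centreD(2)[OF centre_inv[OF Z(2)], of "inv ?W \<otimes> inv (U y) \<otimes> ?W"] cl by simp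
      also have "inv s \<otimes> (inv ?W \<otimes> inv (U y) \<otimes> ?W) \<otimes> (?E \<otimes> g) = inv s \<otimes> (inv ?W \<otimes> inv (U y) \<otimes> (?W \<otimes> ?E) \<otimes> g)"
        using c cl s by (simp add: m_assoc)
      also have "\<dots> = inv s \<otimes> (inv ?W \<otimes> inv (U y) \<otimes> (?E \<otimes> ?W) \<otimes> g)" using UV_commute[of x y] c by simp
      also have "\<dots> = inv s \<otimes> (inv ?W \<otimes> (inv (U y) \<otimes> ?E) \<otimes> ?W \<otimes> g)" using c cl s by (simp add: m_assoc)
      also have "inv (U y) \<otimes> ?E = ?E \<otimes> inv (U y)"
        using commute_inv[OF cl(3,2) UV_commute[of y y]] c by simp
      also have "?E \<otimes> inv (U y) = inv (A y)" using c cl by (simp add: A_def inv_mult_group)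
      finally have e3: "inv (U y1) \<otimes> (inv (inv ?E \<otimes> s) \<otimes> g) = inv s \<otimes> \<kappa>" by (simp add: \<kappa>_def)
      have "V x1 \<otimes> (inv (?W \<otimes> t) \<otimes> h) = (?E \<otimes> V x \<otimes> inv ?E) \<otimes> inv t \<otimes> (inv ?W \<otimes> h)"
        using c cl s by (simp add: Vx1 group_normalize)
      also have "(?E \<otimes> V x \<otimes> inv ?E) \<otimes> inv t = inv t \<otimes> (?E \<otimes> V x \<otimes> inv ?E)"
        using centreD(2)[OF centre_inv[OF Z(1)], of "?E \<otimes> V x \<otimes> inv ?E"] cl by simp
      also have "inv t \<otimes> (?E \<otimes> V x \<otimes> inv ?E) \<otimes> (inv ?W \<otimes> h) = inv t \<otimes> (?E \<otimes> V x \<otimes> inv (?W \<otimes> ?E) \<otimes> h)"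
        using c cl s by (simp add: group_normalize)
      also have "\<dots> = inv t \<otimes> (?E \<otimes> V x \<otimes> inv (?E \<otimes> ?W) \<otimes> h)" using UV_commute[of x y] c by simp
      also have "\<dots> = inv t \<otimes> \<mu>" using c cl s by (simp add: \<mu>_def A_def group_normalize)
      finally have e4: "V x1 \<otimes> (inv (?W \<otimes> t) \<otimes> h) = inv t \<otimes> \<mu>" .
      have "R x1 (inv (inv ?E \<otimes> s) \<otimes> g) y1 (inv (?W \<otimes> t) \<otimes> h) = r x y * p (inv s \<otimes> \<kappa>) (inv t \<otimes> \<mu>)"
        using R_eq[of x1 "inv (inv ?E \<otimes> s) \<otimes> g" y1 "inv (?W \<otimes> t) \<otimes> h"] c cl cl' s by (simp only: e3 e4 r1 m_closed inv_closed)
      then show ?thesis by (simp add: e1 e2 R1 b_def)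
    qed
  qed
  have "(\<Sum>g'\<in>?C. \<Sum>h'\<in>?C. R y h' x g' * R (inv g' \<otimes> x \<otimes> g') (inv g' \<otimes> g) (inv h' \<otimes> y \<otimes> h') (inv h' \<otimes> h)) =
     (\<Sum>s\<in>?C. \<Sum>t\<in>?C. R y (?W \<otimes> t) x (inv ?E \<otimes> s) *
      R (inv (inv ?E \<otimes> s) \<otimes> x \<otimes> (inv ?E \<otimes> s)) (inv (inv ?E \<otimes> s) \<otimes> g) (inv (?W \<otimes> t) \<otimes> y \<otimes> (?W \<otimes> t)) (inv (?W \<otimes> t) \<otimes> h))"
    (is "(\<Sum>g'\<in>?C. \<Sum>h'\<in>?C. ?F g' h') = (\<Sum>s\<in>?C. \<Sum>t\<in>?C. ?F (inv ?E \<otimes> s) (?W \<otimes> t))")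
  proof -
    have "(\<Sum>g'\<in>?C. \<Sum>h'\<in>?C. ?F g' h') = (\<Sum>g'\<in>?C. \<Sum>t\<in>?C. ?F g' (?W \<otimes> t))"
      by (rule sum.cong[OF refl], rule sum_translate(1)[OF cl(1), symmetric])
    also have "\<dots> = (\<Sum>s\<in>?C. \<Sum>t\<in>?C. ?F (inv ?E \<otimes> s) (?W \<otimes> t))"
      using sum_translate(1)[of "inv ?E" "\<lambda>g'. \<Sum>t\<in>?C. ?F g' (?W \<otimes> t)"] cl by simp
    finally show ?thesis .
  qed
  also have "\<dots> = (\<Sum>s\<in>?C. \<Sum>t\<in>?C. b x y * (p t s * p (inv s \<otimes> \<kappa>) (inv t \<otimes> \<mu>)))"
    by (intro sum.cong refl summand)
  also have "\<dots> = b x y * q \<kappa> \<mu>" by (simp add: q_def convolve_def sum_distrib_left)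
  finally have sum: "(\<Sum>g'\<in>?C. \<Sum>h'\<in>?C. ?F g' h') = b x y * q \<kappa> \<mu>" .
  define y' where "y' = f x \<otimes> g \<otimes> inv (f x)"
  define x' where "x' = inv (e g) \<otimes> x \<otimes> e g"
  have c': "x' \<in> ?C" "y' \<in> ?C" using c by (auto simp: x'_def y'_def)
  have "?W \<otimes> \<kappa> \<otimes> inv ?W = inv (A y) \<otimes> (?W \<otimes> g \<otimes> inv ?W)"
    using c cl by (simp add: \<kappa>_def group_normalize)
  then have "?W \<otimes> \<kappa> \<otimes> inv ?W = inv (A y) \<otimes> y'" using conj_U(1)[of x g] c by (simp add: y'_def)
  then have q1: "q \<kappa> \<mu> = q (inv (A y) \<otimes> y') \<mu>"
    using central_Hopf_matrix_conj[OF central_Hopf_matrix_q, of \<kappa> \<mu> ?W] cl cl' by simp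
  have "q (inv (A y) \<otimes> y') \<mu> = q (inv (A y) \<otimes> y') (inv (A x') \<otimes> h)"
  proof (cases "inv (A y) \<otimes> y' \<in> centre G")
    case True
    define z where "z = inv (A y) \<otimes> y'"
    have z: "z \<in> centre G" "z \<in> ?C" "y' = A y \<otimes> z" using True c c' by (auto simp: z_def inv_mult_cancel)
    \<comment> \<open>The first entry of \<open>q\<close> determines \<open>e g\<close> up to the centre.\<close>
    obtain z1 z2 where z12: "z1 \<in> centre G" "z2 \<in> centre G" and Ay: "A y = theta_of y \<otimes> (z1 \<otimes> z2)"
      using A_split[OF c(3)] by metis
    define z3 where "z3 = e (z1 \<otimes> z2 \<otimes> z)"
    have z3: "z3 \<in> centre G"
      unfolding z3_def by (intro normal_endo_centre[OF normal_endo_e] centre_mult centre_inv z12 z)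
    note zc = centreD(1)[OF z12(1)] centreD(1)[OF z12(2)] centreD(1)[OF z3]
    have "y' = theta_of y \<otimes> (z1 \<otimes> z2 \<otimes> z)" using Ay z zc c by (simp add: m_assoc)
    then have "e y' = inv (e y) \<otimes> z3" using c zc z by (simp add: e_mult e_theta z3_def)
    moreover have "e y' = e g" using c by (simp add: y'_def e_simps e_of_f)
    ultimately have eg: "inv (inv (e y)) \<otimes> e g = z3" using c zc by (simp add: inv_mult_cancel)
    have conj: "inv (e g) \<otimes> m \<otimes> e g = ?E \<otimes> m \<otimes> inv ?E" if m: "m \<in> ?C" for m
      using conj_eq_of_central_quotient(2)[of "inv (e y)" "e g" m] eg z3 conj_V(1)[of y m] m c by simp
    have "?E \<otimes> inv (A x) \<otimes> inv ?E = inv (?E \<otimes> A x \<otimes> inv ?E)" using c cl by (simp add: group_normalize)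
    also have "?E \<otimes> A x \<otimes> inv ?E = A x'" using A_conj[of x ?E] conj[of x] c cl by (simp add: x'_def)
    finally show ?thesis by (simp add: \<mu>_def)
  next
    case False
    then have "q (inv (A y) \<otimes> y') m = 0" if "m \<in> ?C" for m
      using central_Hopf_matrixD(1)[OF central_Hopf_matrix_q, of "inv (A y) \<otimes> y'" m] c c' that by auto
    then show ?thesis using c c' cl' by simp
  qed
  moreover have "b x' y = b x y"
    using bicharacterD(6)[OF bicharacter_b, of x y "e g"] c by (simp add: x'_def)
  ultimately show ?thesis
    using sum q1 c by (simp add: double_matrix_def flip: x'_def y'_def)
qed

end

locale half_opposite_rmatrix = split_rmatrix G R e + half_opposite G e K
  for G (structure) and R :: "'a \<Rightarrow> 'a \<Rightarrow> 'a \<Rightarrow> 'a \<Rightarrow> 'k::field" and e and K :: "('a, 'n) monoid_scheme"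
begin

text \<open>
  Although \<open>v\<close> reverses products, \<open>A\<close> becomes multiplicative if the image of \<open>e\<close>, which is the only part
  of the group where \<open>v\<close> is not central, is reversed on one side. It may be reversed in the target, as
  here, or in the source.
\<close>

lemma A_hom:
  assumes "x \<in> carrier G" "y \<in> carrier G"
  shows "A (x \<otimes> y) = A x \<otimes>\<^bsub>K\<^esub> A y"
proof -
  obtain z z' where z: "z \<in> centre G" "z' \<in> centre G" and Ux: "U x = f x \<otimes> z" and Vx: "inv (V x) = inv (e x) \<otimes> z'"
    and Ax: "A x = theta_of x \<otimes> (z \<otimes> z')" using A_split[OF assms(1)] by metis
  note zc = centreD(1)[OF z(1)] centreD(1)[OF z(2)]
  have fz: "f (z \<otimes> z') \<in> carrier G" "e (z \<otimes> z') \<in> centre G" "e (z \<otimes> z') \<in> carrier G"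
    using zc centreD(1) normal_endo_centre[OF normal_endo_e centre_mult[OF z]] by auto
  have cl: "U y \<in> carrier G" "V y \<in> carrier G" "U x \<in> carrier G" "V x \<in> carrier G"
    using assms U_simps V_simps by auto
  let ?z = "z \<otimes> z'"
  have zZ: "?z \<in> centre G" using centre_mult[OF z] .
  have "A x \<otimes>\<^bsub>K\<^esub> A y = f (A x) \<otimes> A y \<otimes> e (A x)" using assms by (simp add: mult_K)
  also have "f (A x) = f x \<otimes> f ?z" using assms zc by (simp add: Ax f_mult f_theta)
  also have "e (A x) = inv (e x) \<otimes> e ?z" using assms zc by (simp add: Ax e_mult e_theta)
  also have "f x \<otimes> f ?z \<otimes> A y \<otimes> (inv (e x) \<otimes> e ?z) = f x \<otimes> f ?z \<otimes> ((A y \<otimes> inv (e x)) \<otimes> e ?z)"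
    using assms fz by (simp add: m_assoc zc)
  also have "(A y \<otimes> inv (e x)) \<otimes> e ?z = e ?z \<otimes> (A y \<otimes> inv (e x))"
    using centreD(2)[OF fz(2), of "A y \<otimes> inv (e x)"] assms by simp
  also have "f x \<otimes> f ?z \<otimes> (e ?z \<otimes> (A y \<otimes> inv (e x))) = f x \<otimes> (f ?z \<otimes> e ?z) \<otimes> (A y \<otimes> inv (e x))"
    using assms fz by (simp add: m_assoc)
  also have "f ?z \<otimes> e ?z = z \<otimes> z'" using f_e zc by simp
  also have "f x \<otimes> (z \<otimes> z') \<otimes> (A y \<otimes> inv (e x)) = U x \<otimes> (z' \<otimes> (A y \<otimes> inv (e x)))"
    using assms zc by (simp add: Ux m_assoc)
  also have "z' \<otimes> (A y \<otimes> inv (e x)) = A y \<otimes> inv (V x)"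
    using centreD(2)[OF z(2), of "A y \<otimes> inv (e x)"] assms zc by (simp add: Vx m_assoc)
  also have "U x \<otimes> (A y \<otimes> inv (V x)) = A (x \<otimes> y)"
    using assms cl U_simps V_simps by (simp add: A_def group_normalize)
  finally show ?thesis by simp
qed

lemma A_hom':
  assumes "x \<in> carrier G" "y \<in> carrier G"
  shows "A (x \<otimes>\<^bsub>K\<^esub> y) = A x \<otimes> A y"
proof -
  have cl: "U x \<in> carrier G" "V x \<in> carrier G" "U y \<in> carrier G" "V y \<in> carrier G"
    "U (e x) \<in> carrier G" "U (f x) \<in> carrier G" "V (e x) \<in> carrier G" "V (f x) \<in> carrier G"
    using assms U_simps V_simps by auto
  have Z: "U (e x) \<in> centre G" "V (f x) \<in> centre G"
    using U_central[of "e x"] V_central[of "f x"] assms cl by (simp_all add: f_of_e e_of_f)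
  have "U (x \<otimes>\<^bsub>K\<^esub> y) = U (f x) \<otimes> (U y \<otimes> U (e x))" using assms cl U_simps by (simp add: mult_K m_assoc)
  also have "\<dots> = U (f x \<otimes> e x) \<otimes> U y"
    using centreD(2)[OF Z(1) cl(3)] assms cl U_simps by (simp add: m_assoc)
  finally have 1: "U (x \<otimes>\<^bsub>K\<^esub> y) = U x \<otimes> U y" using f_e assms by simp
  have "V (x \<otimes>\<^bsub>K\<^esub> y) = V (f x) \<otimes> (V y \<otimes> V (e x))" using assms cl V_simps by (simp add: mult_K m_assoc)
  also have "\<dots> = V y \<otimes> V (e x) \<otimes> V (f x)"
    using centreD(2)[OF Z(2), of "V y \<otimes> V (e x)"] cl by simp
  also have "\<dots> = V y \<otimes> V (e x \<otimes> f x)" using assms cl V_simps by (simp add: m_assoc)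
  finally have 2: "V (x \<otimes>\<^bsub>K\<^esub> y) = V y \<otimes> V x" using e_f assms by simp
  have "inv (V x) \<otimes> U y = U y \<otimes> inv (V x)"
    using commute_inv[OF cl(2,3)] UV_commute[of y x] assms by simp
  then have "A x \<otimes> A y = U x \<otimes> (U y \<otimes> inv (V x)) \<otimes> inv (V y)"
    using cl by (simp add: A_def m_assoc flip: m_assoc[of "inv (V x)" "U y"])
  then show ?thesis using cl by (simp add: A_def 1 2 group_normalize)
qed

lemma central_endo_A_theta: "central_endo K (A \<circ> theta_of)"
  unfolding central_endo_def
proof (intro conjI ballI)
  show "A \<circ> theta_of \<in> hom K K"
    by (auto simp: hom_def carrier_K theta_hom' A_hom)
  fix x assume "x \<in> carrier K"
  then have x: "x \<in> carrier G" by (simp add: carrier_K)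
  then have "inv x \<otimes> A (theta_of x) \<in> centre G" using A_central[of "theta_of x"] by (simp add: theta_theta)
  then show "inv\<^bsub>K\<^esub> x \<otimes>\<^bsub>K\<^esub> (A \<circ> theta_of) x \<in> centre K" using quotient_K_centre x by simp
qed

lemma central_endo_theta_A: "central_endo K (theta_of \<circ> A)"
  unfolding central_endo_def
proof (intro conjI ballI)
  have "A x \<otimes>\<^bsub>K\<^esub> A y \<in> carrier G" if "x \<in> carrier G" "y \<in> carrier G" for x y using that by (simp add: mult_K)
  then show "theta_of \<circ> A \<in> hom K K"
    by (auto simp: hom_def carrier_K theta_hom A_hom')
  fix x assume "x \<in> carrier K"
  then have x: "x \<in> carrier G" by (simp add: carrier_K)
  obtain z z' where z: "z \<in> centre G" "z' \<in> centre G" and Ax: "A x = theta_of x \<otimes> (z \<otimes> z')"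
    using A_split[OF x] by metis
  define z3 where "z3 = theta_of (z \<otimes> z')"
  have z3: "z3 \<in> centre G" "z3 \<in> carrier G"
    using theta_centre[OF centre_mult[OF z]] centreD(1) by (auto simp: z3_def)
  have "theta_of (A x) = x \<otimes>\<^bsub>K\<^esub> z3"
    using x centreD(1)[OF z(1)] centreD(1)[OF z(2)] by (simp add: Ax theta_hom theta_theta z3_def)
  also have "\<dots> = x \<otimes> z3" using mult_K_centre(2)[OF z3(1) x] centreD(2)[OF z3(1) x] by simp
  finally have "inv x \<otimes> theta_of (A x) \<in> centre G" using x z3 by (simp add: inv_mult_cancel)
  then show "inv\<^bsub>K\<^esub> x \<otimes>\<^bsub>K\<^esub> (theta_of \<circ> A) x \<in> centre K" using quotient_K_centre x by simp
qed

text \<open>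
  The matrix of \<open>\<Psi>\<^sub>R\<close> followed by the identification \<open>\<Theta>\<close>, written with the multiplication of \<open>K\<close>.
\<close>

lemma Hopf_End_transported:
  "linear_of (carrier K \<times> carrier K)
     (double_matrix K (A \<circ> theta_of) (theta_of \<circ> A) (\<lambda>x w. b x (theta_of w)) (\<lambda>c d. q c (theta_of d)))
   \<in> Hopf_End (double K)"
  using fin
  by (intro K.Hopf_End_double_matrix central_endo_A_theta central_endo_theta_A bicharacter_K[OF bicharacter_b]
      central_Hopf_matrix_K[OF central_Hopf_matrix_q]) (simp add: carrier_K)

lemma double_matrix_transported:
  assumes "y \<in> carrier G" "x \<in> carrier G" "w \<in> carrier G" "k \<in> carrier G"
  shows "double_matrix K (A \<circ> theta_of) (theta_of \<circ> A) (\<lambda>x w. b x (theta_of w)) (\<lambda>c d. q c (theta_of d)) (y, x) (w, k) =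
    double_matrix G A A b q (y, x) (theta_of w, theta_of k)"
proof -
  have "theta_of (inv\<^bsub>K\<^esub> (theta_of (A x)) \<otimes>\<^bsub>K\<^esub> k) = inv (A x) \<otimes> theta_of k"
    using assms by (simp add: inv_K theta_hom' theta_inv theta_theta)
  then show ?thesis
    using assms central_Hopf_matrix_conj[OF central_Hopf_matrix_q]
    by (simp add: double_matrix_def carrier_K quotient_K)
qed

end

section \<open>From quasitriangular structures to coefficients\<close>

abbreviation coeff :: "(('a \<times> 'a) \<times> ('a \<times> 'a) \<Rightarrow> 'k) \<Rightarrow> 'a \<Rightarrow> 'a \<Rightarrow> 'a \<Rightarrow> 'a \<Rightarrow> 'k" where
  "coeff R \<equiv> (\<lambda>x g y h. R ((x, g), (y, h)))"

lemma \<delta>_apply: "\<delta> x y = (if y = x then 1 else 0)"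
  by (simp add: \<delta>_def)

lemma \<delta>_eq_iff: "\<delta> x = (\<delta> y :: 'b \<Rightarrow> 'k::field) \<longleftrightarrow> x = y"
  by (metis \<delta>_apply zero_neq_one)

lemma on_group_eq: "L (\<delta> g) = \<delta> h \<Longrightarrow> on_group L g = h"
  unfolding on_group_def by (simp add: \<delta>_eq_iff)

lemma mul_tensor:
  "mul (tensor A B) S T (z1, z2) =
    (\<Sum>x1\<in>basis A. \<Sum>y1\<in>basis A. mul B (\<lambda>v. S (x1, v)) (\<lambda>v. T (y1, v)) z2 * bmult A x1 y1 z1)"
proof -
  have "mul (tensor A B) S T (z1, z2) = (\<Sum>x1\<in>basis A. \<Sum>x2\<in>basis B. \<Sum>y1\<in>basis A. \<Sum>y2\<in>basis B.
      S (x1, x2) * T (y1, y2) * (bmult A x1 y1 z1 * bmult B x2 y2 z2))"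
    unfolding mul_def tensor_def tens_def by (simp add: sum.cartesian_product')
  also have "\<dots> = (\<Sum>x1\<in>basis A. \<Sum>y1\<in>basis A. \<Sum>x2\<in>basis B. \<Sum>y2\<in>basis B.
      S (x1, x2) * T (y1, y2) * (bmult A x1 y1 z1 * bmult B x2 y2 z2))"
    by (rule sum.cong[OF refl], rule sum.swap)
  also have "\<dots> = (\<Sum>x1\<in>basis A. \<Sum>y1\<in>basis A. mul B (\<lambda>v. S (x1, v)) (\<lambda>v. T (y1, v)) z2 * bmult A x1 y1 z1)"
    unfolding mul_def sum_distrib_right by (simp only: mult_ac)
  finally show ?thesis .
qed

context group
begin

context
  assumes fin: "finite (carrier G)"
begin

lemma mul_tensor_double:
  "mul (tensor (double G) B) S T ((w, k), z) = (if w \<in> carrier G \<and> k \<in> carrier G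
    then \<Sum>h\<in>carrier G. mul B (\<lambda>v. S ((w, h), v)) (\<lambda>v. T ((inv h \<otimes> w \<otimes> h, inv h \<otimes> k), v)) z
    else (0::'k::field))"
  unfolding mul_tensor by (rule sum_bmult_double[OF fin])

lemma mul_double_double:
  assumes "x \<in> carrier G" "g \<in> carrier G" "y \<in> carrier G" "h \<in> carrier G"
  shows "mul (tensor (double G) (double G)) S T ((x, g), (y, h)) =
    (\<Sum>g'\<in>carrier G. \<Sum>h'\<in>carrier G. S ((x, g'), (y, h')) *
      T ((inv g' \<otimes> x \<otimes> g', inv g' \<otimes> g), (inv h' \<otimes> y \<otimes> h', inv h' \<otimes> h)) :: 'k::field)"
  using assms by (simp add: mul_tensor_double mul_double[OF fin])

lemma mul_double_double_double:
  assumes "x \<in> carrier G" "g \<in> carrier G" "y \<in> carrier G" "h \<in> carrier G" "z \<in> carrier G" "k \<in> carrier G"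
  shows "mul (tensor (double G) (tensor (double G) (double G))) S T ((x, g), (y, h), (z, k)) =
    (\<Sum>g'\<in>carrier G. \<Sum>h'\<in>carrier G. \<Sum>k'\<in>carrier G. S ((x, g'), (y, h'), (z, k')) *
      T ((inv g' \<otimes> x \<otimes> g', inv g' \<otimes> g), (inv h' \<otimes> y \<otimes> h', inv h' \<otimes> h), (inv k' \<otimes> z \<otimes> k', inv k' \<otimes> k)) :: 'k::field)"
  using assms by (simp add: mul_tensor_double mul_double[OF fin])

text \<open>
  All axioms are evaluated at basis vectors. For the intertwining axiom the element \<open>e\<^sub>x\<^sub>y \<bowtie> k\<close> is used:
  \<open>k = \<one>\<close> gives the support condition, and then arbitrary \<open>k\<close> gives invariance under conjugation.
\<close>

lemma rmatrix_of_quasitriangular: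
  fixes R :: "('a \<times> 'a) \<times> ('a \<times> 'a) \<Rightarrow> 'k::field"
  assumes qt: "quasitriangular (double G) R"
  shows "rmatrix G (coeff R)"
proof -
  let ?C = "carrier G" and ?H = "double G :: ('a \<times> 'a, 'k) bialg"
  note qt' = qt[unfolded quasitriangular_def]
  note comul_left = qt'[THEN conjunct2, THEN conjunct1]
    and comul_right = qt'[THEN conjunct2, THEN conjunct2, THEN conjunct1]
    and counit_left = qt'[THEN conjunct2, THEN conjunct2, THEN conjunct2, THEN conjunct1]
    and counit_right = qt'[THEN conjunct2, THEN conjunct2, THEN conjunct2, THEN conjunct2, THEN conjunct1]
    and intertwines = qt'[THEN conjunct2, THEN conjunct2, THEN conjunct2, THEN conjunct2, THEN conjunct2]
  have inv_one: "inv a \<otimes> c = \<one> \<longleftrightarrow> a = c" if "a \<in> ?C" "c \<in> ?C" for a c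
    using inv_mult_eq_iff[of a c \<one>] that by auto
  have delta: "(\<Sum>x\<in>?C. if x = a then \<phi> x else 0) = \<phi> a" if "a \<in> ?C" for a and \<phi> :: "'a \<Rightarrow> 'k"
    using fin that by simp
  have key: "(if (inv h \<otimes> y \<otimes> h) \<otimes> (inv g \<otimes> x \<otimes> g) = x \<otimes> y then R ((x, g), (y, h)) else 0) =
      R ((inv k \<otimes> x \<otimes> k, inv k \<otimes> g \<otimes> k), (inv k \<otimes> y \<otimes> k, inv k \<otimes> h \<otimes> k))"
    if c: "k \<in> ?C" "x \<in> ?C" "g \<in> ?C" "y \<in> ?C" "h \<in> ?C" for k x g y h
  proof -
    let ?d = "\<delta> (x \<otimes> y, k) :: 'a \<times> 'a \<Rightarrow> 'k" and ?z = "((x, g \<otimes> k), (y, h \<otimes> k))"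
    have "?d \<in> vecs (basis ?H)" using c by (auto simp: vecs_def \<delta>_apply basis_double)
    from fun_cong[OF bspec[OF intertwines this], of ?z]
    have eq: "mul (tensor ?H ?H) R (comul ?H ?d) ?z = mul (tensor ?H ?H) (flip (comul ?H ?d)) R ?z" .
    have "mul (tensor ?H ?H) R (comul ?H ?d) ?z = (\<Sum>g'\<in>?C. \<Sum>h'\<in>?C. R ((x, g'), (y, h')) *
        comul ?H ?d ((inv g' \<otimes> x \<otimes> g', inv g' \<otimes> (g \<otimes> k)), (inv h' \<otimes> y \<otimes> h', inv h' \<otimes> (h \<otimes> k))))"
      using c by (simp add: mul_double_double)
    also have "\<dots> = (\<Sum>g'\<in>?C. \<Sum>h'\<in>?C. if h' = h then if g' = g then
        if (inv h \<otimes> y \<otimes> h) \<otimes> (inv g \<otimes> x \<otimes> g) = x \<otimes> y then R ((x, g), (y, h)) else 0 else 0 else 0)"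
    proof (intro sum.cong refl)
      fix g' h' assume c': "g' \<in> ?C" "h' \<in> ?C"
      have 1: "inv a' \<otimes> (a \<otimes> k) = k \<longleftrightarrow> a' = a" if "a \<in> ?C" "a' \<in> ?C" for a a'
        using inv_mult_eq_iff[of a' "a \<otimes> k" k] that c by auto
      show "R ((x, g'), (y, h')) * comul ?H ?d ((inv g' \<otimes> x \<otimes> g', inv g' \<otimes> (g \<otimes> k)), (inv h' \<otimes> y \<otimes> h', inv h' \<otimes> (h \<otimes> k))) =
          (if h' = h then if g' = g then
            if (inv h \<otimes> y \<otimes> h) \<otimes> (inv g \<otimes> x \<otimes> g) = x \<otimes> y then R ((x, g), (y, h)) else 0 else 0 else 0)"
      proof (cases "g' = g \<and> h' = h")
        case True
        then show ?thesis using c by (simp add: comul_double[OF fin] \<delta>_apply inv_mult_cancel)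
      next
        case False
        then have "inv g' \<otimes> (g \<otimes> k) \<noteq> k \<or> inv h' \<otimes> (h \<otimes> k) \<noteq> k"
          using 1[OF c(3) c'(1)] 1[OF c(5) c'(2)] by blast
        then have "comul ?H ?d ((inv g' \<otimes> x \<otimes> g', inv g' \<otimes> (g \<otimes> k)), (inv h' \<otimes> y \<otimes> h', inv h' \<otimes> (h \<otimes> k))) = 0"
          unfolding comul_double[OF fin] by (auto simp: \<delta>_apply)
        then show ?thesis using False by (simp only: mult_zero_right) auto
      qed
    qed
    also have "\<dots> = (if (inv h \<otimes> y \<otimes> h) \<otimes> (inv g \<otimes> x \<otimes> g) = x \<otimes> y then R ((x, g), (y, h)) else 0)"
      using c by (simp add: delta)
    finally have L: "mul (tensor ?H ?H) R (comul ?H ?d) ?z = \<dots>" .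
    have "mul (tensor ?H ?H) (flip (comul ?H ?d)) R ?z = (\<Sum>g'\<in>?C. \<Sum>h'\<in>?C. comul ?H ?d ((y, h'), (x, g')) *
        R ((inv g' \<otimes> x \<otimes> g', inv g' \<otimes> (g \<otimes> k)), (inv h' \<otimes> y \<otimes> h', inv h' \<otimes> (h \<otimes> k))))"
      using c by (simp add: mul_double_double flip_def)
    also have "\<dots> = (\<Sum>g'\<in>?C. \<Sum>h'\<in>?C. if h' = k then if g' = k then
        R ((inv k \<otimes> x \<otimes> k, inv k \<otimes> g \<otimes> k), (inv k \<otimes> y \<otimes> k, inv k \<otimes> h \<otimes> k)) else 0 else 0)"
      using c by (intro sum.cong refl) (auto simp: comul_double[OF fin] \<delta>_apply m_assoc)
    also have "\<dots> = R ((inv k \<otimes> x \<otimes> k, inv k \<otimes> g \<otimes> k), (inv k \<otimes> y \<otimes> k, inv k \<otimes> h \<otimes> k))"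
      using c by (simp add: delta)
    finally show ?thesis using L eq by simp
  qed
  have supp: "R ((x, g), (y, h)) = (if (inv h \<otimes> y \<otimes> h) \<otimes> (inv g \<otimes> x \<otimes> g) = x \<otimes> y then R ((x, g), (y, h)) else 0)"
    if "x \<in> ?C" "g \<in> ?C" "y \<in> ?C" "h \<in> ?C" for x g y h
    using key[of \<one> x g y h] that by simp
  show ?thesis
  proof
    show "finite ?C" by (rule fin)
    show "R ((k \<otimes> x \<otimes> inv k, k \<otimes> g \<otimes> inv k), (k \<otimes> y \<otimes> inv k, k \<otimes> h \<otimes> inv k)) = R ((x, g), (y, h))"
      if "k \<in> ?C" "x \<in> ?C" "g \<in> ?C" "y \<in> ?C" "h \<in> ?C" for k x g y h
      using key[of "inv k" x g y h] supp[of x g y h] that by simp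
    show "(inv h \<otimes> y \<otimes> h) \<otimes> (inv g \<otimes> x \<otimes> g) = x \<otimes> y"
      if "x \<in> ?C" "g \<in> ?C" "y \<in> ?C" "h \<in> ?C" "R ((x, g), (y, h)) \<noteq> 0" for x g y h
      using supp[of x g y h] that by (auto split: if_splits)
  next
    fix a b g g' y k
    assume c: "a \<in> ?C" "b \<in> ?C" "g \<in> ?C" "g' \<in> ?C" "y \<in> ?C" "k \<in> ?C"
    have "(\<lambda>(x, y, z). comul ?H (\<lambda>w. R (w, z)) (x, y)) ((a, g), (b, g'), (y, k)) =
        mul (tensor ?H (tensor ?H ?H)) (leg13 ?H R) (leg23 ?H R) ((a, g), (b, g'), (y, k))"
      by (rule fun_cong[OF comul_left])
    then have "(if g = g' then R ((b \<otimes> a, g), (y, k)) else 0) =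
       (\<Sum>g1\<in>?C. \<Sum>g2\<in>?C. \<Sum>h\<in>?C. leg13 ?H R ((a, g1), (b, g2), (y, h)) *
        leg23 ?H R ((inv g1 \<otimes> a \<otimes> g1, inv g1 \<otimes> g), (inv g2 \<otimes> b \<otimes> g2, inv g2 \<otimes> g'), (inv h \<otimes> y \<otimes> h, inv h \<otimes> k)))"
      using c by (simp add: mul_double_double_double comul_double[OF fin])
    also have "\<dots> = (\<Sum>g1\<in>?C. \<Sum>g2\<in>?C. if g2 = \<one> then if g1 = g then
        \<Sum>h\<in>?C. R ((a, g1), (y, h)) * R ((inv g2 \<otimes> b \<otimes> g2, inv g2 \<otimes> g'), (inv h \<otimes> y \<otimes> h, inv h \<otimes> k)) else 0 else 0)"
      using c by (intro sum.cong refl) (auto simp: leg13_def leg23_def bunit_double[OF fin] inv_one)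
    also have "\<dots> = (\<Sum>h\<in>?C. R ((a, g), (y, h)) * R ((b, g'), (inv h \<otimes> y \<otimes> h, inv h \<otimes> k)))"
      using c by (simp add: delta)
    finally show "(\<Sum>h\<in>?C. R ((a, g), (y, h)) * R ((b, g'), (inv h \<otimes> y \<otimes> h, inv h \<otimes> k))) =
        (if g = g' then R ((b \<otimes> a, g), (y, k)) else 0)" by simp
  next
    fix x k c b h h'
    assume c: "x \<in> ?C" "k \<in> ?C" "c \<in> ?C" "b \<in> ?C" "h \<in> ?C" "h' \<in> ?C"
    have "(\<lambda>(x, y, z). comul ?H (\<lambda>w. R (x, w)) (y, z)) ((x, k), (b, h'), (c, h)) =
        mul (tensor ?H (tensor ?H ?H)) (leg13 ?H R) (leg12 ?H R) ((x, k), (b, h'), (c, h))"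
      by (rule fun_cong[OF comul_right])
    then have "(if h = h' then R ((x, k), (c \<otimes> b, h)) else 0) =
       (\<Sum>g\<in>?C. \<Sum>h1\<in>?C. \<Sum>h2\<in>?C. leg13 ?H R ((x, g), (b, h1), (c, h2)) *
        leg12 ?H R ((inv g \<otimes> x \<otimes> g, inv g \<otimes> k), (inv h1 \<otimes> b \<otimes> h1, inv h1 \<otimes> h'), (inv h2 \<otimes> c \<otimes> h2, inv h2 \<otimes> h)))"
      using c by (simp add: mul_double_double_double comul_double[OF fin] eq_commute[of h'] cong: if_cong)
    also have "\<dots> = (\<Sum>g\<in>?C. \<Sum>h1\<in>?C. \<Sum>h2\<in>?C. if h2 = h then if h1 = \<one> then
        R ((x, g), (c, h2)) * R ((inv g \<otimes> x \<otimes> g, inv g \<otimes> k), (inv h1 \<otimes> b \<otimes> h1, inv h1 \<otimes> h')) else 0 else 0)"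
      using c by (intro sum.cong refl) (auto simp: leg13_def leg12_def bunit_double[OF fin] inv_one)
    also have "\<dots> = (\<Sum>g\<in>?C. R ((x, g), (c, h)) * R ((inv g \<otimes> x \<otimes> g, inv g \<otimes> k), (b, h')))"
      using c by (simp add: delta)
    finally show "(\<Sum>g\<in>?C. R ((x, g), (c, h)) * R ((inv g \<otimes> x \<otimes> g, inv g \<otimes> k), (b, h'))) =
        (if h = h' then R ((x, k), (c \<otimes> b, h)) else 0)" by simp
  next
    fix y h assume c: "y \<in> ?C" "h \<in> ?C"
    have "counit ?H (\<lambda>v. R (v, (y, h))) = bunit ?H (y, h)"
      by (rule fun_cong[OF counit_left])
    then show "(\<Sum>g\<in>?C. R ((\<one>, g), (y, h))) = (if h = \<one> then 1 else 0)"
      using c by (simp add: counit_double[OF fin] bunit_double[OF fin])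
  next
    fix x g assume c: "x \<in> ?C" "g \<in> ?C"
    have "counit ?H (\<lambda>v. R ((x, g), v)) = bunit ?H (x, g)"
      by (rule fun_cong[OF counit_right])
    then show "(\<Sum>h\<in>?C. R ((x, g), (\<one>, h))) = (if g = \<one> then 1 else 0)"
      using c by (simp add: counit_double[OF fin] bunit_double[OF fin])
  qed
qed

lemma F_map_sharp:
  fixes R :: "('a \<times> 'a) \<times> ('a \<times> 'a) \<Rightarrow> 'k::field"
  shows "g \<in> carrier G \<Longrightarrow> F_map (double G) R (sharp (\<delta> g) (\<delta> \<one>)) v = R ((\<one>, g), v)"
    and "x \<in> carrier G \<Longrightarrow> F_map (double G) R (sharp (bunit (fun_co G)) (\<delta> x)) v = (\<Sum>g\<in>carrier G. R ((x, g), v))"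
proof -
  assume g: "g \<in> carrier G"
  have "F_map (double G) R (sharp (\<delta> g) (\<delta> \<one>)) v =
      (\<Sum>(s, h)\<in>carrier G \<times> carrier G. if s = \<one> \<and> h = g then R ((s, h), v) else 0)"
    unfolding F_map_def basis_double by (intro sum.cong refl) (auto simp: sharp_def \<delta>_apply)
  then show "F_map (double G) R (sharp (\<delta> g) (\<delta> \<one>)) v = R ((\<one>, g), v)"
    using g by (simp add: sum_delta_product[OF fin fin])
next
  assume x: "x \<in> carrier G"
  have "F_map (double G) R (sharp (bunit (fun_co G)) (\<delta> x)) v =
      (\<Sum>(s, h)\<in>carrier G \<times> carrier G. if s = x then R ((x, h), v) else 0)"
    unfolding F_map_def basis_double by (intro sum.cong refl) (auto simp: sharp_def \<delta>_apply fun_co_def)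
  also have "\<dots> = (\<Sum>h\<in>carrier G. \<Sum>s\<in>carrier G. if s = x then R ((x, h), v) else 0)"
    by (subst sum.cartesian_product[symmetric], rule sum.swap)
  finally show "F_map (double G) R (sharp (bunit (fun_co G)) (\<delta> x)) v = (\<Sum>g\<in>carrier G. R ((x, g), v))"
    using fin x by simp
qed

lemma id_counit_eq: "id_counit G a x = (\<Sum>g\<in>carrier G. a (x, g) :: 'k::field)"
  by (simp add: id_counit_def counit_def grp_alg_def)

lemma transp_\<delta>:
  assumes "s \<in> carrier G" "y \<in> carrier G"
  shows "group_transp G L (\<delta> s) y = (L (\<delta> y) s :: 'k::field)"
proof -
  have "group_transp G L (\<delta> s) y = (\<Sum>z\<in>carrier G. if z = s then L (\<delta> y) z else 0)"
    using assms unfolding transp_def by (auto simp: \<delta>_apply intro: sum.cong)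
  then show ?thesis using assms fin by simp
qed

end

end

context rmatrix
begin

context
  fixes RR :: "('a \<times> 'a) \<times> ('a \<times> 'a) \<Rightarrow> 'k"
  assumes RR: "\<And>x g y h. RR ((x, g), (y, h)) = R x g y h"
begin

lemma u_of_\<delta>: "g \<in> carrier G \<Longrightarrow> u_of G RR (\<delta> g) y = u_coeff g y"
  by (simp add: u_of_def id_counit_eq[OF fin] F_map_sharp[OF fin] u_coeff_def RR)

lemma r_of_\<delta>: "x \<in> carrier G \<Longrightarrow> r_of G RR (\<delta> x) y = r x y"
  by (simp add: r_of_def id_counit_eq[OF fin] F_map_sharp[OF fin] r_def RR)

lemma p_of_\<delta>: "g \<in> carrier G \<Longrightarrow> p_of G RR (\<delta> g) h = p g h"
  by (simp add: p_of_def ev_id_def F_map_sharp[OF fin] p_def RR)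

lemma v_of_\<delta>: "x \<in> carrier G \<Longrightarrow> h \<in> carrier G \<Longrightarrow> v_of G RR (\<delta> x) h = (if h = inv (V x) then 1 else 0)"
  using sum_R_one_right[of x h] by (simp add: v_of_def ev_id_def F_map_sharp[OF fin] RR)

lemma u_star_eq:
  assumes y: "y \<in> carrier G"
  shows "u_star G RR y = U y"
proof -
  have "group_transp G (u_of G RR) (\<delta> y) = \<delta> (U y)"
  proof
    fix x show "group_transp G (u_of G RR) (\<delta> y) x = \<delta> (U y) x"
    proof (cases "x \<in> carrier G")
      case True
      then show ?thesis using y by (simp add: transp_\<delta>[OF fin] u_of_\<delta> u_coeff_eq \<delta>_apply)
    next
      case False
      then show ?thesis using U_closed[OF y] by (auto simp: transp_def \<delta>_apply)
    qed
  qed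
  then show ?thesis unfolding u_star_def by (rule on_group_eq)
qed

lemma Sv_eq:
  assumes "RR \<in> vecs (basis (double G) \<times> basis (double G))" and x: "x \<in> carrier G"
  shows "Sv G RR x = V x"
proof -
  have V: "V x \<in> carrier G" using V_simps x by simp
  have "v_of G RR (\<delta> x) = \<delta> (inv (V x))"
  proof
    fix h show "v_of G RR (\<delta> x) h = \<delta> (inv (V x)) h"
    proof (cases "h \<in> carrier G")
      case True
      then show ?thesis using x by (simp add: v_of_\<delta> \<delta>_apply)
    next
      case False
      then have "RR ((x, g), (\<one>, h)) = 0" for g using assms(1) by (auto simp: vecs_def basis_double)
      then show ?thesis using False V x by (auto simp: v_of_def ev_id_def F_map_sharp[OF fin] \<delta>_apply)
    qed
  qed
  then have "on_group (v_of G RR) x = inv (V x)" by (rule on_group_eq)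
  then show ?thesis using V by (simp add: Sv_def)
qed

end

end

context split_rmatrix
begin

context
  fixes RR :: "('a \<times> 'a) \<times> ('a \<times> 'a) \<Rightarrow> 'k"
  assumes RR: "\<And>x g y h. RR ((x, g), (y, h)) = R x g y h"
begin

lemma Psi_entries:
  assumes c: "s \<in> carrier G" "z \<in> carrier G"
  shows "conv (fun_co G) (fun_co G) (group_transp G (v_of G RR)) (u_of G RR) (\<delta> s) z = (if s = A z then 1 else 0)"
    and "conv (grp_alg G) (fun_co G) (group_transp G (r_of G RR)) (r_of G RR) (\<delta> s) z = b s z"
    and "conv (fun_co G) (grp_alg G) (group_transp G (p_of G RR)) (p_of G RR) (\<delta> s) z = q s z"
    and "conv (grp_alg G) (grp_alg G) (group_transp G (u_of G RR)) (v_of G RR) (\<delta> s) z = (if z = A s then 1 else 0)"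
proof -
  let ?C = "carrier G"
  have UV: "U z \<in> ?C" "V z \<in> ?C" "U s \<in> ?C" "V s \<in> ?C" using c U_simps V_simps by auto
  have "conv (fun_co G) (fun_co G) (group_transp G (v_of G RR)) (u_of G RR) (\<delta> s) z =
      (\<Sum>(c, d)\<in>?C \<times> ?C. if c = inv (V z) \<and> d = U z then if s = d \<otimes> c then 1 else 0 else 0)"
    unfolding conv_def basis_fun_co using c
    by (intro sum.cong refl)
       (auto simp: comul_fun_co[OF fin] mul_fun_co[OF fin] transp_\<delta>[OF fin] v_of_\<delta>[OF RR] u_of_\<delta>[OF RR] u_coeff_eq \<delta>_apply)
  then show "conv (fun_co G) (fun_co G) (group_transp G (v_of G RR)) (u_of G RR) (\<delta> s) z = (if s = A z then 1 else 0)"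
    using UV by (simp add: sum_delta_product[OF fin fin] A_def)
  have diag: "(\<Sum>(c, d)\<in>?C \<times> ?C. comul (grp_alg G) (\<delta> s) (c, d) * \<phi> c d) = \<phi> s s" for \<phi> :: "'a \<Rightarrow> 'a \<Rightarrow> 'k"
  proof -
    have "(\<Sum>(c, d)\<in>?C \<times> ?C. comul (grp_alg G) (\<delta> s) (c, d) * \<phi> c d) = (\<Sum>(c, d)\<in>?C \<times> ?C. if c = s \<and> d = s then \<phi> c d else 0)"
      by (intro sum.cong refl) (auto simp: comul_grp_alg[OF fin] \<delta>_apply)
    then show ?thesis using c by (simp add: sum_delta_product[OF fin fin])
  qed
  show "conv (grp_alg G) (fun_co G) (group_transp G (r_of G RR)) (r_of G RR) (\<delta> s) z = b s z"
    unfolding conv_def basis_grp_alg diag using c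
    by (simp add: mul_fun_co[OF fin] transp_\<delta>[OF fin] r_of_\<delta>[OF RR] b_def)
  have "conv (grp_alg G) (grp_alg G) (group_transp G (u_of G RR)) (v_of G RR) (\<delta> s) z =
      (\<Sum>g\<in>?C. group_transp G (u_of G RR) (\<delta> s) g * v_of G RR (\<delta> s) (inv g \<otimes> z))"
    unfolding conv_def basis_grp_alg diag using c by (simp add: mul_grp_alg[OF fin])
  also have "\<dots> = (\<Sum>g\<in>?C. if g = U s then if inv g \<otimes> z = inv (V s) then 1 else 0 else 0)"
    using c by (intro sum.cong refl) (simp add: transp_\<delta>[OF fin] v_of_\<delta>[OF RR] u_of_\<delta>[OF RR] u_coeff_eq)
  also have "\<dots> = (if inv (U s) \<otimes> z = inv (V s) then 1 else 0)" using fin UV by simp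
  also have "inv (U s) \<otimes> z = inv (V s) \<longleftrightarrow> z = A s" using inv_mult_eq_iff UV c by (simp add: A_def)
  finally show "conv (grp_alg G) (grp_alg G) (group_transp G (u_of G RR)) (v_of G RR) (\<delta> s) z = (if z = A s then 1 else 0)" .
  have "conv (fun_co G) (grp_alg G) (group_transp G (p_of G RR)) (p_of G RR) (\<delta> s) z =
      (\<Sum>(c, d)\<in>?C \<times> ?C. if d = s \<otimes> inv c then \<Sum>g\<in>?C. p g c * p d (inv g \<otimes> z) else 0)"
    unfolding conv_def basis_fun_co
  proof (intro sum.cong refl, clarify)
    fix c d assume cd: "c \<in> ?C" "d \<in> ?C"
    have "d \<otimes> c = s \<longleftrightarrow> d = s \<otimes> inv c" using cd c inv_solve_right[of d s c] by auto
    then show "comul (fun_co G) (\<delta> s) (c, d) * mul (grp_alg G) (group_transp G (p_of G RR) (\<delta> c)) (p_of G RR (\<delta> d)) z =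
        (if d = s \<otimes> inv c then \<Sum>g\<in>?C. p g c * p d (inv g \<otimes> z) else 0)"
      using cd c by (auto simp: comul_fun_co[OF fin] mul_grp_alg[OF fin] transp_\<delta>[OF fin] p_of_\<delta>[OF RR] \<delta>_apply cong: sum.cong)
  qed
  also have "\<dots> = (\<Sum>c\<in>?C. \<Sum>d\<in>?C. if d = s \<otimes> inv c then \<Sum>g\<in>?C. p g c * p d (inv g \<otimes> z) else 0)"
    by (rule sum.cartesian_product[symmetric])
  also have "\<dots> = (\<Sum>c\<in>?C. \<Sum>g\<in>?C. p g c * p (s \<otimes> inv c) (inv g \<otimes> z))" using fin c by simp
  also have "\<dots> = q s z" unfolding q_def convolve_def
  proof (intro sum.cong refl)
    fix t g assume "t \<in> ?C" "g \<in> ?C"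
    then show "p g t * p (s \<otimes> inv t) (inv g \<otimes> z) = p g t * p (inv t \<otimes> s) (inv g \<otimes> z)"
      using p_conj(1)[of "inv t \<otimes> s" "inv g \<otimes> z" t] c by (simp add: group_normalize)
  qed
  finally show "conv (fun_co G) (grp_alg G) (group_transp G (p_of G RR)) (p_of G RR) (\<delta> s) z = q s z" .
qed

lemma q_conj:
  assumes "c \<in> carrier G" "d \<in> carrier G" "k \<in> carrier G"
  shows "q (k \<otimes> c \<otimes> inv k) d = q c d" "q c (k \<otimes> d \<otimes> inv k) = q c d"
  using central_Hopf_matrix_conj[OF central_Hopf_matrix_q assms]
    central_Hopf_matrix_conj[OF central_Hopf_matrix_transpose[OF central_Hopf_matrix_q] assms(2,1,3)] by auto

text \<open>
  The first Sweedler component of \<open>e\<^sub>y\<close> must be \<open>e\<^sub>s\<close> with \<open>s = A z\<close> in order to contribute at \<open>e\<^sub>z\<close>,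
  which leaves one term of the coproduct. Both arguments of \<open>q\<close> are then conjugated into the order used
  in \<open>double_matrix\<close>.
\<close>

lemma Psi_map_eq: "Psi_map G RR = linear_of (carrier G \<times> carrier G) (double_matrix G A A b q)"
proof (intro ext)
  fix a :: "'a \<times> 'a \<Rightarrow> 'k" and v :: "'a \<times> 'a"
  obtain z h where v: "v = (z, h)" by (metis surj_pair)
  let ?C = "carrier G"
  show "Psi_map G RR a v = linear_of (?C \<times> ?C) (double_matrix G A A b q) a v"
  proof (cases "z \<in> ?C \<and> h \<in> ?C")
    case True
    then have zh: "z \<in> ?C" "h \<in> ?C" by auto
    let ?\<alpha> = "conv (fun_co G) (fun_co G) (group_transp G (v_of G RR)) (u_of G RR)"
    let ?\<beta> = "conv (grp_alg G) (fun_co G) (group_transp G (r_of G RR)) (r_of G RR)"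
    let ?\<gamma> = "conv (fun_co G) (grp_alg G) (group_transp G (p_of G RR)) (p_of G RR)"
    let ?\<eta> = "conv (grp_alg G) (grp_alg G) (group_transp G (u_of G RR)) (v_of G RR)"
    have grp: "mul (grp_alg G) (?\<gamma> (\<delta> t)) (?\<eta> (\<delta> x)) h = q t (inv (A x) \<otimes> h)"
      if "t \<in> ?C" "x \<in> ?C" for t x
    proof -
      have "mul (grp_alg G) (?\<gamma> (\<delta> t)) (?\<eta> (\<delta> x)) h = (\<Sum>g\<in>?C. if g = h \<otimes> inv (A x) then q t g else 0)"
        unfolding mul_grp_alg[OF fin] if_P[OF zh(2)]
      proof (rule sum.cong[OF refl])
        fix g assume g: "g \<in> ?C"
        have "inv g \<otimes> h = A x \<longleftrightarrow> g = h \<otimes> inv (A x)"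
          using inv_mult_eq_iff[of g h "A x"] inv_solve_right[of g h "A x"] g zh that by auto
        then show "?\<gamma> (\<delta> t) g * ?\<eta> (\<delta> x) (inv g \<otimes> h) = (if g = h \<otimes> inv (A x) then q t g else 0)"
          using g zh that by (simp add: Psi_entries(3,4))
      qed
      also have "\<dots> = q t (h \<otimes> inv (A x))" using fin zh that by simp
      finally show ?thesis using q_conj(2)[of t "inv (A x) \<otimes> h" "A x"] zh that by (simp add: group_normalize)
    qed
    have "Psi_map G RR a v = (\<Sum>x\<in>?C. \<Sum>(s, t)\<in>?C \<times> ?C.
        if s = A z then a (t \<otimes> A z, x) * (b x z * q t (inv (A x) \<otimes> h)) else 0)"
      unfolding Psi_map_def matrix_map_def v tens_def
      using zh by (intro sum.cong refl)
        (auto simp: comul_fun_co[OF fin] mul_fun_co[OF fin] Psi_entries(1,2) grp)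
    also have "\<dots> = (\<Sum>x\<in>?C. \<Sum>t\<in>?C. a (t \<otimes> A z, x) * (b x z * q t (inv (A x) \<otimes> h)))"
    proof (rule sum.cong[OF refl])
      fix x assume "x \<in> ?C"
      have "(\<Sum>(s, t)\<in>?C \<times> ?C. if s = A z then a (t \<otimes> A z, x) * (b x z * q t (inv (A x) \<otimes> h)) else 0) =
          (\<Sum>t\<in>?C. \<Sum>s\<in>?C. if s = A z then a (t \<otimes> A z, x) * (b x z * q t (inv (A x) \<otimes> h)) else 0)"
        by (subst sum.cartesian_product[symmetric], rule sum.swap)
      then show "(\<Sum>(s, t)\<in>?C \<times> ?C. if s = A z then a (t \<otimes> A z, x) * (b x z * q t (inv (A x) \<otimes> h)) else 0) =
          (\<Sum>t\<in>?C. a (t \<otimes> A z, x) * (b x z * q t (inv (A x) \<otimes> h)))" using fin zh by simp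
    qed
    also have "\<dots> = (\<Sum>x\<in>?C. \<Sum>y\<in>?C. a (y, x) * double_matrix G A A b q (y, x) (z, h))"
    proof (rule sum.cong[OF refl])
      fix x assume x: "x \<in> ?C"
      let ?\<phi> = "\<lambda>y. a (y, x) * (b x z * q (y \<otimes> inv (A z)) (inv (A x) \<otimes> h))"
      have "(\<Sum>t\<in>?C. a (t \<otimes> A z, x) * (b x z * q t (inv (A x) \<otimes> h))) = (\<Sum>t\<in>?C. ?\<phi> (t \<otimes> A z))"
        using zh by (intro sum.cong refl) (simp add: m_assoc)
      also have "\<dots> = (\<Sum>y\<in>?C. ?\<phi> y)" using sum_translate(2)[of "A z" ?\<phi>] zh by simp
      also have "\<dots> = (\<Sum>y\<in>?C. a (y, x) * double_matrix G A A b q (y, x) (z, h))"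
      proof (rule sum.cong[OF refl])
        fix y assume y: "y \<in> ?C"
        show "?\<phi> y = a (y, x) * double_matrix G A A b q (y, x) (z, h)"
          using q_conj(1)[of "inv (A z) \<otimes> y" "inv (A x) \<otimes> h" "A z"] x y zh
          by (simp add: double_matrix_def group_normalize)
      qed
      finally show "(\<Sum>t\<in>?C. a (t \<otimes> A z, x) * (b x z * q t (inv (A x) \<otimes> h))) =
          (\<Sum>y\<in>?C. a (y, x) * double_matrix G A A b q (y, x) (z, h))" .
    qed
    also have "\<dots> = linear_of (?C \<times> ?C) (double_matrix G A A b q) a v"
      unfolding linear_of_def v
      by (subst sum.swap, subst sum.cartesian_product) (simp add: case_prod_unfold)
    finally show ?thesis .
  next
    case False
    then have "Psi_map G RR a v = 0"
      unfolding Psi_map_def matrix_map_def v tens_def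
      by (intro sum.neutral ballI) (auto simp: mul_fun_co[OF fin] mul_grp_alg[OF fin])
    moreover have "linear_of (?C \<times> ?C) (double_matrix G A A b q) a v = 0"
      unfolding linear_of_def v using False by (intro sum.neutral ballI) (auto simp: double_matrix_def)
    ultimately show ?thesis by simp
  qed
qed

text \<open>
  Indexes the basis of the dual so that \<open>F(\<tau>(R)R)\<close> takes the functional dual to \<open>e\<^sub>x \<bowtie> g\<close> to the image of
  the basis vector with index \<open>\<sigma> (x, g)\<close> under \<open>\<Psi>\<^sub>R\<close>.
\<close>

definition \<sigma> :: "'a \<times> 'a \<Rightarrow> 'a \<times> 'a" where
  "\<sigma> = (\<lambda>(x, g). (f x \<otimes> g \<otimes> inv (f x), inv (e g) \<otimes> x \<otimes> e g))"

lemma bij_\<sigma>: "bij_betw \<sigma> (carrier G \<times> carrier G) (carrier G \<times> carrier G)"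
proof (rule bij_betw_byWitness[where f' = "\<lambda>(y, x). (e y \<otimes> x \<otimes> inv (e y), inv (f x) \<otimes> y \<otimes> f x)"])
  have 1: "e (f x \<otimes> g \<otimes> inv (f x)) = e g" "f (inv (e g) \<otimes> x \<otimes> e g) = f x"
    "f (e g \<otimes> x \<otimes> inv (e g)) = f x" "e (inv (f x) \<otimes> g \<otimes> f x) = e g"
    if "x \<in> carrier G" "g \<in> carrier G" for x g
    using that by (simp_all add: e_simps f_simps e_of_f f_of_e)
  show "\<forall>a\<in>carrier G \<times> carrier G. (case \<sigma> a of (y, x) \<Rightarrow> (e y \<otimes> x \<otimes> inv (e y), inv (f x) \<otimes> y \<otimes> f x)) = a"
    by (clarsimp simp: \<sigma>_def 1) (simp add: group_normalize)
  show "\<forall>a\<in>carrier G \<times> carrier G. \<sigma> (case a of (y, x) \<Rightarrow> (e y \<otimes> x \<otimes> inv (e y), inv (f x) \<otimes> y \<otimes> f x)) = a"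
    by (clarsimp simp: \<sigma>_def 1) (simp add: group_normalize)
qed (auto simp: \<sigma>_def)

lemma monodromy_eq:
  assumes "w \<in> carrier G \<times> carrier G"
  shows "monodromy (double G) RR (w, v) = double_matrix G A A b q (\<sigma> w) v"
proof -
  obtain x g y h where [simp]: "w = (x, g)" "v = (y, h)" by (metis surj_pair)
  show ?thesis
  proof (cases "y \<in> carrier G \<and> h \<in> carrier G")
    case True
    then show ?thesis
      using monodromy_coefficient[of x g y h] assms
      by (simp add: monodromy_def mul_double_double[OF fin] flip_def \<sigma>_def RR)
  next
    case False
    then show ?thesis
      by (auto simp: monodromy_def mul_tensor_double[OF fin] mul_double[OF fin] double_matrix_def \<sigma>_def)
  qed
qed

lemma F_map_monodromy_eq:
  "F_map (double G) (monodromy (double G) RR) (\<phi> \<circ> \<sigma>) = linear_of (carrier G \<times> carrier G) (double_matrix G A A b q) \<phi>"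
proof
  fix v
  let ?B = "carrier G \<times> carrier G"
  have "F_map (double G) (monodromy (double G) RR) (\<phi> \<circ> \<sigma>) v = (\<Sum>w\<in>?B. \<phi> (\<sigma> w) * double_matrix G A A b q (\<sigma> w) v)"
    unfolding F_map_def basis_double by (intro sum.cong refl) (simp add: monodromy_eq)
  also have "\<dots> = (\<Sum>w\<in>?B. \<phi> w * double_matrix G A A b q w v)"
    by (rule sum.reindex_bij_betw[OF bij_\<sigma>])
  finally show "F_map (double G) (monodromy (double G) RR) (\<phi> \<circ> \<sigma>) v = linear_of ?B (double_matrix G A A b q) \<phi> v"
    by (simp add: linear_of_def)
qed

end

end

section \<open>Groups with a decomposition\<close>

locale decomposed_group =
  fixes n :: nat and Gs :: "nat \<Rightarrow> 'a monoid"
  assumes finite_factors: "\<And>i. i \<le> n \<Longrightarrow> finite (carrier (Gs i))"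
    and abelian_factor: "comm_group (Gs 0)"
    and indecomposable_factors: "\<And>i. 1 \<le> i \<Longrightarrow> i \<le> n \<Longrightarrow> indecomposable_group (Gs i) \<and> \<not> comm_group (Gs i)"
begin

abbreviation (input) G where "G \<equiv> prod_group n Gs"

lemma group_factor: "i \<le> n \<Longrightarrow> group (Gs i)"
  using abelian_factor indecomposable_factors[of i]
  by (cases "i = 0") (auto simp: comm_group_def indecomposable_group_def)

sublocale G: group G
  unfolding prod_group_def by (rule product_group) (simp add: group_factor)

lemma carrier_G: "carrier G = (\<Pi>\<^sub>E i\<in>{0..n}. carrier (Gs i))"
  by (simp add: prod_group_def)

lemma finite_G: "finite (carrier G)"
  unfolding carrier_G by (rule finite_PiE) (auto simp: finite_factors)

lemma at_closed: "x \<in> carrier G \<Longrightarrow> i \<le> n \<Longrightarrow> x i \<in> carrier (Gs i)"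
  by (auto simp: carrier_G)

lemma at_mult: "i \<le> n \<Longrightarrow> (x \<otimes>\<^bsub>G\<^esub> y) i = x i \<otimes>\<^bsub>Gs i\<^esub> y i"
  by (simp add: prod_group_def)

lemma at_one: "i \<le> n \<Longrightarrow> \<one>\<^bsub>G\<^esub> i = \<one>\<^bsub>Gs i\<^esub>"
  by (simp add: prod_group_def)

lemma at_inv:
  assumes "x \<in> carrier G" "i \<le> n"
  shows "(inv\<^bsub>G\<^esub> x) i = inv\<^bsub>Gs i\<^esub> (x i)"
  using assms inv_product_group[of x "{0..n}" Gs] group_factor by (simp add: prod_group_def)

lemmas at_simps = at_mult at_one at_inv at_closed

lemma eqI:
  assumes "x \<in> carrier G" "y \<in> carrier G" "\<And>i. i \<le> n \<Longrightarrow> x i = y i"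
  shows "x = y"
  using assms unfolding carrier_G by (intro PiE_ext) auto

lemma centreI_at:
  assumes "c \<in> carrier G" "\<And>i. i \<le> n \<Longrightarrow> c i \<in> centre (Gs i)"
  shows "c \<in> centre G"
proof (rule G.centreI[OF assms(1)])
  fix x assume x: "x \<in> carrier G"
  show "c \<otimes>\<^bsub>G\<^esub> x = x \<otimes>\<^bsub>G\<^esub> c"
    using assms x group.centreD(2)[OF group_factor assms(2)]
    by (intro eqI) (auto simp: at_simps)
qed

definition inject :: "nat \<Rightarrow> 'a \<Rightarrow> nat \<Rightarrow> 'a" where
  "inject i a = (\<lambda>j\<in>{0..n}. if j = i then a else \<one>\<^bsub>Gs j\<^esub>)"

lemma inject_closed: "a \<in> carrier (Gs i) \<Longrightarrow> inject i a \<in> carrier G"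
  using group.is_monoid[OF group_factor] by (auto simp: inject_def carrier_G intro: monoid.one_closed)

lemma at_inject: "j \<le> n \<Longrightarrow> inject i a j = (if j = i then a else \<one>\<^bsub>Gs j\<^esub>)"
  by (simp add: inject_def)

lemma component_eq: "component n Gs i w a = w (inject i a) i"
  by (simp add: component_def inject_def)

lemma inject_mult:
  assumes "i \<le> n" "a \<in> carrier (Gs i)" "b \<in> carrier (Gs i)"
  shows "inject i (a \<otimes>\<^bsub>Gs i\<^esub> b) = inject i a \<otimes>\<^bsub>G\<^esub> inject i b"
proof -
  interpret H: group "Gs i" using group_factor assms by simp
  show ?thesis
    using assms inject_closed group.is_monoid[OF group_factor]
    by (intro eqI) (auto simp: at_simps at_inject monoid.l_one monoid.one_closed)
qed

lemma inject_inv: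
  assumes "i \<le> n" "a \<in> carrier (Gs i)"
  shows "inject i (inv\<^bsub>Gs i\<^esub> a) = inv\<^bsub>G\<^esub> (inject i a)"
proof -
  interpret H: group "Gs i" using group_factor assms by simp
  show ?thesis
    using assms inject_closed group.is_monoid[OF group_factor]
    by (intro eqI) (auto simp: at_simps at_inject monoid.inv_one)
qed

context
  fixes w :: "(nat \<Rightarrow> 'a) \<Rightarrow> nat \<Rightarrow> 'a"
  assumes w: "normal_endo G w"
begin

lemma normal_endo_component:
  assumes i: "i \<le> n"
  shows "normal_endo (Gs i) (component n Gs i w)"
proof -
  interpret H: group "Gs i" using group_factor i by simp
  note d = G.normal_endoD[OF w]
  show ?thesis
    unfolding normal_endo_def component_eq
  proof (intro conjI homI ballI)
    fix a b assume ab: "a \<in> carrier (Gs i)" "b \<in> carrier (Gs i)"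
    then have c: "inject i a \<in> carrier G" "inject i b \<in> carrier G" by (simp_all add: inject_closed)
    then show "w (inject i a) i \<in> carrier (Gs i)" using d(1) i at_closed by simp
    show "w (inject i (a \<otimes>\<^bsub>Gs i\<^esub> b)) i = w (inject i a) i \<otimes>\<^bsub>Gs i\<^esub> w (inject i b) i"
      using i ab c d(2) by (simp add: inject_mult at_mult)
    have "inject i (a \<otimes>\<^bsub>Gs i\<^esub> b \<otimes>\<^bsub>Gs i\<^esub> inv\<^bsub>Gs i\<^esub> a) = inject i a \<otimes>\<^bsub>G\<^esub> inject i b \<otimes>\<^bsub>G\<^esub> inv\<^bsub>G\<^esub> inject i a"
      using i ab by (simp add: inject_mult inject_inv)
    then show "w (inject i (a \<otimes>\<^bsub>Gs i\<^esub> b \<otimes>\<^bsub>Gs i\<^esub> inv\<^bsub>Gs i\<^esub> a)) i = a \<otimes>\<^bsub>Gs i\<^esub> w (inject i b) i \<otimes>\<^bsub>Gs i\<^esub> inv\<^bsub>Gs i\<^esub> a"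
      using d(5)[OF c(2,1)] c i by (simp only: at_simps at_inject) simp
  qed
qed

text \<open>
  An element with trivial entry at \<open>i\<close> commutes with the factor \<open>Gs i\<close>. Its image under \<open>w\<close> is then fixed
  by conjugation with that factor, so its entry at \<open>i\<close> is central.
\<close>

lemma at_normal_endo:
  assumes i: "i \<le> n" and x: "x \<in> carrier G"
  obtains z where "z \<in> centre (Gs i)" "w x i = component n Gs i w (x i) \<otimes>\<^bsub>Gs i\<^esub> z"
proof -
  interpret H: group "Gs i" using group_factor i by simp
  note d = G.normal_endoD[OF w]
  define xi where "xi = inject i (x i)"
  define y where "y = inv\<^bsub>G\<^esub> xi \<otimes>\<^bsub>G\<^esub> x"
  have xi: "xi \<in> carrier G" using x i at_closed inject_closed by (simp add: xi_def)
  have y: "y \<in> carrier G" "x = xi \<otimes>\<^bsub>G\<^esub> y" using xi x by (auto simp: y_def G.inv_mult_cancel)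
  have yi: "y i = \<one>\<^bsub>Gs i\<^esub>" using xi x i by (simp add: y_def at_simps xi_def at_inject)
  have "w y i \<in> centre (Gs i)"
  proof (rule H.centreI)
    show "w y i \<in> carrier (Gs i)" using d(1) y i at_closed by simp
    fix a assume a: "a \<in> carrier (Gs i)"
    let ?a = "inject i a"
    have ac: "?a \<in> carrier G" using a inject_closed by simp
    have "?a \<otimes>\<^bsub>G\<^esub> y = y \<otimes>\<^bsub>G\<^esub> ?a"
      using a ac y yi group.is_monoid[OF group_factor]
      by (intro eqI) (auto simp: at_simps at_inject monoid.l_one monoid.r_one)
    then have "?a \<otimes>\<^bsub>G\<^esub> y \<otimes>\<^bsub>G\<^esub> inv\<^bsub>G\<^esub> ?a = y" using ac y by (simp add: G.m_assoc)
    then have "?a \<otimes>\<^bsub>G\<^esub> w y \<otimes>\<^bsub>G\<^esub> inv\<^bsub>G\<^esub> ?a = w y" using d(5)[OF y(1) ac] by simp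
    then have "?a \<otimes>\<^bsub>G\<^esub> w y \<otimes>\<^bsub>G\<^esub> inv\<^bsub>G\<^esub> ?a \<otimes>\<^bsub>G\<^esub> ?a = w y \<otimes>\<^bsub>G\<^esub> ?a" by simp
    then have "?a \<otimes>\<^bsub>G\<^esub> w y = w y \<otimes>\<^bsub>G\<^esub> ?a" using ac d(1) y by (simp add: G.m_assoc)
    from fun_cong[OF this, of i] show "w y i \<otimes>\<^bsub>Gs i\<^esub> a = a \<otimes>\<^bsub>Gs i\<^esub> w y i"
      using i by (simp add: at_simps at_inject)
  qed
  moreover have "w x i = component n Gs i w (x i) \<otimes>\<^bsub>Gs i\<^esub> w y i"
    using d(2)[OF xi y(1)] i by (simp add: component_eq at_mult flip: xi_def y(2))
  ultimately show ?thesis using that by blast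
qed

end

context
  fixes E :: "nat set"
begin

definition retained :: "nat \<Rightarrow> bool" where "retained i \<longleftrightarrow> i = 0 \<or> i \<in> E"

definition reversed_part :: "(nat \<Rightarrow> 'a) \<Rightarrow> nat \<Rightarrow> 'a" where
  "reversed_part x = (\<lambda>i\<in>{0..n}. if retained i then \<one>\<^bsub>Gs i\<^esub> else x i)"

lemma at_reversed_part: "i \<le> n \<Longrightarrow> reversed_part x i = (if retained i then \<one>\<^bsub>Gs i\<^esub> else x i)"
  by (simp add: reversed_part_def)

lemma reversed_part_closed: "x \<in> carrier G \<Longrightarrow> reversed_part x \<in> carrier G"
  using group.is_monoid[OF group_factor] by (auto simp: reversed_part_def carrier_G intro: monoid.one_closed)

lemma split_group_reversed_part: "split_group G reversed_part"
proof
  show "reversed_part \<in> hom G G"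
  proof (rule homI)
    fix x y assume c: "x \<in> carrier G" "y \<in> carrier G"
    show "reversed_part (x \<otimes>\<^bsub>G\<^esub> y) = reversed_part x \<otimes>\<^bsub>G\<^esub> reversed_part y"
    proof (rule eqI)
      fix i assume i: "i \<le> n"
      interpret H: group "Gs i" using group_factor i by simp
      show "reversed_part (x \<otimes>\<^bsub>G\<^esub> y) i = (reversed_part x \<otimes>\<^bsub>G\<^esub> reversed_part y) i"
        using i c by (simp add: at_simps at_reversed_part)
    qed (use c in \<open>simp_all add: reversed_part_closed\<close>)
  qed (rule reversed_part_closed)
  show "reversed_part (reversed_part x) = reversed_part x" if "x \<in> carrier G" for x
    using that by (intro eqI) (auto simp: reversed_part_closed at_reversed_part)
  fix x y assume c: "x \<in> carrier G" "y \<in> carrier G"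
  show "reversed_part x \<otimes>\<^bsub>G\<^esub> (y \<otimes>\<^bsub>G\<^esub> inv\<^bsub>G\<^esub> reversed_part y) = y \<otimes>\<^bsub>G\<^esub> inv\<^bsub>G\<^esub> reversed_part y \<otimes>\<^bsub>G\<^esub> reversed_part x"
  proof (rule eqI)
    fix i assume i: "i \<le> n"
    interpret H: group "Gs i" using group_factor i by simp
    show "(reversed_part x \<otimes>\<^bsub>G\<^esub> (y \<otimes>\<^bsub>G\<^esub> inv\<^bsub>G\<^esub> reversed_part y)) i = (y \<otimes>\<^bsub>G\<^esub> inv\<^bsub>G\<^esub> reversed_part y \<otimes>\<^bsub>G\<^esub> reversed_part x) i"
      using i c by (simp add: at_simps at_reversed_part reversed_part_closed)
  qed (use c in \<open>simp_all add: reversed_part_closed\<close>)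
qed

interpretation S: split_group G reversed_part by (rule split_group_reversed_part)

lemma at_f:
  assumes "x \<in> carrier G" "i \<le> n"
  shows "S.f x i = (if retained i then x i else \<one>\<^bsub>Gs i\<^esub>)"
proof -
  interpret H: group "Gs i" using group_factor assms by simp
  show ?thesis using assms by (simp add: S.f_def at_simps at_reversed_part reversed_part_closed)
qed

lemma carrier_G_E: "carrier (G_E n Gs E) = carrier G"
  unfolding G_E_def prod_group_def carrier_product_group by (rule PiE_cong) (simp add: op_group_def)

lemma group_op_group:
  assumes "group H"
  shows "group (op_group H)"
proof -
  interpret H: group H by (rule assms)
  show ?thesis
    by (rule groupI) (auto simp: op_group_def H.m_assoc intro: H.r_inv bexI[of _ "inv\<^bsub>H\<^esub> _"])
qed

lemma half_opposite_G_E: "half_opposite G reversed_part (G_E n Gs E)"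
proof (intro half_opposite.intro half_opposite_axioms.intro)
  show "split_group G reversed_part" by (rule split_group_reversed_part)
  show "group (G_E n Gs E)" unfolding G_E_def prod_group_def
    by (rule product_group) (auto simp: group_factor group_op_group)
  show "carrier (G_E n Gs E) = carrier G" by (rule carrier_G_E)
  fix x y assume c: "x \<in> carrier G" "y \<in> carrier G"
  have "y i \<otimes>\<^bsub>Gs i\<^esub> x i \<in> carrier (Gs i)" "x i \<otimes>\<^bsub>Gs i\<^esub> y i \<in> carrier (Gs i)" if "i \<le> n" for i
    using that c group.is_monoid[OF group_factor] at_closed by (auto intro: monoid.m_closed)
  then have cl: "x \<otimes>\<^bsub>G_E n Gs E\<^esub> y \<in> carrier G"
    by (auto simp: G_E_def prod_group_def op_group_def)
  show "x \<otimes>\<^bsub>G_E n Gs E\<^esub> y = S.f x \<otimes>\<^bsub>G\<^esub> y \<otimes>\<^bsub>G\<^esub> reversed_part x"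
  proof (rule eqI[OF cl])
    fix i assume i: "i \<le> n"
    interpret H: group "Gs i" using group_factor i by simp
    show "(x \<otimes>\<^bsub>G_E n Gs E\<^esub> y) i = (S.f x \<otimes>\<^bsub>G\<^esub> y \<otimes>\<^bsub>G\<^esub> reversed_part x) i"
      using i c by (simp add: at_simps at_f at_reversed_part G_E_def prod_group_def[of n "\<lambda>i. if _ i then _ i else _ i"] op_group_def retained_def)
  qed (use c in simp)
qed

lemma theta_eq:
  assumes x: "x \<in> carrier G"
  shows "theta n Gs E x = S.theta_of x"
proof (rule eqI)
  show "theta n Gs E x \<in> carrier G"
    using at_closed[OF x] group.inv_closed[OF group_factor] by (auto simp: theta_def carrier_G)
  fix i assume i: "i \<le> n"
  interpret H: group "Gs i" using group_factor i by simp
  show "theta n Gs E x i = S.theta_of x i"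
    using i x by (simp add: theta_def S.theta_of_def at_simps at_f at_reversed_part retained_def)
qed (use x in simp)

end

end

lemma central_aut_cong:
  assumes "central_aut H w" "\<And>x. x \<in> carrier H \<Longrightarrow> w' x = w x" "group H"
  shows "central_aut H w'"
proof -
  interpret group H by (rule assms)
  show ?thesis
    using assms(1,2) bij_betw_cong[of "carrier H" w' w] unfolding central_aut_def iso_def hom_def by auto
qed

locale decomposed_rmatrix = decomposed_group n Gs for n and Gs :: "nat \<Rightarrow> 'a monoid" +
  fixes RR :: "((nat \<Rightarrow> 'a) \<times> (nat \<Rightarrow> 'a)) \<times> ((nat \<Rightarrow> 'a) \<times> (nat \<Rightarrow> 'a)) \<Rightarrow> 'k::field"
  assumes qt: "quasitriangular (double (prod_group n Gs)) RR"
begin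

abbreviation (input) E where "E \<equiv> E_set n Gs RR"

sublocale R: rmatrix "prod_group n Gs" "coeff RR"
  by (rule G.rmatrix_of_quasitriangular[OF finite_G qt])

lemma RR_vecs: "RR \<in> vecs (basis (double (prod_group n Gs)) \<times> basis (double (prod_group n Gs)))"
  using qt by (simp add: quasitriangular_def basis_double)

text \<open>
  The relation \<open>double_conj\<close> for two elements of one factor, read in this factor, is the hypothesis of
  the dichotomy.
\<close>

lemma component_dichotomy:
  assumes i: "1 \<le> i" "i \<le> n"
  shows "central_aut (Gs i) (component n Gs i R.U) \<and> (\<forall>x\<in>carrier (Gs i). component n Gs i R.V x \<in> centre (Gs i)) \<or>
    central_aut (Gs i) (component n Gs i R.V) \<and> (\<forall>x\<in>carrier (Gs i). component n Gs i R.U x \<in> centre (Gs i))"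
proof -
  interpret H: group "Gs i" using group_factor i by simp
  show ?thesis
  proof (rule H.normal_endo_dichotomy)
    show "finite (carrier (Gs i))" "indecomposable_group (Gs i)" "\<not> comm_group (Gs i)"
      using finite_factors indecomposable_factors i by auto
    show "normal_endo (Gs i) (component n Gs i R.U)" "normal_endo (Gs i) (component n Gs i R.V)"
      using normal_endo_component[OF R.normal_endo_U] normal_endo_component[OF R.normal_endo_V] i by auto
    fix a b assume ab: "a \<in> carrier (Gs i)" "b \<in> carrier (Gs i)"
    have c: "inject i a \<in> carrier (prod_group n Gs)" "inject i b \<in> carrier (prod_group n Gs)"
      using ab inject_closed by auto
    from fun_cong[OF R.double_conj[OF c], of i]
    show "component n Gs i R.V a \<otimes>\<^bsub>Gs i\<^esub> b \<otimes>\<^bsub>Gs i\<^esub> inv\<^bsub>Gs i\<^esub> component n Gs i R.V a \<otimes>\<^bsub>Gs i\<^esub>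
        (inv\<^bsub>Gs i\<^esub> component n Gs i R.U b \<otimes>\<^bsub>Gs i\<^esub> a \<otimes>\<^bsub>Gs i\<^esub> component n Gs i R.U b) = a \<otimes>\<^bsub>Gs i\<^esub> b"
      using i c R.U_simps(1) R.V_simps(1) by (simp add: at_simps at_inject component_eq)
  qed
qed

lemma component_star:
  assumes "a \<in> carrier (Gs i)"
  shows "component n Gs i (u_star (prod_group n Gs) RR) a = component n Gs i R.U a"
    and "component n Gs i (Sv (prod_group n Gs) RR) a = component n Gs i R.V a"
  using R.u_star_eq[of RR, OF refl] R.Sv_eq[of RR, OF refl RR_vecs] inject_closed[OF assms]
  by (simp_all add: component_eq)

lemma E_central:
  assumes i: "i \<le> n" "i \<in> E" and x: "x \<in> carrier (Gs i)"
  shows "inv\<^bsub>Gs i\<^esub> x \<otimes>\<^bsub>Gs i\<^esub> component n Gs i R.U x \<in> centre (Gs i)" "component n Gs i R.V x \<in> centre (Gs i)"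
proof -
  have "central_aut (Gs i) (component n Gs i (u_star (prod_group n Gs) RR))"
    "component n Gs i (Sv (prod_group n Gs) RR) \<in> hom (Gs i) ((Gs i)\<lparr>carrier := centre (Gs i)\<rparr>)"
    using i by (simp_all add: E_set_def)
  then show "inv\<^bsub>Gs i\<^esub> x \<otimes>\<^bsub>Gs i\<^esub> component n Gs i R.U x \<in> centre (Gs i)" "component n Gs i R.V x \<in> centre (Gs i)"
    using x by (simp_all add: central_aut_def hom_def Pi_iff component_star[OF x, symmetric])
qed

text \<open>
  Outside \<open>E\<close> the first alternative of the dichotomy is excluded by the definition of \<open>E\<close>.
\<close>

lemma not_E_central:
  assumes i: "1 \<le> i" "i \<le> n" "i \<notin> E" and x: "x \<in> carrier (Gs i)"
  shows "inv\<^bsub>Gs i\<^esub> x \<otimes>\<^bsub>Gs i\<^esub> component n Gs i R.V x \<in> centre (Gs i)" "component n Gs i R.U x \<in> centre (Gs i)"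
proof -
  interpret H: group "Gs i" using group_factor i by simp
  have "\<not> (central_aut (Gs i) (component n Gs i R.U) \<and> (\<forall>x\<in>carrier (Gs i). component n Gs i R.V x \<in> centre (Gs i)))"
  proof
    assume a: "central_aut (Gs i) (component n Gs i R.U) \<and> (\<forall>x\<in>carrier (Gs i). component n Gs i R.V x \<in> centre (Gs i))"
    have "central_aut (Gs i) (component n Gs i (u_star (prod_group n Gs) RR))"
      using central_aut_cong[OF a[THEN conjunct1] component_star(1)] group_factor i by simp
    moreover have "component n Gs i (Sv (prod_group n Gs) RR) \<in> hom (Gs i) ((Gs i)\<lparr>carrier := centre (Gs i)\<rparr>)"
      using a H.normal_endoD(2)[OF normal_endo_component[OF R.normal_endo_V]] i
      by (simp add: hom_def component_star)
    ultimately show False using i by (simp add: E_set_def)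
  qed
  then have "central_aut (Gs i) (component n Gs i R.V)" "\<forall>x\<in>carrier (Gs i). component n Gs i R.U x \<in> centre (Gs i)"
    using component_dichotomy[OF i(1,2)] by auto
  then show "inv\<^bsub>Gs i\<^esub> x \<otimes>\<^bsub>Gs i\<^esub> component n Gs i R.V x \<in> centre (Gs i)" "component n Gs i R.U x \<in> centre (Gs i)"
    using x by (auto simp: central_aut_def)
qed

lemma centre_abelian_factor: "x \<in> carrier (Gs 0) \<Longrightarrow> x \<in> centre (Gs 0)"
proof -
  interpret H: comm_group "Gs 0" by (rule abelian_factor)
  show "x \<in> carrier (Gs 0) \<Longrightarrow> x \<in> centre (Gs 0)" by (auto simp: centre_def H.m_comm)
qed

lemma half_opposite_rmatrix: "half_opposite_rmatrix (prod_group n Gs) (coeff RR) (reversed_part E) (G_E n Gs E)"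
proof -
  interpret S: half_opposite "prod_group n Gs" "reversed_part E" "G_E n Gs E" by (rule half_opposite_G_E)
  have "inv\<^bsub>prod_group n Gs\<^esub> (S.f x) \<otimes>\<^bsub>prod_group n Gs\<^esub> R.U x \<in> centre (prod_group n Gs) \<and>
      inv\<^bsub>prod_group n Gs\<^esub> (reversed_part E x) \<otimes>\<^bsub>prod_group n Gs\<^esub> R.V x \<in> centre (prod_group n Gs)"
    if x: "x \<in> carrier (prod_group n Gs)" for x
  proof (intro conjI centreI_at)
    have UV: "R.U x \<in> carrier (prod_group n Gs)" "R.V x \<in> carrier (prod_group n Gs)"
      using x R.U_simps(1) R.V_simps(1) by auto
    then show "inv\<^bsub>prod_group n Gs\<^esub> (S.f x) \<otimes>\<^bsub>prod_group n Gs\<^esub> R.U x \<in> carrier (prod_group n Gs)"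
      "inv\<^bsub>prod_group n Gs\<^esub> (reversed_part E x) \<otimes>\<^bsub>prod_group n Gs\<^esub> R.V x \<in> carrier (prod_group n Gs)"
      using x by simp_all
    fix i assume i: "i \<le> n"
    interpret H: group "Gs i" using group_factor i by simp
    have xi: "x i \<in> carrier (Gs i)" using x i at_closed by simp
    obtain z where z: "z \<in> centre (Gs i)" "R.U x i = component n Gs i R.U (x i) \<otimes>\<^bsub>Gs i\<^esub> z"
      using at_normal_endo[OF R.normal_endo_U i x] by blast
    obtain z' where z': "z' \<in> centre (Gs i)" "R.V x i = component n Gs i R.V (x i) \<otimes>\<^bsub>Gs i\<^esub> z'"
      using at_normal_endo[OF R.normal_endo_V i x] by blast
    have cl: "component n Gs i R.U (x i) \<in> carrier (Gs i)" "component n Gs i R.V (x i) \<in> carrier (Gs i)"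
      "z \<in> carrier (Gs i)" "z' \<in> carrier (Gs i)"
      using xi H.normal_endoD(1)[OF normal_endo_component[OF R.normal_endo_U i]]
        H.normal_endoD(1)[OF normal_endo_component[OF R.normal_endo_V i]] H.centreD(1) z z' by auto
    have "R.U x i \<in> carrier (Gs i)" "R.V x i \<in> carrier (Gs i)" using UV i at_closed by auto
    note this[unfolded z(2) z'(2)]
    show "(inv\<^bsub>prod_group n Gs\<^esub> (S.f x) \<otimes>\<^bsub>prod_group n Gs\<^esub> R.U x) i \<in> centre (Gs i)"
    proof (cases "i = 0")
      case True
      then show ?thesis using centre_abelian_factor x UV at_closed[of _ 0] by simp
    next
      case False
      then show ?thesis
        using i x xi cl z H.centre_mult[OF E_central(1)[OF i _ xi] z(1)]
          H.centre_mult[OF not_E_central(2)[OF _ i _ xi] z(1)]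
        by (cases "i \<in> E") (simp_all add: at_simps at_f retained_def H.m_assoc)
    qed
    show "(inv\<^bsub>prod_group n Gs\<^esub> (reversed_part E x) \<otimes>\<^bsub>prod_group n Gs\<^esub> R.V x) i \<in> centre (Gs i)"
    proof (cases "i = 0")
      case True
      then show ?thesis using centre_abelian_factor x UV at_closed[of _ 0] by simp
    next
      case False
      then show ?thesis
        using i x xi cl z' H.centre_mult[OF E_central(2)[OF i _ xi] z'(1)]
          H.centre_mult[OF not_E_central(1)[OF _ i _ xi] z'(1)]
        by (cases "i \<in> E") (simp_all add: at_simps at_reversed_part reversed_part_closed retained_def H.m_assoc)
    qed
  qed
  then show ?thesis by unfold_locales auto
qed

end

section \<open>Surjective endomorphisms of a finite-dimensional space\<close>

lemma sum_fun_apply: "(\<Sum>x\<in>A. g x) y = (\<Sum>x\<in>A. g x y)"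
  by (induction A rule: infinite_finite_induct) auto

interpretation fun_space: vector_space "\<lambda>(c::'k::field) (v::'b \<Rightarrow> 'k) x. c * v x"
  by unfold_locales (auto simp: fun_eq_iff algebra_simps)

lemma linear_of_in_span: "linear_of B N a \<in> fun_space.span (N ` B)"
proof -
  have "linear_of B N a = (\<Sum>x\<in>B. (\<lambda>z. a x * N x z))"
    by (simp add: linear_of_def fun_eq_iff sum_fun_apply)
  also have "\<dots> \<in> fun_space.span (N ` B)"
    by (intro fun_space.span_sum fun_space.span_scale fun_space.span_base) auto
  finally show ?thesis .
qed

lemma independent_\<delta>:
  assumes "finite B"
  shows "fun_space.independent (\<delta> ` B :: ('b \<Rightarrow> 'k::field) set)"
proof (rule fun_space.independent_if_scalars_zero)
  show "finite (\<delta> ` B :: ('b \<Rightarrow> 'k) set)" using assms by simp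
  fix c :: "('b \<Rightarrow> 'k) \<Rightarrow> 'k" and v :: "'b \<Rightarrow> 'k"
  assume 0: "(\<Sum>v\<in>\<delta> ` B. (\<lambda>x. c v * v x)) = 0" and "v \<in> \<delta> ` B"
  then obtain b where b: "b \<in> B" "v = \<delta> b" by blast
  have "0 = (\<Sum>v\<in>\<delta> ` B. (\<lambda>x. c v * v x)) b" by (simp add: 0)
  also have "\<dots> = (\<Sum>a\<in>B. c (\<delta> a) * \<delta> a b)"
    unfolding sum_fun_apply by (simp add: sum.reindex inj_on_def \<delta>_eq_iff)
  also have "\<dots> = (\<Sum>a\<in>B. if a = b then c (\<delta> b) else 0)"
    by (rule sum.cong) (auto simp: \<delta>_apply)
  finally show "c v = 0" using assms b by simp
qed

text \<open>
  A nonzero vector in the kernel expresses one of the images of the basis vectors by the other ones. If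
  the map were surjective, fewer than \<open>card B\<close> vectors would span a space with \<open>card B\<close> independent
  vectors.
\<close>

lemma surj_linear_of_imp_inj:
  fixes N :: "'b \<Rightarrow> 'b \<Rightarrow> 'k::field"
  assumes fin: "finite B" and surj: "vecs B \<subseteq> linear_of B N ` vecs B"
  shows "inj_on (linear_of B N) (vecs B)"
proof (rule inj_onI, rule ccontr)
  fix a a' assume a: "a \<in> vecs B" "a' \<in> vecs B" "linear_of B N a = linear_of B N a'" "a \<noteq> a'"
  define d where "d x = a x - a' x" for x
  obtain b where "a b \<noteq> a' b" using a(4) by blast
  moreover from this have "b \<in> B" using a(1,2) by (cases "b \<in> B") (simp_all add: vecs_def)
  ultimately have b: "b \<in> B" "d b \<noteq> 0" by (simp_all add: d_def)
  let ?S = "fun_space.span (N ` (B - {b}))"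
  have "(\<Sum>x\<in>B. d x * N x z) = 0" for z
    using fun_cong[OF a(3), of z] by (simp add: linear_of_def d_def left_diff_distrib sum_subtractf)
  then have N_b: "d b * N b z = - (\<Sum>x\<in>B - {b}. d x * N x z)" for z
    using sum.remove[OF fin b(1), of "\<lambda>x. d x * N x z"] by (simp add: eq_neg_iff_add_eq_0)
  have "N b z = (\<Sum>x\<in>B - {b}. (- d x / d b) * N x z)" for z
  proof -
    have "N b z = (d b * N b z) / d b" using b by simp
    then show ?thesis unfolding N_b by (simp add: sum_divide_distrib sum_negf)
  qed
  then have "N b = linear_of (B - {b}) N (\<lambda>x. - d x / d b)" by (simp add: linear_of_def fun_eq_iff)
  then have "N b \<in> ?S" using linear_of_in_span by metis
  then have "N ` B \<subseteq> ?S" using fun_space.span_base[of _ "N ` (B - {b})"] by auto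
  then have span: "fun_space.span (N ` B) \<subseteq> ?S" by (simp add: fun_space.span_minimal)
  have "\<delta> ` B \<subseteq> (vecs B :: ('b \<Rightarrow> 'k) set)" by (auto simp: vecs_def \<delta>_apply)
  also note surj
  also have "linear_of B N ` vecs B \<subseteq> fun_space.span (N ` B)" using linear_of_in_span by (rule image_subsetI)
  also note span
  finally have "card (\<delta> ` B :: ('b \<Rightarrow> 'k) set) \<le> card (N ` (B - {b}))"
    using fun_space.independent_span_bound[OF _ independent_\<delta>[OF fin], of "N ` (B - {b})"] fin by simp
  moreover have "card (\<delta> ` B :: ('b \<Rightarrow> 'k) set) = card B"
    by (rule card_image) (auto simp: inj_on_def \<delta>_eq_iff)
  moreover have "card (N ` (B - {b})) < card B"
    using card_image_le[of "B - {b}" N] fin b by (metis card_Diff1_less finite_Diff le_less_trans)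
  ultimately show False by simp
qed

lemma bij_linear_of_iff:
  assumes "finite B"
  shows "bij_betw (linear_of B N) (vecs B) (vecs B) \<longleftrightarrow> linear_of B N ` vecs B = vecs B"
  using surj_linear_of_imp_inj[OF assms, of N] by (auto simp: bij_betw_def)

section \<open>Factorizability\<close>

context decomposed_rmatrix
begin

abbreviation (input) GE where "GE \<equiv> G_E n Gs E"

interpretation S: half_opposite_rmatrix G "coeff RR" "reversed_part E" GE
  by (rule half_opposite_rmatrix)

abbreviation (input) B where "B \<equiv> carrier G \<times> carrier G"

abbreviation (input) N where "N \<equiv> double_matrix G S.A S.A S.b S.q"

lemma Psi_map_linear: "Psi_map G RR = linear_of B N"
  by (rule S.Psi_map_eq) simp

lemma Theta_apply:
  "Theta n Gs E a (w, k) = (if w \<in> carrier G \<and> k \<in> carrier G then a (S.theta_of w, S.theta_of k) else 0)"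
proof -
  have "Theta n Gs E a (w, k) = (\<Sum>(y, x)\<in>B. if y = S.theta_of w \<and> x = S.theta_of k
      then if w \<in> carrier G \<and> k \<in> carrier G then a (y, x) else 0 else 0)"
    unfolding Theta_def
  proof (intro sum.cong refl, clarify)
    fix y x assume c: "y \<in> carrier G" "x \<in> carrier G"
    have eq: "S.theta_of c = w' \<longleftrightarrow> w' \<in> carrier G \<and> c = S.theta_of w'" if "c \<in> carrier G" for c w'
      using that S.theta_theta by auto
    show "a (y, x) * \<delta> (theta n Gs E y, theta n Gs E x) (w, k) =
        (if y = S.theta_of w \<and> x = S.theta_of k then if w \<in> carrier G \<and> k \<in> carrier G then a (y, x) else 0 else 0)"
      using c eq[of y w] eq[of x k] by (auto simp: \<delta>_apply theta_eq)
  qed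
  then show ?thesis by (auto simp: sum_delta_product[OF finite_G finite_G])
qed

lemma Theta_Theta: "a \<in> vecs B \<Longrightarrow> Theta n Gs E (Theta n Gs E a) = a"
  by (rule ext) (auto simp: Theta_apply S.theta_theta vecs_def)

lemma Theta_vecs: "Theta n Gs E a \<in> vecs B"
  by (auto simp: vecs_def Theta_apply)

text \<open>
  \<open>\<Theta>\<close> reindexes the result of \<open>\<Psi>\<^sub>R\<close> by \<open>\<theta>\<close>; this turns the matrix into one that refers to the
  multiplication of \<open>G\<^sub>E\<close> only.
\<close>

lemma Psi_linear:
  "Psi n Gs RR = linear_of B
     (double_matrix GE (S.A \<circ> S.theta_of) (S.theta_of \<circ> S.A) (\<lambda>x w. S.b x (S.theta_of w)) (\<lambda>c d. S.q c (S.theta_of d)))"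
    (is "_ = linear_of B ?M")
proof (intro ext)
  fix a :: "(nat \<Rightarrow> 'a) \<times> (nat \<Rightarrow> 'a) \<Rightarrow> 'k" and v :: "(nat \<Rightarrow> 'a) \<times> (nat \<Rightarrow> 'a)"
  obtain w k where v: "v = (w, k)" by (metis surj_pair)
  have "Psi n Gs RR a v = Theta n Gs E (linear_of B N a) (w, k)"
    by (simp add: Psi_def Psi_map_linear v)
  also have "\<dots> = linear_of B ?M a v"
  proof (cases "w \<in> carrier G \<and> k \<in> carrier G")
    case True
    then show ?thesis
      unfolding v Theta_apply linear_of_def
      by (simp, intro sum.cong refl) (auto simp: S.double_matrix_transported)
  next
    case False
    then show ?thesis
      unfolding v Theta_apply linear_of_def
      by (auto simp: double_matrix_outside carrier_G_E)
  qed
  finally show "Psi n Gs RR a v = linear_of B ?M a v" .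
qed

lemma Psi_Hopf_End: "Psi n Gs RR \<in> Hopf_End (double GE)"
  unfolding Psi_linear using S.Hopf_End_transported by (simp add: carrier_G_E)

lemma F_map_cong:
  "(\<And>w. w \<in> basis H \<Longrightarrow> \<phi> w = \<psi> w) \<Longrightarrow> F_map H T \<phi> = F_map H T \<psi>"
  by (simp add: F_map_def)

text \<open>
  Reindexing by the permutation \<open>\<sigma>\<close> turns one map into the other. Functions are cut off outside the
  basis because \<open>\<sigma>\<close> is controlled only on it.
\<close>

lemma images_eq:
  "F_map (double G) (monodromy (double G) RR) ` vecs B = Psi_map G RR ` vecs B"
    (is "?F ` _ = _")
proof
  show "?F ` vecs B \<subseteq> Psi_map G RR ` vecs B"
  proof clarify
    fix \<phi> :: "(nat \<Rightarrow> 'a) \<times> (nat \<Rightarrow> 'a) \<Rightarrow> 'k"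
    define \<psi> where "\<psi> w = (if w \<in> B then \<phi> (the_inv_into B S.\<sigma> w) else 0)" for w
    have "\<phi> w = (\<psi> \<circ> S.\<sigma>) w" if "w \<in> B" for w
      using that S.bij_\<sigma> the_inv_into_f_f[of S.\<sigma> B w] bij_betwE[OF S.bij_\<sigma>] by (auto simp: \<psi>_def bij_betw_def)
    then have "?F \<phi> = ?F (\<psi> \<circ> S.\<sigma>)" by (intro F_map_cong) (simp only: basis_double)
    also have "\<dots> = Psi_map G RR \<psi>" unfolding Psi_map_linear by (rule S.F_map_monodromy_eq) simp
    finally show "?F \<phi> \<in> Psi_map G RR ` vecs B" by (auto simp: vecs_def \<psi>_def)
  qed
  show "Psi_map G RR ` vecs B \<subseteq> ?F ` vecs B"
  proof clarify
    fix \<psi> :: "(nat \<Rightarrow> 'a) \<times> (nat \<Rightarrow> 'a) \<Rightarrow> 'k"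
    define \<phi> where "\<phi> w = (if w \<in> B then \<psi> (S.\<sigma> w) else 0)" for w
    have "Psi_map G RR \<psi> = ?F (\<psi> \<circ> S.\<sigma>)"
      unfolding Psi_map_linear by (rule S.F_map_monodromy_eq[symmetric]) simp
    also have "\<dots> = ?F \<phi>" by (rule F_map_cong) (simp add: basis_double \<phi>_def)
    finally show "Psi_map G RR \<psi> \<in> ?F ` vecs B" by (auto simp: vecs_def \<phi>_def)
  qed
qed

lemma Psi_surj_iff: "Psi n Gs RR ` vecs B = vecs B \<longleftrightarrow> Psi_map G RR ` vecs B = vecs B"
proof -
  have P: "Psi_map G RR a \<in> vecs B" for a
    unfolding Psi_map_linear linear_of_def vecs_def by (auto simp: double_matrix_outside)
  have "Psi n Gs RR ` vecs B = Theta n Gs E ` Psi_map G RR ` vecs B" by (simp add: Psi_def image_comp)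
  moreover have "Theta n Gs E ` Psi n Gs RR ` vecs B = Psi_map G RR ` vecs B"
    by (simp add: Psi_def image_image Theta_Theta P)
  moreover have "Theta n Gs E ` vecs B = (vecs B :: ((nat \<Rightarrow> 'a) \<times> (nat \<Rightarrow> 'a) \<Rightarrow> 'k) set)"
  proof (intro equalityI subsetI)
    fix a :: "(nat \<Rightarrow> 'a) \<times> (nat \<Rightarrow> 'a) \<Rightarrow> 'k"
    assume "a \<in> vecs B"
    then show "a \<in> Theta n Gs E ` vecs B"
      by (intro image_eqI[of _ _ "Theta n Gs E a"]) (simp_all add: Theta_Theta Theta_vecs)
  qed (auto simp: Theta_vecs)
  ultimately show ?thesis by metis
qed

lemma factorizable_iff: "factorizable (double G) RR \<longleftrightarrow> Psi n Gs RR \<in> Hopf_Aut (double GE)"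
proof -
  have fin: "finite B" using finite_G by simp
  have F: "F_map (double G) (monodromy (double G) RR) = linear_of B (\<lambda>x y. monodromy (double G) RR (x, y))"
    by (simp add: F_map_def linear_of_def basis_double fun_eq_iff)
  have "factorizable (double G) RR \<longleftrightarrow> F_map (double G) (monodromy (double G) RR) ` vecs B = vecs B"
    unfolding factorizable_def basis_double F by (rule bij_linear_of_iff[OF fin])
  also have "\<dots> \<longleftrightarrow> Psi n Gs RR ` vecs B = vecs B" unfolding images_eq Psi_surj_iff ..
  also have "\<dots> \<longleftrightarrow> bij_betw (Psi n Gs RR) (vecs B) (vecs B)"
    unfolding Psi_linear by (rule bij_linear_of_iff[OF fin, symmetric])
  finally show ?thesis using Psi_Hopf_End by (simp add: Hopf_Aut_def basis_double carrier_G_E)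
qed

end

theorem theorem8p5:
  fixes n :: nat
    and Gs :: "nat \<Rightarrow> 'a monoid"
    and R :: "((nat \<Rightarrow> 'a) \<times> (nat \<Rightarrow> 'a)) \<times> ((nat \<Rightarrow> 'a) \<times> (nat \<Rightarrow> 'a)) \<Rightarrow> 'k::field"
    and G :: "(nat \<Rightarrow> 'a) monoid" and E :: "nat set"
  assumes fin: "\<And>i. i \<le> n \<Longrightarrow> finite (carrier (Gs i))"
    and abel: "comm_group (Gs 0)"
    and indec: "\<And>i. 1 \<le> i \<Longrightarrow> i \<le> n \<Longrightarrow> indecomposable_group (Gs i) \<and> \<not> comm_group (Gs i)"
    and G: "G = prod_group n Gs"
    and R: "quasitriangular (double G) R"
    and E: "E = E_set n Gs R"
  shows "Psi n Gs R \<in> Hopf_End (double (G_E n Gs E)) \<and>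
    F_map (double G) (monodromy (double G) R) ` vecs (basis (double G :: (_, 'k) bialg))
      = Psi_map G R ` vecs (basis (double (G_E n Gs E) :: (_, 'k) bialg)) \<and>
    (factorizable (double G) R \<longleftrightarrow> Psi n Gs R \<in> Hopf_Aut (double (G_E n Gs E)))"
proof -
  interpret decomposed_rmatrix n Gs R
    using fin abel indec R[unfolded G]
    by (intro decomposed_rmatrix.intro decomposed_group.intro decomposed_rmatrix_axioms.intro) auto
  show ?thesis
    unfolding G E basis_double carrier_G_E
    using Psi_Hopf_End images_eq factorizable_iff by blast
qed

end
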